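(* Let $d\ge 1$ and let $S_1,\dots,S_d$ be commuting invertible measure preserving transformations of a standard probability space $(X,\mu)$. Define $T_1=S_1$ and $T_i=S_iS_1^{-1}$ for $2\le i\le d$, and let $|\!|\!|\cdot|\!|\!|$ denote the box seminorm on $L^\infty(\mu)$ associated to the system $(X,\mu,T_d,\dots,T_2,T_1)$ (transformations taken in this order). Then, for every $f_1,\dots,f_d\in L^\infty(\mu)$ with $\|f_i\|_{L^\infty(\mu)}\le 1$ for $2\le i\le d$, we have $$\limsup_{j\to+\infty}\Bigl\|\frac1{|I_j|}\sum_{n\in I_j}S_1^nf_1\cdot S_2^nf_2\cdots S_d^nf_d\Bigr\|_{L^2(\mu)}\le |\!|\!|f_1|\!|\!|$$ for every sequence $(I_j: j\ge 1)$ of intervals in $\mathbb Z$ whose lengths $|I_j|$ tend to infinity.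
   Context: All functions are measurable and real valued; sets, functions and $\sigma$-algebras are considered modulo null sets; for a transformation $T$ and a function $f$, $Tf=f\circ T$. For a measure preserving transformation $S$ of a probability space $(Y,\nu)$, $\mathcal I(S)$ is the $\sigma$-algebra of $S$-invariant sets, and $\nu\times_{\mathcal I(S)}\nu$ is the measure on $Y\times Y$ characterized by $\int f(y)f'(y')\,d(\nu\times_{\mathcal I(S)}\nu)(y,y')=\int \mathbb E_\nu(f\mid\mathcal I(S))\,\mathbb E_\nu(f'\mid\mathcal I(S))\,d\nu$ for all bounded measurable $f,f'$ on $Y$. Points of $X^{2^k}$ are written $x=(x_\epsilon:\epsilon\in\{0,1\}^k)$, and $X^{2^{k+1}}$ is identified with $X^{2^k}\times X^{2^k}$ via $x\mapsto\bigl((x_{\eta 0})_{\eta\in\{0,1\}^k},(x_{\eta1})_{\eta\in\{0,1\}^k}\bigr)$. Box measure: given commuting invertible measure preserving transformations $R_1,\dots,R_d$ of $(X,\mu)$, put $\mu_{R_1}=\mu\times_{\mathcal I(R_1)}\mu$ on $X^2$ and, inductively for $1\le k<d$, $\mu_{R_1,\dots,R_{k+1}}=\mu_{R_1,\dots,R_k}\times_{\mathcal I(R_{k+1}\times\dots\times R_{k+1})}\mu_{R_1,\dots,R_k}$ on $X^{2^{k+1}}$, where $R_{k+1}\times\dots\times R_{k+1}$ ($2^k$ factors) acts diagonally on $X^{2^k}$. Box seminorm: for $f\in L^\infty(\mu)$, the box seminorm of $f$ associated to the system $(X,\mu,R_1,\dots,R_d)$ is $\bigl(\int\prod_{\epsilon\in\{0,1\}^d}f(x_\epsilon)\,d\mu_{R_1,\dots,R_d}(x)\bigr)^{1/2^d}$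 (the integral is nonnegative). Here it is applied with $(R_1,\dots,R_d)=(T_d,\dots,T_1)$. *)

theory Defs
  imports "HOL-Probability.Probability"
begin

locale standard_prob_space = prob_space M for M :: "'a measure" +
  assumes standard:
    "\<exists>X. topspace X = space M \<and> completely_metrizable_space X \<and> second_countable X
         \<and> sets M = sigma_sets (space M) {U. openin X U}"

definition invertible_mpt :: "'a measure \<Rightarrow> ('a \<Rightarrow> 'a) \<Rightarrow> bool" where
  "invertible_mpt M S \<longleftrightarrow>
     S \<in> M \<rightarrow>\<^sub>M M \<and> distr M M S = M \<and>
     bij_betw S (space M) (space M) \<and> inv_into (space M) S \<in> M \<rightarrow>\<^sub>M M"

definition int_iterate :: "'a measure \<Rightarrow> ('a \<Rightarrow> 'a) \<Rightarrow> int \<Rightarrow> 'a \<Rightarrow> 'a" where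
  "int_iterate M S n =
     (if 0 \<le> n then S ^^ nat n else inv_into (space M) S ^^ nat (- n))"

definition L_infty :: "'a measure \<Rightarrow> ('a \<Rightarrow> real) set" where
  "L_infty M = {f \<in> borel_measurable M. esssup M (\<lambda>x. ereal \<bar>f x\<bar>) < \<infinity>}"

definition L2_norm :: "'a measure \<Rightarrow> ('a \<Rightarrow> real) \<Rightarrow> real" where
  "L2_norm M f = sqrt (\<integral>x. (f x)\<^sup>2 \<partial>M)"

(* Invariance is equality of A with its preimage modulo null sets.  The family below is already
   closed under countable unions and complements when S preserves N. *)
definition invariant_algebra :: "'a measure \<Rightarrow> ('a \<Rightarrow> 'a) \<Rightarrow> 'a measure" where
  "invariant_algebra N S =
     sigma (space N) {A \<in> sets N. AE y in N. S y \<in> A \<longleftrightarrow> y \<in> A}"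

(* The relatively independent square of N over the S-invariant sets.  At most one measure P has
   the stated properties, since the rectangles generate the product sigma-algebra; existence uses
   standardness of N. *)
definition rel_square :: "'a measure \<Rightarrow> ('a \<Rightarrow> 'a) \<Rightarrow> ('a \<times> 'a) measure" where
  "rel_square N S = (THE P.
     sets P = sets (N \<Otimes>\<^sub>M N) \<and>
     (\<forall>f\<in>borel_measurable N. \<forall>f'\<in>borel_measurable N.
        bounded (f ` space N) \<longrightarrow> bounded (f' ` space N) \<longrightarrow>
        (\<integral>z. f (fst z) * f' (snd z) \<partial>P) =
        (\<integral>y. real_cond_exp N (invariant_algebra N S) f y *
              real_cond_exp N (invariant_algebra N S) f' y \<partial>N)))"

text \<open>
  The index set \<open>{0,1}\<^sup>k\<close> consists of the Boolean lists of length \<open>k\<close>, and a point of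
  \<open>X\<close> to the power \<open>2\<^sup>k\<close> is an extensional function on it.
\<close>

definition cube :: "nat \<Rightarrow> bool list set" where
  "cube k = {e. length e = k}"

definition diagonal_map :: "nat \<Rightarrow> ('a \<Rightarrow> 'a) \<Rightarrow> (bool list \<Rightarrow> 'a) \<Rightarrow> (bool list \<Rightarrow> 'a)" where
  "diagonal_map k S x = (\<lambda>e\<in>cube k. S (x e))"

(* The new coordinate is the last one: the first component collects the indices ending in False. *)
definition cube_join ::
    "nat \<Rightarrow> (bool list \<Rightarrow> 'a) \<times> (bool list \<Rightarrow> 'a) \<Rightarrow> (bool list \<Rightarrow> 'a)" where
  "cube_join k z = (\<lambda>e\<in>cube (Suc k). if last e then snd z (butlast e) else fst z (butlast e))"

text \<open>
  \<open>box_measure M R k\<close> uses the maps \<open>R 1, \<dots>, R k\<close>, in this order. The recursion starts at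
  \<open>k = 0\<close> with \<open>M\<close> itself, carried by functions on the one-point index set; its first step
  is then the relatively independent square of \<open>M\<close> over the \<open>R 1\<close>-invariant sets.
\<close>

primrec box_measure ::
    "'a measure \<Rightarrow> (nat \<Rightarrow> 'a \<Rightarrow> 'a) \<Rightarrow> nat \<Rightarrow> (bool list \<Rightarrow> 'a) measure" where
  "box_measure M R 0 = distr M (PiM (cube 0) (\<lambda>_. M)) (\<lambda>x. \<lambda>e\<in>cube 0. x)"
| "box_measure M R (Suc k) =
     distr (rel_square (box_measure M R k) (diagonal_map k (R (Suc k))))
           (PiM (cube (Suc k)) (\<lambda>_. M)) (cube_join k)"

definition box_seminorm ::
    "'a measure \<Rightarrow> (nat \<Rightarrow> 'a \<Rightarrow> 'a) \<Rightarrow> nat \<Rightarrow> ('a \<Rightarrow> real) \<Rightarrow> real" where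
  "box_seminorm M R d f =
     root (2 ^ d) (\<integral>x. (\<Prod>e\<in>cube d. f (x e)) \<partial>(box_measure M R d))"

end

theory Submission
  imports Defs "HOL-Library.Function_Algebras"
begin

text \<open>
  The proof is by induction on the number \<open>d\<close> of transformations. Write \<open>u n\<close> for the product of the
  functions \<open>f i \<circ> S i ^ n\<close>. By van der Corput's inequality, the upper limit of the squared norms of the
  averages of \<open>u\<close> is at most the mean, over pairs \<open>h, h' < H\<close>, of upper limits of the correlations: the
  averages over \<open>n\<close> of the integrals of \<open>u n \<cdot> u (n + \<bar>h - h'\<bar>)\<close>. As \<open>S 2\<close> preserves the measure,
  each of these integrals is unchanged when the inverse of \<open>S 2 ^ n\<close> is applied to the integrand. The
  correlation of order \<open>h\<close> then is the integral of a function bounded by \<open>1\<close>, namely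
  \<open>f 2 \<cdot> f 2 \<circ> S 2 ^ h\<close>, against an average of the original kind, for the \<open>d - 1\<close> maps
  \<open>S 1 \<circ> S 2\<inverse>, S 3 \<circ> S 2\<inverse>, \<dots>, S d \<circ> S 2\<inverse>\<close> and the functions \<open>f i \<cdot> f i \<circ> S i ^ h\<close>. The
  induction hypothesis bounds it by the seminorm of \<open>f 1 \<cdot> f 1 \<circ> S 1 ^ h\<close> for the quotients of the new
  maps by the first of them. These are \<open>T d, \<dots>, T 3\<close>, followed by the new first map, which is the
  inverse of \<open>T 2\<close> and hence has the same invariant sets as \<open>T 2\<close>: eliminating the second map leaves the
  others in the order of the box measure. For \<open>d = 1\<close> the correlation is itself the integral of
  \<open>f 1 \<cdot> f 1 \<circ> S 1 ^ h\<close>.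

  Let \<open>F\<close> be the product of the \<open>2 ^ (d - 1)\<close> copies of \<open>f 1\<close> on the cube that carries the box measure
  of \<open>T d, \<dots>, T 2\<close>. The power \<open>2 ^ (d - 1)\<close> of the last seminorm is the integral of \<open>F \<cdot> F \<circ> D ^ h\<close>,
  where \<open>D\<close> applies \<open>T 1 = S 1\<close> to every coordinate. The mean of these integrals over the differences
  of pairs below \<open>H\<close> is the squared norm of the \<open>H\<close>-th ergodic average of \<open>F\<close>. By the ergodic theorem it
  converges to the squared norm of the conditional expectation of \<open>F\<close> on the \<open>D\<close>-invariant sets, which is
  the power \<open>2 ^ d\<close> of the seminorm of \<open>f 1\<close>. Convexity of \<open>t ^ 2 ^ (d - 1)\<close> transfers this from the
  powers to the seminorms. These steps are \<open>van_der_Corput\<close>, \<open>correlation_le_average\<close> and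
  \<open>seminorm_gap_average\<close>.

  Box measures are built from relatively independent squares, so it has to be shown that the latter exist
  (\<open>rel_square_is_rel_square\<close>). For a measure preserving map \<open>S\<close>, the value prescribed on a rectangle
  \<open>A \<times> B\<close> is, by the ergodic theorem, the limit of the averages of the measures of the intersections of
  \<open>A\<close> with the preimages of \<open>B\<close> under \<open>S ^ i\<close>, that is, of values of the measures carried by the graphs
  of the powers \<open>S ^ i\<close>. Limits of measures are additive, and on standard spaces compact inner and open
  outer approximation improve this to countable additivity. The same limit shows that a map commuting with
  \<open>S\<close> preserves the relatively independent square, which makes the recursion for box measures work.

  Commutation is only assumed up to null sets. The induction is therefore phrased for an action of an
  abelian group up to null sets, where composing and inverting maps becomes arithmetic in the group.
\<close>

section \<open>Measure preserving maps and their invariant sets\<close>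

definition mpt :: "'a measure \<Rightarrow> ('a \<Rightarrow> 'a) \<Rightarrow> bool" where
  "mpt N S \<longleftrightarrow> S \<in> N \<rightarrow>\<^sub>M N \<and> distr N N S = N"

lemma mpt_measurable [measurable_dest]: "mpt N S \<Longrightarrow> S \<in> N \<rightarrow>\<^sub>M N"
  by (simp add: mpt_def)

lemma mpt_AE:
  assumes "mpt N S" "AE y in N. P y"
  shows "AE y in N. P (S y)"
proof -
  have "distr N N S = N" using assms(1) by (simp add: mpt_def)
  then have "AE y in distr N N S. P y" using assms(2) by (simp only:)
  then show ?thesis using AE_distrD[OF mpt_measurable[OF assms(1)]] by blast
qed

lemma mpt_integral:
  fixes f :: "'a \<Rightarrow> real"
  assumes "mpt N S" "f \<in> borel_measurable N"
  shows "(\<integral>y. f (S y) \<partial>N) = (\<integral>y. f y \<partial>N)"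
  using integral_distr[OF mpt_measurable[OF assms(1)] assms(2)] assms(1) by (simp add: mpt_def)

lemma mpt_id: "mpt N (\<lambda>x. x)"
  by (simp add: mpt_def distr_id2)

lemma mpt_comp: "mpt N S \<Longrightarrow> mpt N R \<Longrightarrow> mpt N (S \<circ> R)"
  unfolding mpt_def by (metis distr_distr measurable_comp)

lemma mpt_funpow: "mpt N S \<Longrightarrow> mpt N (S ^^ n)"
proof (induction n)
  case 0
  then show ?case using mpt_id by (simp add: id_def)
next
  case (Suc n)
  then show ?case using mpt_comp[of N S "S ^^ n"] by (simp add: o_def)
qed

lemma mpt_measure:
  assumes "mpt N S" "A \<in> sets N"
  shows "measure N (S -` A \<inter> space N) = measure N A"
  using measure_distr[OF mpt_measurable[OF assms(1)] assms(2)] assms(1) by (simp add: mpt_def)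

lemma mpt_space: "mpt N S \<Longrightarrow> x \<in> space N \<Longrightarrow> S x \<in> space N"
  by (meson measurable_space mpt_measurable)

text \<open>
  Almost everywhere invariant sets form a \<open>\<sigma>\<close>-algebra because \<open>S\<close> maps the space to itself and a
  countable union of null sets is null.
\<close>

lemma sets_invariant_algebra:
  assumes S: "mpt N S"
  shows "sets (invariant_algebra N S) = {A \<in> sets N. AE y in N. S y \<in> A \<longleftrightarrow> y \<in> A}"
    (is "_ = ?F")
proof -
  have "sigma_algebra (space N) ?F"
  proof (rule sigma_algebra_iff2[THEN iffD2], intro conjI ballI allI impI)
    show "?F \<subseteq> Pow (space N)" using sets.sets_into_space by auto
    show "{} \<in> ?F" by simp
    show "space N - A \<in> ?F" if "A \<in> ?F" for A
    proof -
      have "AE y in N. S y \<in> A \<longleftrightarrow> y \<in> A" using that by auto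
      then have "AE y in N. S y \<in> space N - A \<longleftrightarrow> y \<in> space N - A"
        using AE_space by eventually_elim (use S mpt_space in fastforce)
      then show ?thesis using that by auto
    qed
    fix A :: "nat \<Rightarrow> 'a set"
    assume A: "range A \<subseteq> ?F"
    then have "AE y in N. \<forall>n. S y \<in> A n \<longleftrightarrow> y \<in> A n" by (auto simp: AE_all_countable)
    then have "AE y in N. S y \<in> (\<Union>n. A n) \<longleftrightarrow> y \<in> (\<Union>n. A n)" by eventually_elim auto
    then show "(\<Union>n. A n) \<in> ?F" using A by auto
  qed
  moreover have "?F \<subseteq> Pow (space N)" using sets.sets_into_space by auto
  ultimately show ?thesis unfolding invariant_algebra_def
    by (simp add: sigma_algebra.sigma_sets_eq)
qed

lemma space_invariant_algebra: "space (invariant_algebra N S) = space N"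
  unfolding invariant_algebra_def by (simp add: space_measure_of_conv)

lemma subalgebra_invariant_algebra: "mpt N S \<Longrightarrow> subalgebra N (invariant_algebra N S)"
  unfolding subalgebra_def by (auto simp: sets_invariant_algebra space_invariant_algebra)

text \<open>
  The superlevel sets of \<open>g\<close> at rational heights are invariant, and they determine \<open>g\<close>.
\<close>

lemma invariant_algebra_measurable_invariant:
  fixes g :: "'a \<Rightarrow> real"
  assumes S: "mpt N S" and g: "g \<in> borel_measurable (invariant_algebra N S)"
  shows "AE y in N. g (S y) = g y"
proof -
  have "AE y in N. g (S y) > of_rat q \<longleftrightarrow> g y > of_rat q" for q :: rat
  proof -
    have "{y \<in> space N. g y > of_rat q} \<in> sets (invariant_algebra N S)"
      using g space_invariant_algebra[of N S] by (metis borel_measurable_iff_greater)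
    then have "AE y in N. S y \<in> {y \<in> space N. g y > of_rat q} \<longleftrightarrow> y \<in> {y \<in> space N. g y > of_rat q}"
      unfolding sets_invariant_algebra[OF S] by auto
    then show ?thesis using AE_space by eventually_elim (use mpt_space[OF S] in auto)
  qed
  then have "AE y in N. \<forall>q::rat. g (S y) > of_rat q \<longleftrightarrow> g y > of_rat q"
    by (auto simp: AE_all_countable)
  then show ?thesis
  proof eventually_elim
    case (elim y)
    then show ?case by (metis linorder_neqE_linordered_idom of_rat_dense order_less_asym)
  qed
qed

section \<open>The ergodic theorem\<close>

text \<open>
  The maximum of \<open>0\<close> and the first \<open>n\<close> ergodic sums of \<open>h\<close>. In the recursive form, the maximal
  inequality compares two consecutive maxima, at \<open>x\<close> and at \<open>S x\<close>.
\<close>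

primrec max_sum :: "('a \<Rightarrow> real) \<Rightarrow> ('a \<Rightarrow> 'a) \<Rightarrow> nat \<Rightarrow> 'a \<Rightarrow> real" where
  "max_sum h S 0 x = 0"
| "max_sum h S (Suc n) x = max 0 (h x + max_sum h S n (S x))"

lemma max_sum_nonneg: "0 \<le> max_sum h S n x"
  by (cases n) auto

lemma max_sum_ge: "(\<Sum>i<n. h ((S ^^ i) x)) \<le> max_sum h S n x"
proof (induction n arbitrary: x)
  case (Suc n)
  have "(\<Sum>i<Suc n. h ((S ^^ i) x)) = h x + (\<Sum>i<n. h ((S ^^ i) (S x)))"
    by (simp add: sum.lessThan_Suc_shift funpow_swap1 del: sum.lessThan_Suc)
  also have "\<dots> \<le> h x + max_sum h S n (S x)" using Suc by simp
  also have "\<dots> \<le> max_sum h S (Suc n) x" by simp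
  finally show ?case .
qed auto

lemma max_sum_mono_Suc: "max_sum h S n x \<le> max_sum h S (Suc n) x"
proof (induction n arbitrary: x)
  case (Suc n)
  then show ?case
    unfolding max_sum.simps(2)[of h S "Suc n"] max_sum.simps(2)[of h S n x]
    by (intro max.mono add_left_mono) auto
qed (simp add: max_sum_nonneg)

lemma max_sum_mono: "m \<le> n \<Longrightarrow> max_sum h S m x \<le> max_sum h S n x"
  by (rule lift_Suc_mono_le[of "\<lambda>n. max_sum h S n x"]) (rule max_sum_mono_Suc)

lemma max_sum_le:
  assumes "\<And>x. \<bar>h x\<bar> \<le> C"
  shows "max_sum h S n x \<le> real n * C"
proof (induction n arbitrary: x)
  case (Suc n)
  have "0 \<le> C" using assms abs_ge_zero order_trans by blast
  moreover have "h x \<le> C" using assms[of x] by simp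
  ultimately show ?case using Suc[of "S x"] by (simp add: algebra_simps max_def)
qed auto

lemma max_sum_measurable:
  assumes [measurable]: "S \<in> N \<rightarrow>\<^sub>M N" "h \<in> borel_measurable N"
  shows "max_sum h S n \<in> borel_measurable N"
proof (induction n)
  case 0
  have "max_sum h S 0 = (\<lambda>x. 0)" by auto
  then show ?case by simp
next
  case (Suc n)
  note [measurable] = Suc
  have "max_sum h S (Suc n) = (\<lambda>x. max 0 (h x + max_sum h S n (S x)))" by auto
  then show ?case by simp
qed

text \<open>
  Where the maximum is positive, \<open>h\<close> is the difference of \<open>max_sum h S (Suc k)\<close> at \<open>x\<close> and
  \<open>max_sum h S k\<close> at \<open>S x\<close>; elsewhere this difference is at most \<open>0\<close>. Its integral is nonnegative,
  since \<open>S\<close> preserves the measure and the maxima increase with \<open>n\<close>.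
\<close>

lemma maximal_ergodic:
  assumes "prob_space N" and S: "mpt N S" and [measurable]: "h \<in> borel_measurable N"
    and C: "\<And>x. \<bar>h x\<bar> \<le> C"
  shows "0 \<le> (\<integral>x. indicator {x. 0 < max_sum h S n x} x * h x \<partial>N)"
proof (cases n)
  case 0
  then show ?thesis by simp
next
  case (Suc k)
  interpret prob_space N by fact
  note [measurable] = mpt_measurable[OF S] max_sum_measurable[of S N h]
  have C0: "0 \<le> C" using C abs_ge_zero order_trans by blast
  have int: "integrable N (max_sum h S j)" for j
    by (rule integrable_const_bound[of _ "real j * C"])
      (use max_sum_le[of h C S j] max_sum_nonneg[of h S j] C in auto)
  have int': "integrable N (\<lambda>x. max_sum h S j (S x))" for j
    by (rule integrable_const_bound[of _ "real j * C"])
      (use max_sum_le[of h C S j] max_sum_nonneg[of h S j] C in auto)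
  have "(\<integral>x. max_sum h S k x \<partial>N) \<le> (\<integral>x. max_sum h S n x \<partial>N)"
    by (rule integral_mono[OF int int]) (simp add: Suc max_sum_mono_Suc del: max_sum.simps)
  then have "0 \<le> (\<integral>x. max_sum h S n x - max_sum h S k (S x) \<partial>N)"
    using mpt_integral[OF S, of "max_sum h S k"] by (simp add: int int' del: max_sum.simps)
  also have "\<dots> \<le> (\<integral>x. indicator {x. 0 < max_sum h S n x} x * h x \<partial>N)"
  proof (rule integral_mono)
    show "integrable N (\<lambda>x. max_sum h S n x - max_sum h S k (S x))" using int int' by simp
    show "integrable N (\<lambda>x. indicator {x. 0 < max_sum h S n x} x * h x)"
      by (rule integrable_const_bound[of _ C]) (auto simp: indicator_def C C0)
    show "max_sum h S n x - max_sum h S k (S x) \<le> indicator {x. 0 < max_sum h S n x} x * h x" for x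
      using max_sum_nonneg[of h S k "S x"] by (auto simp: Suc indicator_def max_def)
  qed
  finally show ?thesis .
qed

text \<open>
  The set \<open>E\<close> on which the ergodic sums of \<open>f - e\<close> have no upper bound is strictly invariant, and every
  point of \<open>E\<close> has a positive ergodic sum. The maximal inequality on \<open>E\<close> gives that \<open>f - e\<close> has
  nonnegative integral over \<open>E\<close>. But the integral of \<open>f\<close> over \<open>E\<close> is zero, so \<open>E\<close> is null.
\<close>

lemma ergodic_sums_bounded_above:
  assumes "prob_space N" and S: "mpt N S" and [measurable]: "f \<in> borel_measurable N"
    and C: "\<And>x. \<bar>f x\<bar> \<le> C"
    and zero: "\<And>A. A \<in> sets (invariant_algebra N S) \<Longrightarrow> (\<integral>x. indicator A x * f x \<partial>N) = 0"
    and e: "0 < e"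
  shows "AE x in N. \<exists>m. \<forall>k. (\<Sum>i<k. f ((S ^^ i) x) - e) \<le> real m"
proof -
  interpret prob_space N by fact
  note [measurable] = mpt_measurable[OF S] mpt_measurable[OF mpt_funpow[OF S]]
  define s where "s k x = (\<Sum>i<k. f ((S ^^ i) x) - e)" for k x
  have [measurable]: "s k \<in> borel_measurable N" for k
    unfolding s_def by measurable
  have s_Suc: "s (Suc k) x = f x - e + s k (S x)" for k x
    unfolding s_def by (simp add: sum.lessThan_Suc_shift funpow_swap1 del: sum.lessThan_Suc)
  define E where "E = {x \<in> space N. \<forall>m. \<exists>k. real m < s k x}"
  have E[measurable]: "E \<in> sets N" unfolding E_def by measurable
  have C0: "0 \<le> C" using C abs_ge_zero order_trans by blast
  obtain c :: nat where c: "C + e \<le> real c" using real_arch_simple by blast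
  have c': "\<bar>f x - e\<bar> \<le> real c" for x using C[of x] c e by linarith
  have inv: "S x \<in> E \<longleftrightarrow> x \<in> E" if x: "x \<in> space N" for x
  proof -
    have "(\<forall>m. \<exists>k. real m < s k x) \<longleftrightarrow> (\<forall>m. \<exists>k. real m < s k (S x))"
    proof (intro iffI allI)
      fix m assume "\<forall>m. \<exists>k. real m < s k x"
      then obtain k where k: "real (m + c) < s k x" by blast
      show "\<exists>k. real m < s k (S x)"
      proof (cases k)
        case 0
        then show ?thesis using k by (simp add: s_def)
      next
        case (Suc j)
        then show ?thesis using k s_Suc[of j x] c'[of x] by (intro exI[of _ j]) simp
      qed
    next
      fix m assume "\<forall>m. \<exists>k. real m < s k (S x)"
      then obtain k where k: "real (m + c) < s k (S x)" by blast
      then show "\<exists>k. real m < s k x"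
        using s_Suc[of k x] c'[of x] by (intro exI[of _ "Suc k"]) simp
    qed
    then show ?thesis unfolding E_def using x mpt_space[OF S x] by simp
  qed
  have Einv: "E \<in> sets (invariant_algebra N S)"
    using inv AE_I2[of N] unfolding sets_invariant_algebra[OF S] by auto
  define h where "h x = indicator E x * (f x - e)" for x
  have [measurable]: "h \<in> borel_measurable N" unfolding h_def by measurable
  have [measurable]: "max_sum h S n \<in> borel_measurable N" for n
    by (rule max_sum_measurable) measurable
  have h: "\<bar>h x\<bar> \<le> real c" for x using c'[of x] by (auto simp: h_def indicator_def)
  have pow: "(S ^^ i) x \<in> E" if "x \<in> E" for x i
  proof (induction i)
    case (Suc i)
    then show ?case using inv[of "(S ^^ i) x"] by (simp add: E_def)
  qed (use that in simp)
  have "(\<lambda>n. \<integral>x. indicator {x. 0 < max_sum h S n x} x * h x \<partial>N) \<longlonglongrightarrow> (\<integral>x. h x \<partial>N)"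
  proof (rule integral_dominated_convergence[where w = "\<lambda>_. real c"])
    show "AE x in N. (\<lambda>n. indicator {x. 0 < max_sum h S n x} x * h x) \<longlonglongrightarrow> h x"
    proof (rule AE_I2)
      fix x assume "x \<in> space N"
      show "(\<lambda>n. indicator {x. 0 < max_sum h S n x} x * h x) \<longlonglongrightarrow> h x"
      proof (cases "x \<in> E")
        case True
        then obtain k where "real 0 < s k x" unfolding E_def by blast
        then have "0 < s k x" by simp
        moreover have "s k x = (\<Sum>i<k. h ((S ^^ i) x))"
          using pow[OF True] by (simp add: s_def h_def)
        ultimately have "0 < max_sum h S k x" using max_sum_ge[where h=h and S=S and x=x and n=k] by simp
        then have "0 < max_sum h S n x" if "n \<ge> k" for n
          using max_sum_mono[OF that, of h S x] by simp
        then have "\<forall>\<^sub>F n in sequentially. indicator {x. 0 < max_sum h S n x} x * h x = h x"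
          by (auto simp: eventually_sequentially intro!: exI[of _ k])
        then show ?thesis by (rule tendsto_eventually)
      qed (simp add: h_def)
    qed
  qed (auto simp: indicator_def h)
  then have "0 \<le> (\<integral>x. h x \<partial>N)"
    by (rule LIMSEQ_le_const) (use maximal_ergodic[OF \<open>prob_space N\<close> S _ h] in auto)
  moreover have "(\<integral>x. h x \<partial>N) = (\<integral>x. indicator E x * f x \<partial>N) - e * measure N E"
  proof -
    have 1: "integrable N (\<lambda>x. indicator E x * f x)"
      by (rule integrable_const_bound[of _ C]) (use C C0 in \<open>auto simp: indicator_def\<close>)
    have 2: "integrable N (\<lambda>x. e * indicator E x)"
      by (rule integrable_const_bound[of _ e]) (use e in \<open>auto simp: indicator_def\<close>)
    have "(\<integral>x. h x \<partial>N) = (\<integral>x. indicator E x * f x - e * indicator E x \<partial>N)"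
      by (simp add: h_def algebra_simps)
    also have "\<dots> = (\<integral>x. indicator E x * f x \<partial>N) - e * measure N E"
      using Bochner_Integration.integral_diff[OF 1 2] by simp
    finally show ?thesis .
  qed
  ultimately have "e * measure N E \<le> 0" using zero[OF Einv] by simp
  then have "measure N E = 0" using e by (simp add: mult_le_0_iff measure_le_0_iff)
  then have "E \<in> null_sets N" by (simp add: null_sets_def emeasure_eq_measure)
  then have "AE x in N. x \<notin> E" by (rule AE_not_in)
  then show ?thesis using AE_space unfolding E_def s_def[symmetric]
    by eventually_elim (auto simp: not_less)
qed

text \<open>
  If the sums of \<open>f - e\<close> and of \<open>- f - e\<close> are bounded above, then the averages of \<open>f\<close> are
  eventually within \<open>2 * e\<close> of zero.
\<close>

lemma ergodic_theorem_mean_zero: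
  assumes N: "prob_space N" and S: "mpt N S" and [measurable]: "f \<in> borel_measurable N"
    and C: "\<And>x. \<bar>f x\<bar> \<le> C"
    and zero: "\<And>A. A \<in> sets (invariant_algebra N S) \<Longrightarrow> (\<integral>x. indicator A x * f x \<partial>N) = 0"
  shows "AE x in N. (\<lambda>k. (\<Sum>i<k. f ((S ^^ i) x)) / real k) \<longlonglongrightarrow> 0"
proof -
  have "AE x in N. \<exists>m. \<forall>k. (\<Sum>i<k. g ((S ^^ i) x) - 1 / real (Suc n)) \<le> real m"
    if "g = f \<or> g = (\<lambda>x. - f x)" for g n
    by (rule ergodic_sums_bounded_above[OF N S, where C = C]) (use that C zero in \<open>auto\<close>)
  then have "AE x in N. \<forall>n. \<exists>m. \<forall>k. (\<Sum>i<k. f ((S ^^ i) x) - 1 / real (Suc n)) \<le> real m"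
    "AE x in N. \<forall>n. \<exists>m. \<forall>k. (\<Sum>i<k. - f ((S ^^ i) x) - 1 / real (Suc n)) \<le> real m"
    by (simp_all only: AE_all_countable) auto
  then show ?thesis
  proof eventually_elim
    case (elim x)
    define a where "a k = (\<Sum>i<k. f ((S ^^ i) x))" for k
    show ?case
    proof (rule LIMSEQ_I)
      fix r :: real assume "0 < r"
      then obtain n where n: "1 / real (Suc n) < r / 2" using nat_approx_posE[of "r/2"] by auto
      obtain m1 where m1: "\<And>k. a k - k / real (Suc n) \<le> real m1"
        using elim(1) by (force simp: a_def sum_subtractf)
      obtain m2 where m2: "\<And>k. - a k - k / real (Suc n) \<le> real m2"
        using elim(2) by (force simp: a_def sum_subtractf sum_negf)
      define m where "m = max m1 m2"
      have m: "\<bar>a k\<bar> \<le> real m + k / real (Suc n)" for k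
        using m1[of k] m2[of k] by (auto simp: m_def)
      obtain k0 :: nat where k0: "2 * (real m + 1) / r < real k0" using reals_Archimedean2 by blast
      show "\<exists>no. \<forall>k\<ge>no. norm ((\<Sum>i<k. f ((S ^^ i) x)) / real k - 0) < r"
      proof (intro exI allI impI)
        fix k assume "k0 \<le> k"
        then have k: "2 * (real m + 1) / r < real k" using k0 by linarith
        then have kr: "2 * (real m + 1) < real k * r" using \<open>0 < r\<close> by (simp add: field_simps)
        have kpos: "0 < real k" using k \<open>0 < r\<close> by (meson divide_nonneg_pos le_less_trans mult_nonneg_nonneg of_nat_0_le_iff add_nonneg_nonneg zero_le_numeral zero_le_one)
        have "\<bar>a k\<bar> \<le> real m + k * (1 / real (Suc n))" using m[of k] by simp
        also have "\<dots> \<le> real m + k * (r / 2)"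
          using n by (intro add_left_mono mult_left_mono) auto
        also have "\<dots> < k * r" using kr by simp
        finally have "\<bar>a k\<bar> < r * k" by (simp add: mult.commute)
        then show "norm ((\<Sum>i<k. f ((S ^^ i) x)) / real k - 0) < r"
          using kpos by (simp add: a_def pos_divide_less_eq)
      qed
    qed
  qed
qed

lemma real_cond_exp_bounded:
  assumes "prob_space N" and sub: "subalgebra N F" and [measurable]: "f \<in> borel_measurable N"
    and C: "\<And>x. \<bar>f x\<bar> \<le> C"
  shows "AE x in N. \<bar>real_cond_exp N F f x\<bar> \<le> C"
proof -
  interpret prob_space N by fact
  interpret finite_measure_subalgebra N F by unfold_locales (rule sub)
  have f: "integrable N f" by (rule integrable_const_bound[of _ C]) (auto simp: C)
  have C': "f x \<le> C" "- C \<le> f x" for x using C[of x] by auto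
  have "AE x in N. real_cond_exp N F f x \<le> C"
    by (rule real_cond_exp_le_c[OF f]) (use C' in auto)
  moreover have "AE x in N. real_cond_exp N F f x \<ge> - C"
    by (rule real_cond_exp_ge_c[OF f]) (use C' in auto)
  ultimately show ?thesis by eventually_elim auto
qed

definition truncate :: "real \<Rightarrow> ('a \<Rightarrow> real) \<Rightarrow> 'a \<Rightarrow> real" where
  "truncate C f x = max (- C) (min C (f x))"

lemma truncate_measurable: "f \<in> borel_measurable M \<Longrightarrow> truncate C f \<in> borel_measurable M"
  unfolding truncate_def[abs_def]
  by (intro borel_measurable_max borel_measurable_min borel_measurable_const)

lemma truncate_bounded: "0 \<le> C \<Longrightarrow> \<bar>truncate C f x\<bar> \<le> C"
  by (auto simp: truncate_def)

lemma truncate_eq: "\<bar>f x\<bar> \<le> C \<Longrightarrow> truncate C f x = f x"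
  by (auto simp: truncate_def)

text \<open>
  The conditional expectation is an invariant function, so it equals its ergodic averages, and the
  difference from \<open>f\<close> has mean zero on every invariant set. Truncation replaces the conditional
  expectation by a version \<open>e\<close> that is bounded everywhere.
\<close>

lemma ergodic_theorem:
  assumes N: "prob_space N" and S: "mpt N S" and f[measurable]: "f \<in> borel_measurable N"
    and C: "\<And>x. \<bar>f x\<bar> \<le> C"
  shows "AE x in N. (\<lambda>k. (\<Sum>i<k. f ((S ^^ i) x)) / real k)
            \<longlonglongrightarrow> real_cond_exp N (invariant_algebra N S) f x"
proof -
  interpret prob_space N by fact
  let ?F = "invariant_algebra N S"
  have sub: "subalgebra N ?F" using S by (rule subalgebra_invariant_algebra)
  interpret finite_measure_subalgebra N ?F by unfold_locales (rule sub)
  have fint: "integrable N f" by (rule integrable_const_bound[of _ C]) (auto simp: C)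
  have C0: "0 \<le> C" using C abs_ge_zero order_trans by blast
  define e where "e = truncate C (real_cond_exp N ?F f)"
  have eF: "e \<in> borel_measurable ?F" unfolding e_def by (intro truncate_measurable borel_measurable_cond_exp)
  then have [measurable]: "e \<in> borel_measurable N" using measurable_from_subalg[OF sub] by blast
  have eC: "\<bar>e x\<bar> \<le> C" for x unfolding e_def by (rule truncate_bounded[OF C0])
  have eint: "integrable N e" by (rule integrable_const_bound[of _ C]) (auto simp: eC)
  have eeq: "AE x in N. e x = real_cond_exp N ?F f x"
    using real_cond_exp_bounded[OF N sub f C] unfolding e_def by eventually_elim (rule truncate_eq)
  have einv: "AE x in N. \<forall>i. e ((S ^^ i) x) = e x"
  proof (unfold AE_all_countable, rule allI)
    fix i show "AE x in N. e ((S ^^ i) x) = e x"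
    proof (induction i)
      case (Suc i)
      have "AE x in N. e (S ((S ^^ i) x)) = e ((S ^^ i) x)"
        using mpt_AE[OF mpt_funpow[OF S] invariant_algebra_measurable_invariant[OF S eF]] .
      then show ?case using Suc by eventually_elim simp
    qed simp
  qed
  have "AE x in N. (\<lambda>k. (\<Sum>i<k. f ((S ^^ i) x) - e ((S ^^ i) x)) / real k) \<longlonglongrightarrow> 0"
  proof (rule ergodic_theorem_mean_zero[OF N S])
    show "\<bar>f x - e x\<bar> \<le> 2 * C" for x using C[of x] eC[of x] by linarith
    fix A assume A: "A \<in> sets ?F"
    then have [measurable]: "A \<in> sets N" using sub by (auto simp: subalgebra_def)
    have i: "integrable N (\<lambda>x. indicator A x * f x)" "integrable N (\<lambda>x. indicator A x * e x)"
      by (rule integrable_const_bound[of _ C]; use C C0 eC in \<open>auto simp: indicator_def\<close>)+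
    have "(\<integral>x. indicator A x * e x \<partial>N) = (\<integral>x. indicator A x * real_cond_exp N ?F f x \<partial>N)"
      by (rule integral_cong_AE) (use eeq in auto)
    also have "\<dots> = (\<integral>x. indicator A x * f x \<partial>N)"
      using real_cond_exp_intA[OF fint A] by (simp add: set_lebesgue_integral_def)
    finally show "(\<integral>x. indicator A x * (f x - e x) \<partial>N) = 0"
      using i by (simp add: right_diff_distrib)
  qed simp
  then show ?thesis using einv eeq
  proof eventually_elim
    case (elim x)
    have "(\<lambda>k. (\<Sum>i<k. f ((S ^^ i) x) - e ((S ^^ i) x)) / real k + e x) \<longlonglongrightarrow> 0 + e x"
      by (intro tendsto_add elim tendsto_const)
    moreover have "\<forall>\<^sub>F k in sequentially.
        (\<Sum>i<k. f ((S ^^ i) x) - e ((S ^^ i) x)) / real k + e x = (\<Sum>i<k. f ((S ^^ i) x)) / real k"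
      using eventually_gt_at_top[of 0]
      by eventually_elim (simp add: elim(2) sum_subtractf diff_divide_distrib)
    ultimately show ?case using elim(3) by (simp add: tendsto_cong)
  qed
qed

lemma set_average_bounded:
  fixes f :: "'b \<Rightarrow> real"
  assumes C: "\<And>n. \<bar>f n\<bar> \<le> C"
  shows "\<bar>(\<Sum>n\<in>J. f n) / card J\<bar> \<le> C"
proof (cases "card J = 0")
  case True
  then show ?thesis using order_trans[OF abs_ge_zero C] by simp
next
  case False
  have "\<bar>\<Sum>n\<in>J. f n\<bar> \<le> (\<Sum>n\<in>J. C)" by (rule order_trans[OF sum_abs sum_mono[OF C]])
  then show ?thesis using False by (simp add: divide_le_eq mult.commute)
qed

lemma average_bounded:
  fixes f :: "'b \<Rightarrow> real"
  assumes "\<And>x. \<bar>f x\<bar> \<le> C"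
  shows "\<bar>(\<Sum>i<k. f (p i)) / real k\<bar> \<le> C"
  using set_average_bounded[of "\<lambda>i. f (p i)" C "{..<k}", OF assms] by simp

lemma mean_ergodic_weak:
  assumes N: "prob_space N" and S: "mpt N S" and f[measurable]: "f \<in> borel_measurable N"
    and C: "\<And>x. \<bar>f x\<bar> \<le> C"
    and g[measurable]: "g \<in> borel_measurable N" and D: "\<And>x. \<bar>g x\<bar> \<le> D"
  shows "(\<lambda>k. \<integral>x. g x * ((\<Sum>i<k. f ((S ^^ i) x)) / real k) \<partial>N)
      \<longlonglongrightarrow> (\<integral>x. g x * real_cond_exp N (invariant_algebra N S) f x \<partial>N)"
proof -
  interpret prob_space N by fact
  note [measurable] = mpt_measurable[OF mpt_funpow[OF S]]
  have [measurable]: "real_cond_exp N (invariant_algebra N S) f \<in> borel_measurable N"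
    by (rule borel_measurable_cond_exp2)
  have D0: "0 \<le> D" using D abs_ge_zero order_trans by blast
  show ?thesis
  proof (rule integral_dominated_convergence[where w = "\<lambda>_. D * C"])
    show "AE x in N. (\<lambda>k. g x * ((\<Sum>i<k. f ((S ^^ i) x)) / real k))
        \<longlonglongrightarrow> g x * real_cond_exp N (invariant_algebra N S) f x"
      using ergodic_theorem[OF N S f C] by eventually_elim (intro tendsto_intros)
    show "AE x in N. norm (g x * ((\<Sum>i<k. f ((S ^^ i) x)) / real k)) \<le> D * C" for k
      unfolding real_norm_def abs_mult
      by (intro AE_I2 mult_mono D average_bounded C D0 abs_ge_zero)
  qed auto
qed

lemma mean_ergodic_norm:
  assumes N: "prob_space N" and S: "mpt N S" and f[measurable]: "f \<in> borel_measurable N"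
    and C: "\<And>x. \<bar>f x\<bar> \<le> C"
  shows "(\<lambda>k. \<integral>x. ((\<Sum>i<k. f ((S ^^ i) x)) / real k)\<^sup>2 \<partial>N)
      \<longlonglongrightarrow> (\<integral>x. (real_cond_exp N (invariant_algebra N S) f x)\<^sup>2 \<partial>N)"
proof -
  interpret prob_space N by fact
  note [measurable] = mpt_measurable[OF mpt_funpow[OF S]]
  have [measurable]: "real_cond_exp N (invariant_algebra N S) f \<in> borel_measurable N"
    by (rule borel_measurable_cond_exp2)
  show ?thesis
  proof (rule integral_dominated_convergence[where w = "\<lambda>_. C\<^sup>2"])
    show "AE x in N. (\<lambda>k. ((\<Sum>i<k. f ((S ^^ i) x)) / real k)\<^sup>2)
        \<longlonglongrightarrow> (real_cond_exp N (invariant_algebra N S) f x)\<^sup>2"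
      using ergodic_theorem[OF N S f C] by eventually_elim (intro tendsto_intros)
    show "AE x in N. norm (((\<Sum>i<k. f ((S ^^ i) x)) / real k)\<^sup>2) \<le> C\<^sup>2" for k
    proof (rule AE_I2)
      fix x
      have "\<bar>(\<Sum>i<k. f ((S ^^ i) x)) / real k\<bar>\<^sup>2 \<le> C\<^sup>2"
        by (rule power_mono[OF average_bounded[of f C, OF C]]) simp
      then show "norm (((\<Sum>i<k. f ((S ^^ i) x)) / real k)\<^sup>2) \<le> C\<^sup>2"
        by (simp only: power2_abs real_norm_def abs_power2)
    qed
  qed auto
qed

section \<open>Standard Borel spaces\<close>

text \<open>
  A measurable retract of the sequence space. Countable products inherit this property, and it moves
  compact approximation from the Polish space \<open>nat \<Rightarrow> real\<close> to \<open>N\<close>.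
\<close>

definition standard_borel :: "'a measure \<Rightarrow> bool" where
  "standard_borel N \<longleftrightarrow> (\<exists>\<phi> \<psi>. \<phi> \<in> N \<rightarrow>\<^sub>M (borel :: (nat \<Rightarrow> real) measure) \<and> \<psi> \<in> borel \<rightarrow>\<^sub>M N \<and>
     (\<forall>x\<in>space N. \<psi> (\<phi> x) = x))"

lemma standard_borel_cong:
  assumes "sets M = sets N" and "standard_borel M"
  shows "standard_borel N"
  using assms(2) unfolding standard_borel_def
    measurable_cong_sets[OF assms(1) refl] measurable_cong_sets[OF refl assms(1)]
    sets_eq_imp_space_eq[OF assms(1)] .

lemma coordinate_measurable: "(\<lambda>y. y n) \<in> borel_measurable (borel :: (nat \<Rightarrow> real) measure)"
  by (intro borel_measurable_continuous_onI continuous_on_product_coordinates)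

text \<open>
  A family of sequences indexed by \<open>J\<close> is coded as one sequence, by numbering \<open>J\<close> and pairing it with
  the index of the sequence.
\<close>

lemma standard_borel_PiM:
  fixes J :: "'b set" and N :: "'a measure"
  assumes J: "countable J" "J \<noteq> {}" and N: "standard_borel N"
  shows "standard_borel (PiM J (\<lambda>_. N))"
proof -
  obtain \<phi> :: "'a \<Rightarrow> nat \<Rightarrow> real" and \<psi> where
    \<phi>: "\<phi> \<in> borel_measurable N" and \<psi>: "\<psi> \<in> borel \<rightarrow>\<^sub>M N"
    and inv: "\<And>x. x \<in> space N \<Longrightarrow> \<psi> (\<phi> x) = x"
    using N unfolding standard_borel_def by blast
  define \<phi>' :: "('b \<Rightarrow> 'a) \<Rightarrow> nat \<Rightarrow> real" where
    "\<phi>' x n = \<phi> (x (from_nat_into J (fst (prod_decode n)))) (snd (prod_decode n))" for x n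
  define \<psi>' :: "(nat \<Rightarrow> real) \<Rightarrow> 'b \<Rightarrow> 'a" where
    "\<psi>' y = (\<lambda>j\<in>J. \<psi> (\<lambda>m. y (prod_encode (to_nat_on J j, m))))" for y
  have "\<phi>' \<in> borel_measurable (PiM J (\<lambda>_. N))"
  proof (rule measurable_coordinatewise_then_product)
    fix n
    have "from_nat_into J (fst (prod_decode n)) \<in> J" using J(2) by (rule from_nat_into)
    then have "(\<lambda>x. x (from_nat_into J (fst (prod_decode n)))) \<in> PiM J (\<lambda>_. N) \<rightarrow>\<^sub>M N"
      by (rule measurable_component_singleton)
    from measurable_compose[OF measurable_compose[OF this \<phi>] coordinate_measurable]
    show "(\<lambda>x. \<phi>' x n) \<in> borel_measurable (PiM J (\<lambda>_. N))" unfolding \<phi>'_def .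
  qed
  moreover have "\<psi>' \<in> borel \<rightarrow>\<^sub>M PiM J (\<lambda>_. N)"
    unfolding \<psi>'_def
  proof (rule measurable_restrict)
    fix j
    have "(\<lambda>y m. y (prod_encode (to_nat_on J j, m))) \<in> borel_measurable (borel :: (nat \<Rightarrow> real) measure)"
      by (rule measurable_coordinatewise_then_product) (rule coordinate_measurable)
    then show "(\<lambda>y. \<psi> (\<lambda>m. y (prod_encode (to_nat_on J j, m)))) \<in> borel \<rightarrow>\<^sub>M N"
      using \<psi> by (rule measurable_compose)
  qed
  moreover have "\<psi>' (\<phi>' x) = x" if x: "x \<in> space (PiM J (\<lambda>_. N))" for x
  proof
    fix j show "\<psi>' (\<phi>' x) j = x j"
    proof (cases "j \<in> J")
      case True
      then have "x j \<in> space N" using x by (auto simp: space_PiM)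
      then show ?thesis using True J(1) inv by (simp add: \<psi>'_def \<phi>'_def)
    next
      case False
      then show ?thesis using x by (auto simp: \<psi>'_def space_PiM PiE_def extensional_def)
    qed
  qed
  ultimately show ?thesis unfolding standard_borel_def by blast
qed

text \<open>
  A point is sent to the sequence of its distances to a dense sequence \<open>p\<close>. The set \<open>G\<close> lists the
  conditions on a sequence \<open>y\<close> that make it such a distance sequence: the triangle inequalities with the
  distances between the \<open>p n\<close>, and infimum zero. Completeness makes them sufficient: terms of \<open>p\<close> along
  which \<open>y\<close> tends to zero form a Cauchy sequence, whose limit has distances \<open>y\<close>. As \<open>G\<close> is Borel, the
  inverse extends measurably by a constant.
\<close>

lemma standard_borel_Polish:
  assumes nonempty: "space M \<noteq> {}" and top: "topspace X = space M"
    and cm: "completely_metrizable_space X" and sc: "second_countable X"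
    and sets: "sets M = sigma_sets (space M) {U. openin X U}"
  shows "standard_borel M"
proof -
  obtain Ms d where "Metric_space Ms d" and comp: "Metric_space.mcomplete Ms d"
    and X: "X = Metric_space.mtopology Ms d"
    using cm unfolding completely_metrizable_space_def by blast
  interpret Metric_space Ms d by fact
  have Ms: "Ms = space M" using top X by simp
  obtain C where C: "countable C" "C \<subseteq> Ms" "mtopology closure_of C = Ms"
    using second_countable_imp_separable_space[OF sc] unfolding separable_space_def X by auto
  have Cne: "C \<noteq> {}" using C(3) nonempty Ms by auto
  define p where "p = from_nat_into C"
  have p: "p n \<in> Ms" for n using from_nat_into[OF Cne] C(2) p_def by blast
  have dense: "\<exists>n. d z (p n) < r" if "z \<in> Ms" "0 < r" for z r
  proof -
    have "z \<in> mtopology closure_of C" using that C(3) by simp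
    then have "\<exists>c\<in>C. c \<in> mball z r" using that unfolding metric_closure_of by blast
    then obtain c where "c \<in> C" "c \<in> mball z r" by blast
    then show ?thesis using from_nat_into_to_nat_on[OF C(1)] unfolding p_def by (metis in_mball)
  qed
  have open_sets: "U \<in> sets M" if "openin mtopology U" for U
    unfolding sets using that X by (intro sigma_sets.Basic) simp
  define \<phi> where "\<phi> z n = d z (p n)" for z n
  have "\<phi> \<in> borel_measurable M"
  proof (rule measurable_coordinatewise_then_product)
    fix n show "(\<lambda>z. \<phi> z n) \<in> borel_measurable M"
      unfolding borel_measurable_iff_less
    proof
      fix c
      have "{z \<in> space M. \<phi> z n < c} = mball (p n) c"
        using p by (auto simp: \<phi>_def Ms[symmetric] commute)
      then show "{z \<in> space M. \<phi> z n < c} \<in> sets M" using open_sets by simp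
    qed
  qed
  define G where "G = {y :: nat \<Rightarrow> real. (\<forall>n m. d (p n) (p m) \<le> y n + y m \<and> y n \<le> y m + d (p n) (p m))
      \<and> (\<forall>k. \<exists>n. y n < 1 / real (Suc k))}"
  have G: "G \<in> sets borel"
  proof -
    have 1: "closed {y :: nat \<Rightarrow> real. d (p n) (p m) \<le> y n + y m}" for n m
      by (intro closed_Collect_le continuous_intros continuous_on_product_coordinates)
    have 2: "closed {y :: nat \<Rightarrow> real. y n \<le> y m + d (p n) (p m)}" for n m
      by (intro closed_Collect_le continuous_intros continuous_on_product_coordinates)
    have 3: "open {y :: nat \<Rightarrow> real. y n < 1 / real (Suc k)}" for n k
      by (intro open_Collect_less continuous_intros continuous_on_product_coordinates)
    have "G = (\<Inter>n. \<Inter>m. {y. d (p n) (p m) \<le> y n + y m} \<inter> {y. y n \<le> y m + d (p n) (p m)})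
        \<inter> (\<Inter>k. \<Union>n. {y. y n < 1 / real (Suc k)})"
      unfolding G_def by auto
    also have "\<dots> \<in> sets borel"
    proof (rule sets.Int)
      show "(\<Inter>n. \<Inter>m. {y. d (p n) (p m) \<le> y n + y m} \<inter> {y. y n \<le> y m + d (p n) (p m)}) \<in> sets borel"
        by (intro borel_closed closed_INT closed_Int ballI 1 2)
      have "open (\<Union>n. {y :: nat \<Rightarrow> real. y n < 1 / real (Suc k)})" for k
        by (intro open_UN ballI 3)
      then have "(\<Union>n. {y :: nat \<Rightarrow> real. y n < 1 / real (Suc k)}) \<in> sets borel" for k
        by (rule borel_open)
      then show "(\<Inter>k. \<Union>n. {y :: nat \<Rightarrow> real. y n < 1 / real (Suc k)}) \<in> sets borel"
        by (intro sets.countable_INT) auto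
    qed
    finally show ?thesis .
  qed
  have ex: "\<exists>z\<in>Ms. \<phi> z = y" if y: "y \<in> G" for y
  proof -
    have "\<forall>k. \<exists>n. y n < 1 / real (Suc k)" using y by (simp add: G_def)
    then obtain s where s: "\<And>k. y (s k) < 1 / real (Suc k)" by metis
    have y1: "d (p n) (p m) \<le> y n + y m" and y2: "y n \<le> y m + d (p n) (p m)" for n m
      using y by (auto simp: G_def)
    have small: "\<exists>K. \<forall>k\<ge>K. y (s k) < e" if e: "0 < e" for e
    proof -
      obtain K where K: "1 / real (Suc K) < e" using nat_approx_posE[OF e] by auto
      have "y (s k) < e" if "K \<le> k" for k
      proof -
        have "1 / real (Suc k) \<le> 1 / real (Suc K)" using that by (simp add: frac_le)
        then show ?thesis using s[of k] K by linarith
      qed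
      then show ?thesis by blast
    qed
    have "MCauchy (\<lambda>k. p (s k))"
      unfolding MCauchy_def
    proof (intro conjI allI impI)
      show "range (\<lambda>k. p (s k)) \<subseteq> Ms" using p by auto
      fix e :: real assume "0 < e"
      then obtain K where K: "\<And>k. K \<le> k \<Longrightarrow> y (s k) < e / 2" using small[of "e/2"] by auto
      show "\<exists>N. \<forall>n n'. N \<le> n \<longrightarrow> N \<le> n' \<longrightarrow> d (p (s n)) (p (s n')) < e"
      proof (intro exI allI impI)
        fix n n' assume "K \<le> n" "K \<le> n'"
        then show "d (p (s n)) (p (s n')) < e" using K[of n] K[of n'] y1[of "s n" "s n'"] by linarith
      qed
    qed
    then obtain z where "limitin mtopology (\<lambda>k. p (s k)) z sequentially"
      using comp unfolding mcomplete_def by blast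
    then have z: "z \<in> Ms" and lim: "\<And>e. 0 < e \<Longrightarrow> \<exists>K. \<forall>k\<ge>K. d (p (s k)) z < e"
      unfolding limitin_metric eventually_sequentially by blast+
    have "\<phi> z n = y n" for n
    proof (rule ccontr)
      assume "\<phi> z n \<noteq> y n"
      then have "0 < \<bar>\<phi> z n - y n\<bar> / 2" by simp
      then obtain K K' where K: "\<And>k. K \<le> k \<Longrightarrow> y (s k) < \<bar>\<phi> z n - y n\<bar> / 2"
        and K': "\<And>k. K' \<le> k \<Longrightarrow> d (p (s k)) z < \<bar>\<phi> z n - y n\<bar> / 2"
        using small lim by meson
      let ?k = "max K K'"
      have a: "d z (p n) \<le> d z (p (s ?k)) + d (p (s ?k)) (p n)"
        by (rule triangle[OF z p p])
      have b: "d (p (s ?k)) (p n) \<le> d (p (s ?k)) z + d z (p n)"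
        by (rule triangle[OF p z p])
      have c: "d z (p (s ?k)) = d (p (s ?k)) z" by (rule commute)
      have e: "d (p n) (p (s ?k)) = d (p (s ?k)) (p n)" by (rule commute)
      have "\<bar>\<phi> z n - y n\<bar> \<le> d (p (s ?k)) z + y (s ?k)"
        using a b c e y1[of "s ?k" n] y2[of n "s ?k"] unfolding \<phi>_def by (intro abs_leI) linarith+
      moreover have "y (s ?k) < \<bar>\<phi> z n - y n\<bar> / 2" by (rule K) simp
      moreover have "d (p (s ?k)) z < \<bar>\<phi> z n - y n\<bar> / 2" by (rule K') simp
      ultimately show False by argo
    qed
    then show ?thesis using z by auto
  qed
  have inj: "z = z'" if zz: "z \<in> Ms" "z' \<in> Ms" "\<phi> z = \<phi> z'" for z z'
  proof (rule ccontr)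
    assume "z \<noteq> z'"
    then have "0 < d z z'" using zz by simp
    then obtain n where n: "d z (p n) < d z z' / 2" using dense[OF zz(1), of "d z z' / 2"] by auto
    have "d z' (p n) = d z (p n)" using zz(3) unfolding \<phi>_def by metis
    then show False using triangle[OF zz(1) p zz(2), of n] n commute[of z' "p n"] by linarith
  qed
  have \<phi>G: "\<phi> z \<in> G" if z: "z \<in> Ms" for z
  proof -
    have "d (p n) (p m) \<le> d z (p n) + d z (p m)" "d z (p n) \<le> d z (p m) + d (p n) (p m)" for n m
      using triangle[OF p z p, of n m] triangle[OF z p p, of n m] by (simp_all add: commute)
    moreover have "\<exists>n. d z (p n) < 1 / real (Suc k)" for k by (rule dense[OF z]) simp
    ultimately show ?thesis unfolding G_def \<phi>_def by blast
  qed
  define \<psi> where "\<psi> y = (if y \<in> G then (SOME z. z \<in> Ms \<and> \<phi> z = y) else p 0)" for y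
  have \<psi>: "\<psi> y \<in> Ms" "\<phi> (\<psi> y) = y" if "y \<in> G" for y
    using someI_ex[of "\<lambda>z. z \<in> Ms \<and> \<phi> z = y"] ex[OF that] that unfolding \<psi>_def by auto
  have \<psi>_Ms: "\<psi> y \<in> Ms" for y using \<psi>(1) p by (cases "y \<in> G") (auto simp: \<psi>_def)
  have "\<psi> \<in> borel \<rightarrow>\<^sub>M M"
  proof (rule measurable_sigma_sets[OF sets])
    show "{U. openin X U} \<subseteq> Pow (space M)" using openin_subset top by blast
    show "\<psi> \<in> space borel \<rightarrow> space M" using \<psi>_Ms Ms by simp
    fix U assume "U \<in> {U. openin X U}"
    then have U: "openin mtopology U" using X by simp
    \<comment> \<open>Every point of \<open>U\<close> lies in a ball inside \<open>U\<close> with centre in the dense sequence and rational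
      radius.\<close>
    have iff: "\<psi> y \<in> U \<longleftrightarrow> (\<exists>n. \<exists>q::rat. mball (p n) (of_rat q) \<subseteq> U \<and> y n < of_rat q)" if y: "y \<in> G" for y
    proof
      assume "\<psi> y \<in> U"
      then obtain r where r: "0 < r" "mball (\<psi> y) r \<subseteq> U" using U by (auto simp: openin_mtopology)
      obtain n where n: "d (\<psi> y) (p n) < r / 2" using dense[OF \<psi>_Ms] r(1) half_gt_zero by blast
      then obtain q :: rat where q: "d (\<psi> y) (p n) < of_rat q" "of_rat q < r / 2" using of_rat_dense by blast
      have "mball (p n) (of_rat q) \<subseteq> mball (\<psi> y) r"
      proof
        fix w assume "w \<in> mball (p n) (of_rat q)"
        then have w: "w \<in> Ms" "d (p n) w < of_rat q" by auto
        then show "w \<in> mball (\<psi> y) r"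
          using triangle[OF \<psi>_Ms p w(1), of y n] n q \<psi>_Ms by auto
      qed
      then have "mball (p n) (of_rat q) \<subseteq> U" using r by blast
      moreover have "y n = d (\<psi> y) (p n)" using \<psi>(2)[OF y] unfolding \<phi>_def by metis
      then have "y n < of_rat q" using q by simp
      ultimately show "\<exists>n. \<exists>q::rat. mball (p n) (of_rat q) \<subseteq> U \<and> y n < of_rat q" by blast
    next
      assume "\<exists>n. \<exists>q::rat. mball (p n) (of_rat q) \<subseteq> U \<and> y n < of_rat q"
      then obtain n and q :: rat where nq: "mball (p n) (of_rat q) \<subseteq> U" "y n < of_rat q" by blast
      have "y n = d (\<psi> y) (p n)" using \<psi>(2)[OF y] unfolding \<phi>_def by metis
      then have "\<psi> y \<in> mball (p n) (of_rat q)" using nq p \<psi>_Ms by (simp add: commute)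
      then show "\<psi> y \<in> U" using nq by blast
    qed
    let ?V = "{y :: nat \<Rightarrow> real. \<exists>n. \<exists>q::rat. mball (p n) (of_rat q) \<subseteq> U \<and> y n < of_rat q}"
    have "?V = (\<Union>n. \<Union>q\<in>{q::rat. mball (p n) (of_rat q) \<subseteq> U}. {y. y n < of_rat q})" by auto
    also have "\<dots> \<in> sets borel"
      by (intro borel_open open_UN ballI open_Collect_less continuous_intros continuous_on_product_coordinates)
    finally have V: "?V \<in> sets borel" .
    have "\<psi> -` U \<inter> space borel = (G \<inter> ?V) \<union> (if p 0 \<in> U then - G else {})"
    proof (rule set_eqI)
      fix y
      have "y \<notin> G \<Longrightarrow> \<psi> y = p 0" by (simp add: \<psi>_def)
      moreover have "y \<in> G \<Longrightarrow> \<psi> y \<in> U \<longleftrightarrow> y \<in> ?V" using iff by simp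
      ultimately show "y \<in> \<psi> -` U \<inter> space borel \<longleftrightarrow> y \<in> (G \<inter> ?V) \<union> (if p 0 \<in> U then - G else {})"
        by (cases "y \<in> G") (simp_all del: mem_Collect_eq)
    qed
    also have "\<dots> \<in> sets borel" using V G borel_comp[OF G] by (auto intro!: sets.Un)
    finally show "\<psi> -` U \<inter> space borel \<in> sets borel" .
  qed
  moreover have "\<forall>z\<in>space M. \<psi> (\<phi> z) = z"
    using inj \<psi> \<phi>G Ms by blast
  ultimately show ?thesis using \<open>\<phi> \<in> borel_measurable M\<close> unfolding standard_borel_def by blast
qed

lemma standard_prob_space_standard_borel:
  assumes "standard_prob_space M"
  shows "standard_borel M"
proof -
  interpret standard_prob_space M by fact
  show ?thesis using standard standard_borel_Polish[OF not_empty] by blast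
qed

section \<open>The relatively independent measure of rectangles\<close>

locale mp_system = prob_space N for N :: "'a measure" +
  fixes S :: "'a \<Rightarrow> 'a"
  assumes S: "mpt N S"
begin

abbreviation F :: "'a measure" where "F \<equiv> invariant_algebra N S"

abbreviation \<E> :: "('a \<Rightarrow> real) \<Rightarrow> 'a \<Rightarrow> real" where "\<E> \<equiv> real_cond_exp N F"

lemma sub: "subalgebra N F"
  using S by (rule subalgebra_invariant_algebra)

sublocale finite_measure_subalgebra N F
  by unfold_locales (rule sub)

lemma S_pow[measurable]: "S ^^ i \<in> N \<rightarrow>\<^sub>M N"
  by (rule mpt_measurable[OF mpt_funpow[OF S]])

lemma bounded_integrable: "f \<in> borel_measurable N \<Longrightarrow> (\<And>x. \<bar>f x\<bar> \<le> C) \<Longrightarrow> integrable N f"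
  for f :: "'a \<Rightarrow> real" by (rule integrable_const_bound[of _ C]) auto

lemma cond_exp_measurable[measurable]: "\<E> f \<in> borel_measurable N"
  by (rule borel_measurable_cond_exp2)

text \<open>
  Conditional expectation is the orthogonal projection on the functions that are measurable for the
  invariant sets.
\<close>

lemma cond_exp_selfadjoint:
  assumes [measurable]: "f \<in> borel_measurable N" "g \<in> borel_measurable N"
    and C: "\<And>x. \<bar>f x\<bar> \<le> C" and D: "\<And>x. \<bar>g x\<bar> \<le> D"
  shows "(\<integral>x. \<E> f x * \<E> g x \<partial>N) = (\<integral>x. f x * \<E> g x \<partial>N)"
proof -
  have "integrable N (\<lambda>x. \<E> g x * f x)"
  proof (rule integrable_const_bound[of _ "D * C"])
    show "AE x in N. norm (\<E> g x * f x) \<le> D * C"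
      using real_cond_exp_bounded[OF prob_space_axioms sub assms(2) D]
    proof eventually_elim
      case (elim x)
      then show ?case unfolding real_norm_def abs_mult
        by (intro mult_mono C order_trans[OF abs_ge_zero D]) auto
    qed
  qed simp
  from real_cond_exp_intg(2)[OF this] show ?thesis by (simp add: mult.commute)
qed

text \<open>
  The value that the relatively independent square has to take on the rectangle \<open>A \<times> B\<close>.
\<close>

definition joint :: "'a set \<Rightarrow> 'a set \<Rightarrow> real" where
  "joint A B = (\<integral>x. \<E> (indicator A) x * \<E> (indicator B) x \<partial>N)"

text \<open>
  The image of \<open>N\<close> on the graph of \<open>S ^^ i\<close>. Averages of these measures converge on rectangles to
  \<open>joint\<close>, which is how finite additivity and invariance of the relatively independent square are obtained.
\<close>

definition graph_measure :: "nat \<Rightarrow> ('a \<times> 'a) measure" where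
  "graph_measure i = distr N (N \<Otimes>\<^sub>M N) (\<lambda>x. (x, (S ^^ i) x))"

lemma prob_space_graph_measure: "prob_space (graph_measure i)"
  unfolding graph_measure_def by (rule prob_space_distr) measurable

lemma sets_graph_measure[measurable_cong, simp]: "sets (graph_measure i) = sets (N \<Otimes>\<^sub>M N)"
  unfolding graph_measure_def by simp

abbreviation \<gamma> :: "nat \<Rightarrow> ('a \<times> 'a) set \<Rightarrow> real" where "\<gamma> i \<equiv> measure (graph_measure i)"

abbreviation \<Gamma> :: "nat \<Rightarrow> ('a \<times> 'a) set \<Rightarrow> real" where "\<Gamma> k Z \<equiv> (\<Sum>i<k. \<gamma> i Z) / real k"

lemma measure_graph_measure:
  assumes [measurable]: "A \<in> sets N" "B \<in> sets N"
  shows "\<gamma> i (A \<times> B) = measure N (A \<inter> ((S ^^ i) -` B \<inter> space N))"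
proof -
  have "(\<lambda>x. (x, (S ^^ i) x)) -` (A \<times> B) \<inter> space N = A \<inter> ((S ^^ i) -` B \<inter> space N)"
    by auto
  then show ?thesis
    unfolding graph_measure_def by (subst measure_distr) auto
qed

text \<open>
  The ergodic theorem for the indicator of \<open>B\<close>, integrated against the indicator of \<open>A\<close>.
\<close>

lemma joint_limit:
  assumes A[measurable]: "A \<in> sets N" and B[measurable]: "B \<in> sets N"
  shows "(\<lambda>k. \<Gamma> k (A \<times> B)) \<longlonglongrightarrow> joint A B"
proof -
  have "(\<integral>x. indicator A x * ((\<Sum>i<k. indicator B ((S ^^ i) x)) / real k) \<partial>N)
      = \<Gamma> k (A \<times> B)" for k
  proof -
    have "indicator A x * (\<Sum>i<k. indicator B ((S ^^ i) x))
        = (\<Sum>i<k. indicator (A \<inter> ((S ^^ i) -` B \<inter> space N)) x :: real)"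
      if "x \<in> space N" for x
      unfolding sum_distrib_left by (rule sum.cong) (use that in \<open>auto simp: indicator_def\<close>)
    then have *: "indicator A x * ((\<Sum>i<k. indicator B ((S ^^ i) x)) / real k)
        = (\<Sum>i<k. indicator (A \<inter> ((S ^^ i) -` B \<inter> space N)) x) / real k"
      if "x \<in> space N" for x
      using that by simp
    have "(\<integral>x. indicator A x * ((\<Sum>i<k. indicator B ((S ^^ i) x)) / real k) \<partial>N)
        = (\<integral>x. (\<Sum>i<k. indicator (A \<inter> ((S ^^ i) -` B \<inter> space N)) x) / real k \<partial>N)"
      by (rule Bochner_Integration.integral_cong[OF refl *])
    also have "\<dots> = (\<Sum>i<k. measure N (A \<inter> ((S ^^ i) -` B \<inter> space N))) / real k"
      by (subst integral_divide_zero, subst Bochner_Integration.integral_sum)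
        (auto intro!: bounded_integrable[where C = 1] simp: Int_absorb2 sets.Int_space_eq2)
    finally show ?thesis by (simp add: measure_graph_measure)
  qed
  moreover have "(\<lambda>k. \<integral>x. indicator A x * ((\<Sum>i<k. indicator B ((S ^^ i) x)) / real k) \<partial>N)
      \<longlonglongrightarrow> (\<integral>x. indicator A x * \<E> (indicator B) x \<partial>N)"
    by (rule mean_ergodic_weak[OF prob_space_axioms S, where C = 1 and D = 1]) (auto simp: indicator_def)
  moreover have "(\<integral>x. indicator A x * \<E> (indicator B) x \<partial>N) = joint A B"
    unfolding joint_def
    by (rule cond_exp_selfadjoint[symmetric, where C = 1 and D = 1]) (auto simp: indicator_def)
  ultimately show ?thesis by (simp only:)
qed

lemma joint_nonneg: "A \<in> sets N \<Longrightarrow> B \<in> sets N \<Longrightarrow> 0 \<le> joint A B"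
  by (rule LIMSEQ_le_const[OF joint_limit]) (auto intro!: sum_nonneg divide_nonneg_nonneg)

text \<open>
  The graph measures are subadditive on arbitrary sets, and this survives the limit even though \<open>joint\<close>
  is only defined on rectangles. The next lemma does the same for packings.
\<close>

lemma joint_cover:
  assumes "finite J" and [measurable]: "A \<in> sets N" "B \<in> sets N"
    and U: "\<And>j. j \<in> J \<Longrightarrow> U j \<in> sets N" and V: "\<And>j. j \<in> J \<Longrightarrow> V j \<in> sets N"
    and cover: "A \<times> B \<subseteq> (\<Union>j\<in>J. U j \<times> V j)"
  shows "joint A B \<le> (\<Sum>j\<in>J. joint (U j) (V j))"
proof (rule LIMSEQ_le[OF joint_limit])
  show "(\<lambda>k. \<Sum>j\<in>J. \<Gamma> k (U j \<times> V j))
      \<longlonglongrightarrow> (\<Sum>j\<in>J. joint (U j) (V j))"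
    by (intro tendsto_sum joint_limit U V)
  have "\<gamma> i (A \<times> B) \<le> (\<Sum>j\<in>J. \<gamma> i (U j \<times> V j))" for i
  proof -
    interpret G: prob_space "graph_measure i" by (rule prob_space_graph_measure)
    have UV: "U j \<times> V j \<in> sets (N \<Otimes>\<^sub>M N)" if "j \<in> J" for j using U V that by simp
    have "\<gamma> i (A \<times> B) \<le> \<gamma> i (\<Union>j\<in>J. U j \<times> V j)"
      by (rule G.finite_measure_mono[OF cover]) (use UV assms(1) in auto)
    also have "\<dots> \<le> (\<Sum>j\<in>J. \<gamma> i (U j \<times> V j))"
      by (rule G.finite_measure_subadditive_finite) (use UV assms(1) in auto)
    finally show ?thesis .
  qed
  then have "(\<Sum>i<k. \<gamma> i (A \<times> B)) \<le>
      (\<Sum>i<k. \<Sum>j\<in>J. \<gamma> i (U j \<times> V j))" for k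
    by (rule sum_mono)
  then have "\<Gamma> k (A \<times> B) \<le>
      (\<Sum>j\<in>J. \<Gamma> k (U j \<times> V j))" for k
    by (subst (asm) sum.swap) (simp add: sum_divide_distrib[symmetric] divide_right_mono)
  then show "\<exists>n. \<forall>k\<ge>n. \<Gamma> k (A \<times> B) \<le>
      (\<Sum>j\<in>J. \<Gamma> k (U j \<times> V j))" by blast
qed (use assms in auto)

lemma joint_packing:
  assumes "finite J" and [measurable]: "A \<in> sets N" "B \<in> sets N"
    and U: "\<And>j. j \<in> J \<Longrightarrow> U j \<in> sets N" and V: "\<And>j. j \<in> J \<Longrightarrow> V j \<in> sets N"
    and disj: "disjoint_family_on (\<lambda>j. U j \<times> V j) J"
    and pack: "(\<Union>j\<in>J. U j \<times> V j) \<subseteq> A \<times> B"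
  shows "(\<Sum>j\<in>J. joint (U j) (V j)) \<le> joint A B"
proof (rule LIMSEQ_le[OF _ joint_limit])
  show "(\<lambda>k. \<Sum>j\<in>J. \<Gamma> k (U j \<times> V j))
      \<longlonglongrightarrow> (\<Sum>j\<in>J. joint (U j) (V j))"
    by (intro tendsto_sum joint_limit U V)
  have "(\<Sum>j\<in>J. \<gamma> i (U j \<times> V j)) \<le> \<gamma> i (A \<times> B)" for i
  proof -
    interpret G: prob_space "graph_measure i" by (rule prob_space_graph_measure)
    have UV: "U j \<times> V j \<in> sets (N \<Otimes>\<^sub>M N)" if "j \<in> J" for j using U V that by simp
    have "(\<Sum>j\<in>J. \<gamma> i (U j \<times> V j)) = \<gamma> i (\<Union>j\<in>J. U j \<times> V j)"
      by (rule G.finite_measure_finite_Union[symmetric, OF assms(1) _ disj]) (use UV in auto)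
    also have "\<dots> \<le> \<gamma> i (A \<times> B)"
      by (rule G.finite_measure_mono[OF pack]) auto
    finally show ?thesis .
  qed
  then have "(\<Sum>i<k. \<Sum>j\<in>J. \<gamma> i (U j \<times> V j)) \<le>
      (\<Sum>i<k. \<gamma> i (A \<times> B))" for k
    by (rule sum_mono)
  then have "(\<Sum>j\<in>J. \<Gamma> k (U j \<times> V j)) \<le>
      \<Gamma> k (A \<times> B)" for k
    by (subst (asm) sum.swap) (simp add: sum_divide_distrib[symmetric] divide_right_mono)
  then show "\<exists>n. \<forall>k\<ge>n. (\<Sum>j\<in>J. \<Gamma> k (U j \<times> V j)) \<le>
      \<Gamma> k (A \<times> B)" by blast
qed (use assms in auto)

lemma joint_left:
  assumes A: "A \<in> sets N"
  shows "joint A (space N) = measure N A"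
proof -
  have "\<Gamma> k (A \<times> space N) = measure N A" if "0 < k" for k
  proof -
    have "A \<inter> ((S ^^ i) -` space N \<inter> space N) = A" for i
      using sets.sets_into_space[OF A] measurable_space[OF S_pow] by auto
    then show ?thesis using that A by (simp add: measure_graph_measure)
  qed
  then have "\<forall>\<^sub>F k in sequentially. \<Gamma> k (A \<times> space N) = measure N A"
    using eventually_gt_at_top[of 0] by (rule eventually_mono[rotated])
  then have "(\<lambda>k. \<Gamma> k (A \<times> space N)) \<longlonglongrightarrow> measure N A"
    by (rule tendsto_eventually)
  then show ?thesis using joint_limit[OF A sets.top] LIMSEQ_unique by blast
qed

lemma joint_commute: "joint A B = joint B A"
  unfolding joint_def by (simp add: mult.commute)

lemma joint_right: "B \<in> sets N \<Longrightarrow> joint (space N) B = measure N B"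
  using joint_left joint_commute by metis

text \<open>
  Both marginals of \<open>joint\<close> are \<open>N\<close>. This controls the error made when the sides of a rectangle are
  replaced by approximations.
\<close>

lemma joint_diff:
  assumes [measurable]: "A \<in> sets N" "B \<in> sets N" "K \<in> sets N" "L \<in> sets N"
  shows "joint A B \<le> joint K L + measure N (A - K) + measure N (B - L)"
proof -
  let ?U = "\<lambda>n::nat. if n = 0 then K else if n = 1 then A - K else space N"
  let ?V = "\<lambda>n::nat. if n = 0 then L else if n = 1 then space N else B - L"
  have "A \<subseteq> space N" "B \<subseteq> space N" using assms sets.sets_into_space[of A N] sets.sets_into_space[of B N] by simp_all
  then have "A \<times> B \<subseteq> (\<Union>n\<in>{0,1,2}. ?U n \<times> ?V n)" by auto
  then have "joint A B \<le> (\<Sum>n\<in>{0,1,2}. joint (?U n) (?V n))"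
    by (intro joint_cover) auto
  then show ?thesis by (simp add: joint_left joint_right)
qed

lemma joint_empty: "A \<in> sets N \<Longrightarrow> joint A {} = 0" "A \<in> sets N \<Longrightarrow> joint {} A = 0"
  using joint_cover[of "{}" A "{}"] joint_nonneg[of A "{}"] joint_commute[of A "{}"] by fastforce+

text \<open>
  One inequality is finite additivity. For the other, shrink the sides of \<open>X \<times> Y\<close> to compact sets and
  enlarge those of the \<open>n\<close>-th rectangle to open sets with error \<open>e / 2 ^ (n + 1)\<close>. Finitely many of
  the enlarged rectangles cover the compact one, and finite subadditivity applies.
\<close>

lemma joint_sigma_additive:
  assumes std: "standard_borel N"
    and A: "\<And>n. A n \<in> sets N" and B: "\<And>n. B n \<in> sets N"
    and X: "X \<in> sets N" and Y: "Y \<in> sets N"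
    and disj: "disjoint_family (\<lambda>n. A n \<times> B n)" and Un: "(\<Union>n. A n \<times> B n) = X \<times> Y"
  shows "(\<Sum>n. ennreal (joint (A n) (B n))) = ennreal (joint X Y)"
proof (rule antisym)
  have "(\<Sum>n<m. ennreal (joint (A n) (B n))) \<le> ennreal (joint X Y)" for m
  proof -
    have "(\<Sum>n<m. joint (A n) (B n)) \<le> joint X Y"
    proof (rule joint_packing)
      show "disjoint_family_on (\<lambda>n. A n \<times> B n) {..<m}"
        using disj by (rule disjoint_family_on_mono[rotated]) simp
      show "(\<Union>n<m. A n \<times> B n) \<subseteq> X \<times> Y" unfolding Un[symmetric] by blast
    qed (use A B X Y in auto)
    then show ?thesis by (simp add: sum_ennreal joint_nonneg A B ennreal_leI)
  qed
  then show "(\<Sum>n. ennreal (joint (A n) (B n))) \<le> ennreal (joint X Y)"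
    by (intro suminf_le_const) auto
next
  obtain \<phi> :: "'a \<Rightarrow> nat \<Rightarrow> real" and \<psi> where
    [measurable]: "\<phi> \<in> borel_measurable N" and [measurable]: "\<psi> \<in> borel \<rightarrow>\<^sub>M N"
    and inv: "\<And>x. x \<in> space N \<Longrightarrow> \<psi> (\<phi> x) = x"
    using std unfolding standard_borel_def by blast
  define \<nu> where "\<nu> = distr N borel \<phi>"
  interpret \<nu>: prob_space \<nu> unfolding \<nu>_def by (rule prob_space_distr) simp
  have s\<nu>: "sets \<nu> = sets borel" unfolding \<nu>_def by simp
  define star where "star Z = \<phi> -` Z \<inter> space N" for Z
  have star[measurable]: "star Z \<in> sets N" if "Z \<in> sets borel" for Z
    unfolding star_def using that by measurable
  have m\<nu>: "measure \<nu> Z = measure N (star Z)" if "Z \<in> sets borel" for Z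
    unfolding \<nu>_def star_def using that by (subst measure_distr) auto
  \<comment> \<open>Since \<open>\<psi>\<close> is defined on the whole sequence space, \<open>pull\<close> keeps covers; since it inverts
    \<open>\<phi>\<close>, \<open>star\<close> undoes \<open>pull\<close>.\<close>
  define pull where "pull Z = \<psi> -` Z" for Z
  have pull: "pull Z \<in> sets borel" if "Z \<in> sets N" for Z
    using measurable_sets[OF \<open>\<psi> \<in> borel \<rightarrow>\<^sub>M N\<close> that] unfolding pull_def by simp
  have star_pull: "star (pull Z) = Z" if "Z \<in> sets N" for Z
    using sets.sets_into_space[OF that] inv unfolding star_def pull_def by auto
  have inner: "\<exists>K. compact K \<and> K \<subseteq> pull Z \<and> measure N (Z - star K) \<le> e"
    if Z: "Z \<in> sets N" and e: "0 < e" for Z e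
  proof -
    have "\<exists>K\<in>{K. K \<subseteq> pull Z \<and> compact K}. emeasure \<nu> (pull Z) < emeasure \<nu> K + ennreal e"
      by (rule SUP_approx_ennreal[OF _ _ inner_regular[OF s\<nu> _ pull[OF Z]]])
        (use e \<nu>.emeasure_finite in auto)
    then obtain K where K: "K \<subseteq> pull Z" "compact K" "emeasure \<nu> (pull Z) < emeasure \<nu> K + ennreal e" by blast
    have Kb: "K \<in> sets borel" using K by (intro borel_closed compact_imp_closed)
    have "measure \<nu> (pull Z) < measure \<nu> K + e"
      using K(3) e by (simp add: \<nu>.emeasure_eq_measure ennreal_plus[symmetric] ennreal_less_iff del: ennreal_plus)
    then have "measure N Z \<le> measure N (star K) + e"
      using m\<nu>[OF Kb] m\<nu>[OF pull[OF Z]] star_pull[OF Z] by simp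
    moreover have "star K \<subseteq> Z" using K(1) star_pull[OF Z] unfolding star_def by blast
    ultimately have "measure N (Z - star K) \<le> e"
      using finite_measure_Diff[OF Z star[OF Kb]] by simp
    then show ?thesis using K by blast
  qed
  have outer: "\<exists>U. open U \<and> pull Z \<subseteq> U \<and> measure N (star U - Z) \<le> e"
    if Z: "Z \<in> sets N" and e: "0 < e" for Z e
  proof -
    have "\<exists>U\<in>{U. pull Z \<subseteq> U \<and> open U}. emeasure \<nu> U < emeasure \<nu> (pull Z) + ennreal e"
      by (rule INF_approx_ennreal[OF _ outer_regular[OF s\<nu> _ pull[OF Z]]])
        (use e \<nu>.emeasure_finite in auto)
    then obtain U where U: "pull Z \<subseteq> U" "open U" "emeasure \<nu> U < emeasure \<nu> (pull Z) + ennreal e" by blast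
    have Ub: "U \<in> sets borel" using U by auto
    have "measure \<nu> U < measure \<nu> (pull Z) + e"
      using U(3) e by (simp add: \<nu>.emeasure_eq_measure ennreal_plus[symmetric] ennreal_less_iff del: ennreal_plus)
    then have "measure N (star U) \<le> measure N Z + e"
      using m\<nu>[OF Ub] m\<nu>[OF pull[OF Z]] star_pull[OF Z] by simp
    moreover have "Z \<subseteq> star U" using U(1) star_pull[OF Z] unfolding star_def by blast
    ultimately have "measure N (star U - Z) \<le> e"
      using finite_measure_Diff[OF star[OF Ub] Z] by simp
    then show ?thesis using U by blast
  qed
  have bound: "ennreal (joint X Y) \<le> (\<Sum>n. ennreal (joint (A n) (B n))) + ennreal (4 * e)"
    if e: "0 < e" for e :: real
  proof -
    obtain K L where K: "compact K" "K \<subseteq> pull X" "measure N (X - star K) \<le> e"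
      and L: "compact L" "L \<subseteq> pull Y" "measure N (Y - star L) \<le> e"
      using inner[OF X e] inner[OF Y e] by blast
    have en: "0 < e * (1/2) ^ Suc n" for n using e by simp
    have "\<forall>n. \<exists>U. open U \<and> pull (A n) \<subseteq> U \<and> measure N (star U - A n) \<le> e * (1/2) ^ Suc n"
      using outer[OF A en] by (rule allI)
    from choice[OF this] obtain U where "\<forall>n. open (U n) \<and> pull (A n) \<subseteq> U n \<and> measure N (star (U n) - A n) \<le> e * (1/2) ^ Suc n"
      by (rule exE)
    then have U: "\<And>n. open (U n)" "\<And>n. pull (A n) \<subseteq> U n" "\<And>n. measure N (star (U n) - A n) \<le> e * (1/2) ^ Suc n"
      by auto
    have "\<forall>n. \<exists>U. open U \<and> pull (B n) \<subseteq> U \<and> measure N (star U - B n) \<le> e * (1/2) ^ Suc n"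
      using outer[OF B en] by (rule allI)
    from choice[OF this] obtain V where "\<forall>n. open (V n) \<and> pull (B n) \<subseteq> V n \<and> measure N (star (V n) - B n) \<le> e * (1/2) ^ Suc n"
      by (rule exE)
    then have V: "\<And>n. open (V n)" "\<And>n. pull (B n) \<subseteq> V n" "\<And>n. measure N (star (V n) - B n) \<le> e * (1/2) ^ Suc n"
      by auto
    have KL: "compact (K \<times> L)" using K L by (intro compact_Times)
    have KL_sub: "K \<times> L \<subseteq> (\<Union>n\<in>UNIV. U n \<times> V n)"
    proof clarify
      fix k l assume "k \<in> K" "l \<in> L"
      then have "(\<psi> k, \<psi> l) \<in> X \<times> Y" using K L by (auto simp: pull_def)
      then obtain n where "\<psi> k \<in> A n" "\<psi> l \<in> B n" unfolding Un[symmetric] by blast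
      then show "(k, l) \<in> (\<Union>n\<in>UNIV. U n \<times> V n)"
        using U(2)[of n] V(2)[of n] by (auto simp: pull_def)
    qed
    have UV: "open (U n \<times> V n)" for n using U(1) V(1) by (intro open_Times)
    obtain J where J: "finite J" "K \<times> L \<subseteq> (\<Union>n\<in>J. U n \<times> V n)"
      by (rule compactE_image[OF KL UV KL_sub])
    have Kb: "K \<in> sets borel" "L \<in> sets borel" using K L by (auto intro!: borel_closed compact_imp_closed)
    have Ub: "U n \<in> sets borel" "V n \<in> sets borel" for n using U(1) V(1) by auto
    have "joint X Y \<le> joint (star K) (star L) + measure N (X - star K) + measure N (Y - star L)"
      by (rule joint_diff[OF X Y star[OF Kb(1)] star[OF Kb(2)]])
    also have "\<dots> \<le> joint (star K) (star L) + 2 * e" using K L by simp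
    also have "joint (star K) (star L) \<le> (\<Sum>n\<in>J. joint (star (U n)) (star (V n)))"
    proof (rule joint_cover)
      show "star K \<times> star L \<subseteq> (\<Union>n\<in>J. star (U n) \<times> star (V n))"
        using J(2) unfolding star_def by blast
    qed (use J(1) star[OF Kb(1)] star[OF Kb(2)] star[OF Ub(1)] star[OF Ub(2)] in simp_all)
    also have "\<dots> \<le> (\<Sum>n\<in>J. joint (A n) (B n) + 2 * e * (1/2) ^ Suc n)"
    proof (rule sum_mono)
      fix n
      show "joint (star (U n)) (star (V n)) \<le> joint (A n) (B n) + 2 * e * (1/2) ^ Suc n"
        using joint_diff[OF star[OF Ub(1)] star[OF Ub(2)] A B, of n n n n] U(3)[of n] V(3)[of n] by simp
    qed
    also have "\<dots> = (\<Sum>n\<in>J. joint (A n) (B n)) + 2 * e * (\<Sum>n\<in>J. (1/2) ^ Suc n)"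
      by (simp add: sum.distrib sum_distrib_left)
    also have "(\<Sum>n\<in>J. (1/2) ^ Suc n) \<le> (1::real)"
      using sum_le_suminf[OF sums_summable[OF power_half_series] J(1)] sums_unique[OF power_half_series] by simp
    finally have "joint X Y \<le> (\<Sum>n\<in>J. joint (A n) (B n)) + 4 * e" using e by simp
    then have "ennreal (joint X Y) \<le> ennreal ((\<Sum>n\<in>J. joint (A n) (B n)) + 4 * e)" by (rule ennreal_leI)
    also have "\<dots> = (\<Sum>n\<in>J. ennreal (joint (A n) (B n))) + ennreal (4 * e)"
    proof -
      have "0 \<le> (\<Sum>n\<in>J. joint (A n) (B n))" by (intro sum_nonneg joint_nonneg A B)
      then have "ennreal ((\<Sum>n\<in>J. joint (A n) (B n)) + 4 * e) = ennreal (\<Sum>n\<in>J. joint (A n) (B n)) + ennreal (4 * e)"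
        using e by (intro ennreal_plus) auto
      then show ?thesis using sum_ennreal[of J "\<lambda>n. joint (A n) (B n)"] joint_nonneg[OF A B] by simp
    qed
    also have "(\<Sum>n\<in>J. ennreal (joint (A n) (B n))) \<le> (\<Sum>n. ennreal (joint (A n) (B n)))"
      by (rule sum_le_suminf) (use J in auto)
    finally show ?thesis by (simp add: add_right_mono)
  qed
  show "ennreal (joint X Y) \<le> (\<Sum>n. ennreal (joint (A n) (B n)))"
  proof (rule ennreal_le_epsilon)
    fix e :: real assume "0 < e"
    then show "ennreal (joint X Y) \<le> (\<Sum>n. ennreal (joint (A n) (B n))) + ennreal e"
      using bound[of "e / 4"] by simp
  qed
qed

text \<open>
  Rectangles form a semiring, on which \<open>joint\<close> is countably additive, so Caratheodory's theorem extends it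
  to the product \<open>\<sigma>\<close>-algebra.
\<close>

lemma joint_measure_exists:
  assumes std: "standard_borel N"
  shows "\<exists>P. sets P = sets (N \<Otimes>\<^sub>M N) \<and> (\<forall>A\<in>sets N. \<forall>B\<in>sets N. emeasure P (A \<times> B) = ennreal (joint A B))"
proof -
  define P where "P = extend_measure (space N \<times> space N) {(A, B). A \<in> sets N \<and> B \<in> sets N}
    (\<lambda>(A, B). A \<times> B) (\<lambda>(A, B). ennreal (joint A B))"
  have "emeasure P (A \<times> B) = ennreal (joint A B)" if "A \<in> sets N" "B \<in> sets N" for A B
  proof (rule extend_measure_caratheodory_pair[OF P_def])
    show "A \<in> sets N \<and> B \<in> sets N" using that by simp
    show "semiring_of_sets (space N \<times> space N) {A \<times> B |A B. A \<in> sets N \<and> B \<in> sets N}"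
    proof (unfold_locales)
      show "{A \<times> B |A B. A \<in> sets N \<and> B \<in> sets N} \<subseteq> Pow (space N \<times> space N)"
        using sets.sets_into_space by blast
      show "{} \<in> {A \<times> B |A B. A \<in> sets N \<and> B \<in> sets N}" by blast
      fix a b assume "a \<in> {A \<times> B |A B. A \<in> sets N \<and> B \<in> sets N}" "b \<in> {A \<times> B |A B. A \<in> sets N \<and> B \<in> sets N}"
      then obtain A B C D where ab: "a = A \<times> B" "b = C \<times> D"
        and m: "A \<in> sets N" "B \<in> sets N" "C \<in> sets N" "D \<in> sets N" by blast
      show "a \<inter> b \<in> {A \<times> B |A B. A \<in> sets N \<and> B \<in> sets N}"
        unfolding ab Times_Int_Times using m by blast
      show "\<exists>C\<subseteq>{A \<times> B |A B. A \<in> sets N \<and> B \<in> sets N}. finite C \<and> disjoint C \<and> a - b = \<Union> C"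
      proof (intro exI[of _ "{(A - C) \<times> B, (A \<inter> C) \<times> (B - D)}"] conjI)
        show "{(A - C) \<times> B, (A \<inter> C) \<times> (B - D)} \<subseteq> {A \<times> B |A B. A \<in> sets N \<and> B \<in> sets N}"
          using m by blast
        show "disjoint {(A - C) \<times> B, (A \<inter> C) \<times> (B - D)}" by (auto simp: disjoint_def)
        show "a - b = \<Union> {(A - C) \<times> B, (A \<inter> C) \<times> (B - D)}" unfolding ab by auto
      qed simp
    qed
    show "ennreal (joint i j) = 0" if "i \<in> sets N \<and> j \<in> sets N" "i \<times> j = {}" for i j
      using that joint_empty by auto
    show "ennreal (joint i j) = ennreal (joint k l)"
      if "i \<in> sets N \<and> j \<in> sets N" "k \<in> sets N \<and> l \<in> sets N" "i \<times> j = k \<times> l" for i j k l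
      using that joint_empty by (auto simp: times_eq_iff)
    show "(\<Sum>n. ennreal (joint (X n) (Y n))) = ennreal (joint j k)"
      if "\<And>n. X n \<in> sets N \<and> Y n \<in> sets N" "j \<in> sets N \<and> k \<in> sets N"
        "disjoint_family (\<lambda>n. X n \<times> Y n)" "(\<Union>i. X i \<times> Y i) = j \<times> k" for X Y :: "nat \<Rightarrow> 'a set" and j k
      by (rule joint_sigma_additive[OF std]) (use that in auto)
  qed simp
  moreover have "sets P = sets (N \<Otimes>\<^sub>M N)"
  proof -
    have "sets P = sigma_sets (space N \<times> space N) ((\<lambda>(A, B). A \<times> B) ` {(A, B). A \<in> sets N \<and> B \<in> sets N})"
      unfolding P_def by (rule sets_extend_measure) (use sets.sets_into_space in blast)
    also have "(\<lambda>(A, B). A \<times> B) ` {(A, B). A \<in> sets N \<and> B \<in> sets N} = {A \<times> B |A B. A \<in> sets N \<and> B \<in> sets N}"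
      by auto
    finally show ?thesis by (simp add: sets_pair_measure)
  qed
  ultimately show ?thesis by blast
qed

end

section \<open>The relatively independent square\<close>

text \<open>
  The hypothesis says that \<open>w\<close> and \<open>v\<close> are densities of the same signed measure, once pushed to \<open>N\<close>.
  Adding the constant \<open>C\<close> to both makes them densities of actual measures, which then have the same
  integrals. In the construction of the relatively independent square, this extends identities from
  indicators to bounded functions, one factor at a time.
\<close>

lemma integral_eq_if_eq_on_preimages:
  fixes w :: "'b \<Rightarrow> real" and v :: "'a \<Rightarrow> real"
  assumes "prob_space P" "prob_space N" and p[measurable]: "p \<in> P \<rightarrow>\<^sub>M N" and marg: "distr P N p = N"
    and [measurable]: "w \<in> borel_measurable P" and w: "\<And>z. z \<in> space P \<Longrightarrow> \<bar>w z\<bar> \<le> C"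
    and [measurable]: "v \<in> borel_measurable N" and v: "AE x in N. \<bar>v x\<bar> \<le> C"
    and eq: "\<And>B. B \<in> sets N \<Longrightarrow> (\<integral>z. w z * indicator B (p z) \<partial>P) = (\<integral>x. v x * indicator B x \<partial>N)"
    and g[measurable]: "g \<in> borel_measurable N" and D: "\<And>x. x \<in> space N \<Longrightarrow> \<bar>g x\<bar> \<le> D"
  shows "(\<integral>z. w z * g (p z) \<partial>P) = (\<integral>x. v x * g x \<partial>N)"
proof -
  interpret P: prob_space P by fact
  interpret N: prob_space N by fact
  have wint: "integrable P (\<lambda>z. w z * h (p z))"
    if [measurable]: "h \<in> borel_measurable N" and h: "\<And>x. x \<in> space N \<Longrightarrow> \<bar>h x\<bar> \<le> E" for h E
  proof (rule P.integrable_const_bound[of _ "C * E"])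
    show "AE z in P. norm (w z * h (p z)) \<le> C * E"
    proof (rule AE_I2)
      fix z assume z: "z \<in> space P"
      then have "p z \<in> space N" using measurable_space[OF p] by blast
      then show "norm (w z * h (p z)) \<le> C * E"
        unfolding real_norm_def abs_mult
        by (intro mult_mono w h z) (use order_trans[OF abs_ge_zero w[OF z]] in auto)
    qed
  qed simp
  have vint: "integrable N (\<lambda>x. v x * h x)"
    if [measurable]: "h \<in> borel_measurable N" and h: "\<And>x. x \<in> space N \<Longrightarrow> \<bar>h x\<bar> \<le> E" for h E
  proof (rule N.integrable_const_bound[of _ "C * E"])
    show "AE x in N. norm (v x * h x) \<le> C * E" using v AE_space
    proof eventually_elim
      case (elim x)
      then show ?case unfolding real_norm_def abs_mult
        by (intro mult_mono h) auto
    qed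
  qed simp
  let ?W = "\<lambda>z. w z + C" and ?V = "\<lambda>x. v x + C"
  have W0: "0 \<le> ?W z" if "z \<in> space P" for z using w[OF that] by linarith
  have V0: "AE x in N. 0 \<le> ?V x" using v by eventually_elim linarith
  have push: "(\<integral>z. h (p z) \<partial>P) = (\<integral>x. h x \<partial>N)" if "h \<in> borel_measurable N" for h :: "'a \<Rightarrow> real"
    using integral_distr[OF p that] marg by simp
  have pint: "integrable P (\<lambda>z. h (p z))"
    if [measurable]: "h \<in> borel_measurable N" and h: "\<And>x. x \<in> space N \<Longrightarrow> \<bar>h x\<bar> \<le> E" for h :: "'a \<Rightarrow> real" and E
    by (rule P.integrable_const_bound[of _ E]) (use h measurable_space[OF p] in auto)
  have nint: "integrable N h"
    if [measurable]: "h \<in> borel_measurable N" and h: "\<And>x. x \<in> space N \<Longrightarrow> \<bar>h x\<bar> \<le> E" for h :: "'a \<Rightarrow> real" and E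
    by (rule N.integrable_const_bound[of _ E]) (use h in auto)
  have shiftW: "(\<integral>z. ?W z * h (p z) \<partial>P) = (\<integral>z. w z * h (p z) \<partial>P) + C * (\<integral>x. h x \<partial>N)"
    if h: "h \<in> borel_measurable N" "\<And>x. x \<in> space N \<Longrightarrow> \<bar>h x\<bar> \<le> E" for h E
  proof -
    have "(\<integral>z. ?W z * h (p z) \<partial>P) = (\<integral>z. w z * h (p z) + C * h (p z) \<partial>P)"
      by (simp add: distrib_right)
    also have "\<dots> = (\<integral>z. w z * h (p z) \<partial>P) + (\<integral>z. C * h (p z) \<partial>P)"
    proof (rule Bochner_Integration.integral_add)
      show "integrable P (\<lambda>z. w z * h (p z))" by (rule wint[OF h])
      have "integrable P (\<lambda>z. h (p z))" by (rule pint[OF h])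
      then show "integrable P (\<lambda>z. C * h (p z))" by simp
    qed
    finally show ?thesis by (simp add: push[OF h(1)])
  qed
  have shiftV: "(\<integral>x. ?V x * h x \<partial>N) = (\<integral>x. v x * h x \<partial>N) + C * (\<integral>x. h x \<partial>N)"
    if h: "h \<in> borel_measurable N" "\<And>x. x \<in> space N \<Longrightarrow> \<bar>h x\<bar> \<le> E" for h E
  proof -
    have "(\<integral>x. ?V x * h x \<partial>N) = (\<integral>x. v x * h x + C * h x \<partial>N)"
      by (simp add: distrib_right)
    also have "\<dots> = (\<integral>x. v x * h x \<partial>N) + (\<integral>x. C * h x \<partial>N)"
    proof (rule Bochner_Integration.integral_add)
      show "integrable N (\<lambda>x. v x * h x)" by (rule vint[OF h])
      have "integrable N h" by (rule nint[OF h])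
      then show "integrable N (\<lambda>x. C * h x)" by simp
    qed
    finally show ?thesis by simp
  qed
  let ?\<mu> = "distr (density P (\<lambda>z. ennreal (?W z))) N p" and ?\<nu> = "density N (\<lambda>x. ennreal (?V x))"
  have "?\<mu> = ?\<nu>"
  proof (rule measure_eqI)
    fix B assume "B \<in> sets ?\<mu>"
    then have B[measurable]: "B \<in> sets N" by simp
    let ?i = "indicator B :: 'a \<Rightarrow> real"
    have iB: "?i \<in> borel_measurable N" "\<And>x. x \<in> space N \<Longrightarrow> \<bar>?i x\<bar> \<le> 1"
      by (simp_all add: indicator_def)
    have int_iB: "integrable P (\<lambda>z. w z * ?i (p z))" "integrable P (\<lambda>z. ?i (p z))"
        "integrable N (\<lambda>x. v x * ?i x)" "integrable N ?i"
      by (rule wint[OF iB] pint[OF iB] vint[OF iB] nint[OF iB]; assumption)+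
    have shiftW_iB: "(\<integral>z. ?W z * ?i (p z) \<partial>P) = (\<integral>z. w z * ?i (p z) \<partial>P) + C * (\<integral>x. ?i x \<partial>N)"
      by (rule shiftW[OF iB])
    have shiftV_iB: "(\<integral>x. ?V x * ?i x \<partial>N) = (\<integral>x. v x * ?i x \<partial>N) + C * (\<integral>x. ?i x \<partial>N)"
      by (rule shiftV[OF iB])
    have "emeasure ?\<mu> B = (\<integral>\<^sup>+z. ennreal (?W z) * indicator (p -` B \<inter> space P) z \<partial>P)"
      by (subst emeasure_distr) (auto simp: emeasure_density)
    also have "\<dots> = (\<integral>\<^sup>+z. ennreal (?W z * indicator B (p z)) \<partial>P)"
      by (rule nn_integral_cong) (auto simp: indicator_def)
    also have "\<dots> = ennreal (\<integral>z. ?W z * indicator B (p z) \<partial>P)"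
    proof (rule nn_integral_eq_integral)
      have "integrable P (\<lambda>z. w z * indicator B (p z) + C * indicator B (p z))"
        by (intro Bochner_Integration.integrable_add int_iB integrable_mult_right)
      then show "integrable P (\<lambda>z. ?W z * indicator B (p z))" by (simp add: distrib_right)
      show "AE z in P. 0 \<le> ?W z * indicator B (p z)" using W0 by (intro AE_I2) simp
    qed
    also have "(\<integral>z. ?W z * indicator B (p z) \<partial>P) = (\<integral>x. ?V x * indicator B x \<partial>N)"
      unfolding shiftW_iB shiftV_iB eq[OF B] ..
    also have "ennreal (\<integral>x. ?V x * indicator B x \<partial>N) = (\<integral>\<^sup>+x. ennreal (?V x * indicator B x) \<partial>N)"
    proof (rule nn_integral_eq_integral[symmetric])
      have "integrable N (\<lambda>x. v x * indicator B x + C * indicator B x)"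
        by (intro Bochner_Integration.integrable_add int_iB integrable_mult_right)
      then show "integrable N (\<lambda>x. ?V x * indicator B x)" by (simp add: distrib_right)
      show "AE x in N. 0 \<le> ?V x * indicator B x" using V0 by eventually_elim simp
    qed
    also have "\<dots> = (\<integral>\<^sup>+x. ennreal (?V x) * indicator B x \<partial>N)"
      by (rule nn_integral_cong) (auto simp: indicator_def)
    also have "\<dots> = emeasure ?\<nu> B"
      by (auto simp: emeasure_density)
    finally show "emeasure ?\<mu> B = emeasure ?\<nu> B" .
  qed simp
  then have "(\<integral>x. g x \<partial>?\<mu>) = (\<integral>x. g x \<partial>?\<nu>)" by simp
  moreover have "(\<integral>x. g x \<partial>?\<mu>) = (\<integral>z. ?W z * g (p z) \<partial>P)"
    by (subst integral_distr) (auto simp: integral_density W0)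
  moreover have "(\<integral>x. g x \<partial>?\<nu>) = (\<integral>x. ?V x * g x \<partial>N)"
    by (subst integral_density) (auto simp: V0)
  moreover have "(\<integral>z. ?W z * g (p z) \<partial>P) = (\<integral>z. w z * g (p z) \<partial>P) + C * (\<integral>x. g x \<partial>N)"
    by (rule shiftW[OF g D])
  moreover have "(\<integral>x. ?V x * g x \<partial>N) = (\<integral>x. v x * g x \<partial>N) + C * (\<integral>x. g x \<partial>N)"
    by (rule shiftV[OF g D])
  ultimately show ?thesis by linarith
qed

context mp_system begin

text \<open>
  The property that \<open>rel_square\<close> picks out by definite description.
\<close>

definition is_rel_square :: "('a \<times> 'a) measure \<Rightarrow> bool" where
  "is_rel_square P \<longleftrightarrow> sets P = sets (N \<Otimes>\<^sub>M N) \<and>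
     (\<forall>f\<in>borel_measurable N. \<forall>f'\<in>borel_measurable N.
        bounded (f ` space N) \<longrightarrow> bounded (f' ` space N) \<longrightarrow>
        (\<integral>z. f (fst z) * f' (snd z) \<partial>P) =
        (\<integral>y. \<E> f y * \<E> f' y \<partial>N))"

text \<open>
  Indicator functions show that the defining property prescribes the value on rectangles; with
  \<open>measure_eqI_rectangles\<close> below this gives uniqueness.
\<close>

lemma is_rel_square_measure:
  assumes P: "is_rel_square P" and A: "A \<in> sets N" and B: "B \<in> sets N"
  shows "measure P (A \<times> B) = joint A B"
proof -
  have sP: "sets P = sets (N \<Otimes>\<^sub>M N)" using P by (simp add: is_rel_square_def)
  have AB: "A \<times> B \<in> sets P" unfolding sP using A B by simp
  have bd: "bounded ((indicator Z :: 'a \<Rightarrow> real) ` space N)" for Z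
    by (rule boundedI[of _ 1]) (auto simp: indicator_def)
  have "measure P (A \<times> B) = (\<integral>z. indicator (A \<times> B) z \<partial>P)"
    using AB sets.sets_into_space[OF AB] by (simp add: Int_absorb2)
  also have "\<dots> = (\<integral>z. indicator A (fst z) * indicator B (snd z) \<partial>P)"
    by (simp add: indicator_times)
  also have "\<dots> = joint A B"
    using P A B bd unfolding is_rel_square_def joint_def by simp
  finally show ?thesis .
qed

lemma joint_space: "joint (space N) (space N) = 1"
  by (simp add: joint_left prob_space)

lemma space_pair: "sets P = sets (N \<Otimes>\<^sub>M N) \<Longrightarrow> space P = space N \<times> space N"
  by (metis sets_eq_imp_space_eq space_pair_measure)

lemma is_rel_square_prob:
  assumes P: "is_rel_square P"
  shows "prob_space P"
proof (rule prob_spaceI)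
  have "measure P (space P) = 1"
    using is_rel_square_measure[OF P sets.top sets.top] joint_space P space_pair[of P]
    by (simp add: is_rel_square_def)
  then show "emeasure P (space P) = 1"
    using emeasure_eq_ennreal_measure[of P "space P"] by (cases "emeasure P (space P) = top") (simp_all add: measure_def)
qed

lemma measure_eqI_rectangles:
  assumes "prob_space P" "prob_space Q" and sP: "sets P = sets (N \<Otimes>\<^sub>M N)" and sQ: "sets Q = sets (N \<Otimes>\<^sub>M N)"
    and eq: "\<And>A B. A \<in> sets N \<Longrightarrow> B \<in> sets N \<Longrightarrow> measure P (A \<times> B) = measure Q (A \<times> B)"
  shows "P = Q"
proof -
  interpret P: prob_space P by fact
  interpret Q: prob_space Q by fact
  show ?thesis
  proof (rule measure_eqI_generator_eq[OF Int_stable_pair_measure_generator[of N N]])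
    show "{a \<times> b |a b. a \<in> sets N \<and> b \<in> sets N} \<subseteq> Pow (space N \<times> space N)"
      using sets.sets_into_space by blast
    show "emeasure P X = emeasure Q X" if "X \<in> {a \<times> b |a b. a \<in> sets N \<and> b \<in> sets N}" for X
      using that eq by (auto simp: P.emeasure_eq_measure Q.emeasure_eq_measure)
    show "range (\<lambda>_::nat. space N \<times> space N) \<subseteq> {a \<times> b |a b. a \<in> sets N \<and> b \<in> sets N}" by auto
  qed (auto simp: sP sQ sets_pair_measure)
qed

lemma joint_marginals:
  assumes "prob_space P" and sP: "sets P = sets (N \<Otimes>\<^sub>M N)"
    and mP: "\<And>A B. A \<in> sets N \<Longrightarrow> B \<in> sets N \<Longrightarrow> measure P (A \<times> B) = joint A B"
  shows "distr P N fst = N" and "distr P N snd = N"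
proof -
  interpret P: prob_space P by fact
  have spP: "space P = space N \<times> space N" by (rule space_pair[OF sP])
  have m: "fst \<in> P \<rightarrow>\<^sub>M N" "snd \<in> P \<rightarrow>\<^sub>M N"
    by (simp_all add: measurable_cong_sets[OF sP refl])
  have marginal: "distr P N q = N" if q: "q \<in> P \<rightarrow>\<^sub>M N"
    and eq: "\<And>A. A \<in> sets N \<Longrightarrow> measure P (q -` A \<inter> space P) = measure N A" for q
    by (rule measure_eqI) (use q in \<open>simp_all add: emeasure_distr P.emeasure_eq_measure emeasure_eq_measure eq\<close>)
  show "distr P N fst = N"
  proof (rule marginal[OF m(1)])
    fix A assume A: "A \<in> sets N"
    then have "fst -` A \<inter> space P = A \<times> space N" using sets.sets_into_space by (auto simp: spP)
    then show "measure P (fst -` A \<inter> space P) = measure N A" using A by (simp add: mP joint_left)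
  qed
  show "distr P N snd = N"
  proof (rule marginal[OF m(2)])
    fix A assume A: "A \<in> sets N"
    then have "snd -` A \<inter> space P = space N \<times> A" using sets.sets_into_space by (auto simp: spP)
    then show "measure P (snd -` A \<inter> space P) = measure N A" using A by (simp add: mP joint_right)
  qed
qed

text \<open>
  The measure built from \<open>joint\<close> satisfies the identity for indicators. Self-adjointness of the
  conditional expectation puts the identity in the form of \<open>integral_eq_if_eq_on_preimages\<close>, used first to
  generalize the function of the first coordinate and then that of the second.
\<close>

lemma is_rel_square_exists:
  assumes std: "standard_borel N"
  shows "\<exists>P. is_rel_square P"
proof -
  obtain P where sP: "sets P = sets (N \<Otimes>\<^sub>M N)"
    and P: "\<And>A B. A \<in> sets N \<Longrightarrow> B \<in> sets N \<Longrightarrow> emeasure P (A \<times> B) = ennreal (joint A B)"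
    using joint_measure_exists[OF std] by blast
  have spP: "space P = space N \<times> space N" by (rule space_pair[OF sP])
  have pP: "prob_space P"
    by (rule prob_spaceI) (simp add: spP P joint_space)
  interpret P: prob_space P by (rule pP)
  have [measurable]: "fst \<in> P \<rightarrow>\<^sub>M N" "snd \<in> P \<rightarrow>\<^sub>M N"
    by (simp_all add: measurable_cong_sets[OF sP refl])
  have mP: "measure P (A \<times> B) = joint A B" if "A \<in> sets N" "B \<in> sets N" for A B
    by (simp add: measure_def P that joint_nonneg)
  note marg = joint_marginals[OF pP sP mP]
  have i01: "\<bar>indicator Z x :: real\<bar> \<le> 1" for Z :: "'a set" and x by (simp add: indicator_def)
  have step1: "(\<integral>z. indicator B (snd z) * f (fst z) \<partial>P) = (\<integral>x. \<E> (indicator B) x * f x \<partial>N)"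
    if B[measurable]: "B \<in> sets N" and f: "f \<in> borel_measurable N" "\<And>x. x \<in> space N \<Longrightarrow> \<bar>f x\<bar> \<le> C" for B f C
  proof (rule integral_eq_if_eq_on_preimages[OF pP prob_space_axioms _ marg(1), where C = 1 and D = C])
    show "AE x in N. \<bar>\<E> (indicator B) x\<bar> \<le> 1"
      by (rule real_cond_exp_bounded[OF prob_space_axioms sub _ i01]) simp
    fix A assume A[measurable]: "A \<in> sets N"
    have AB: "A \<times> B \<in> sets P" unfolding sP using A B by simp
    have "(\<integral>z. indicator B (snd z) * indicator A (fst z) \<partial>P) = (\<integral>z. (indicator (A \<times> B) z :: real) \<partial>P)"
      by (rule Bochner_Integration.integral_cong) (auto simp: indicator_def)
    also have "\<dots> = joint A B"
      using AB sets.sets_into_space[OF AB] mP[OF A B] by (simp add: Int_absorb2)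
    also have "\<dots> = (\<integral>x. indicator A x * \<E> (indicator B) x \<partial>N)"
      unfolding joint_def by (rule cond_exp_selfadjoint[OF _ _ i01 i01]) auto
    finally show "(\<integral>z. indicator B (snd z) * indicator A (fst z) \<partial>P)
        = (\<integral>x. \<E> (indicator B) x * indicator A x \<partial>N)" by (simp add: mult.commute)
  qed (use f i01 in auto)
  have trunc: "(\<integral>z. f (fst z) * f' (snd z) \<partial>P) = (\<integral>y. \<E> f y * \<E> f' y \<partial>N)"
    if f[measurable]: "f \<in> borel_measurable N" "f' \<in> borel_measurable N"
      and C: "\<And>x. \<bar>f x\<bar> \<le> C" and D: "\<And>x. \<bar>f' x\<bar> \<le> D" for f f' C D
  proof -
    have "(\<integral>z. f (fst z) * f' (snd z) \<partial>P) = (\<integral>x. \<E> f x * f' x \<partial>N)"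
    proof (rule integral_eq_if_eq_on_preimages[OF pP prob_space_axioms _ marg(2), where C = C and D = D])
      show "AE x in N. \<bar>\<E> f x\<bar> \<le> C"
        by (rule real_cond_exp_bounded[OF prob_space_axioms sub f(1) C])
      fix B assume B[measurable]: "B \<in> sets N"
      have "(\<integral>z. f (fst z) * indicator B (snd z) \<partial>P) = (\<integral>x. f x * \<E> (indicator B) x \<partial>N)"
        using step1[OF B f(1) C] by (simp add: mult.commute)
      also have "\<dots> = (\<integral>x. \<E> f x * \<E> (indicator B) x \<partial>N)"
        by (rule cond_exp_selfadjoint[symmetric, OF _ _ C i01]) auto
      also have "\<dots> = (\<integral>x. \<E> (indicator B) x * \<E> f x \<partial>N)"
        by (simp add: mult.commute)
      also have "\<dots> = (\<integral>x. indicator B x * \<E> f x \<partial>N)"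
        by (rule cond_exp_selfadjoint[OF _ _ i01 C]) auto
      finally show "(\<integral>z. f (fst z) * indicator B (snd z) \<partial>P) = (\<integral>x. \<E> f x * indicator B x \<partial>N)"
        by (simp add: mult.commute)
    qed (use C D in auto)
    also have "\<dots> = (\<integral>x. f' x * \<E> f x \<partial>N)" by (simp add: mult.commute)
    also have "\<dots> = (\<integral>x. \<E> f' x * \<E> f x \<partial>N)"
      by (rule cond_exp_selfadjoint[symmetric, OF _ _ D C]) auto
    finally show ?thesis by (simp add: mult.commute)
  qed
  have "is_rel_square P"
    unfolding is_rel_square_def
  proof (intro conjI ballI impI sP)
    fix f f' :: "'a \<Rightarrow> real" assume f[measurable]: "f \<in> borel_measurable N" "f' \<in> borel_measurable N"
      and bd: "bounded (f ` space N)" "bounded (f' ` space N)"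
    obtain C where C: "\<And>x. x \<in> space N \<Longrightarrow> \<bar>f x\<bar> \<le> C" using bd(1) by (auto simp: bounded_iff)
    obtain D where D: "\<And>x. x \<in> space N \<Longrightarrow> \<bar>f' x\<bar> \<le> D" using bd(2) by (auto simp: bounded_iff)
    define g where "g = truncate \<bar>C\<bar> f"
    define g' where "g' = truncate \<bar>D\<bar> f'"
    have g[measurable]: "g \<in> borel_measurable N" "g' \<in> borel_measurable N"
      unfolding g_def g'_def by (rule truncate_measurable[OF f(1)] truncate_measurable[OF f(2)])+
    have eq: "g x = f x" "g' x = f' x" if "x \<in> space N" for x
      using C[OF that] D[OF that] unfolding g_def g'_def by (intro truncate_eq; linarith)+
    have "(\<integral>z. g (fst z) * g' (snd z) \<partial>P) = (\<integral>y. \<E> g y * \<E> g' y \<partial>N)"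
      by (rule trunc[OF g, of "\<bar>C\<bar>" "\<bar>D\<bar>"]) (simp_all only: g_def g'_def truncate_bounded[OF abs_ge_zero])
    moreover have "(\<integral>z. g (fst z) * g' (snd z) \<partial>P) = (\<integral>z. f (fst z) * f' (snd z) \<partial>P)"
      by (rule Bochner_Integration.integral_cong) (auto simp: spP eq)
    moreover have "(\<integral>y. \<E> g y * \<E> g' y \<partial>N)
        = (\<integral>y. \<E> f y * \<E> f' y \<partial>N)"
    proof (rule integral_cong_AE)
      have "AE y in N. \<E> g y = \<E> f y"
        by (rule real_cond_exp_cong) (auto simp: eq)
      moreover have "AE y in N. \<E> g' y = \<E> f' y"
        by (rule real_cond_exp_cong) (auto simp: eq)
      ultimately show "AE y in N. \<E> g y * \<E> g' y
          = \<E> f y * \<E> f' y" by eventually_elim simp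
    qed auto
    ultimately show "(\<integral>z. f (fst z) * f' (snd z) \<partial>P)
        = (\<integral>y. \<E> f y * \<E> f' y \<partial>N)" by simp
  qed
  then show ?thesis by blast
qed

lemma rel_square_is_rel_square:
  assumes "standard_borel N"
  shows "is_rel_square (rel_square N S)"
proof -
  have "\<exists>!P. is_rel_square P"
  proof (rule ex_ex1I[OF is_rel_square_exists[OF assms]])
    fix P Q assume PQ: "is_rel_square P" "is_rel_square Q"
    then show "P = Q"
      by (intro measure_eqI_rectangles is_rel_square_prob) (auto simp: is_rel_square_measure, auto simp: is_rel_square_def)
  qed
  from theI'[OF this] show ?thesis
    unfolding rel_square_def is_rel_square_def .
qed

text \<open>
  As \<open>G\<close> commutes with the powers of \<open>S\<close> and preserves \<open>N\<close>, replacing \<open>A\<close> and \<open>B\<close> by their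
  preimages under \<open>G\<close> changes none of the averages that converge to \<open>joint A B\<close>.
\<close>

lemma rel_square_invariant:
  assumes std: "standard_borel N" and G: "mpt N G" and comm: "AE x in N. G (S x) = S (G x)"
  shows "mpt (rel_square N S) (\<lambda>z. (G (fst z), G (snd z)))"
proof -
  let ?P = "rel_square N S" and ?G = "\<lambda>z. (G (fst z), G (snd z))"
  note J = rel_square_is_rel_square[OF std]
  interpret P: prob_space ?P by (rule is_rel_square_prob[OF J])
  have sP: "sets ?P = sets (N \<Otimes>\<^sub>M N)" using J by (simp add: is_rel_square_def)
  note G'[measurable] = mpt_measurable[OF G]
  have meas: "?G \<in> ?P \<rightarrow>\<^sub>M ?P"
    unfolding measurable_cong_sets[OF sP sP] by measurable
  have pow: "AE x in N. G ((S ^^ i) x) = (S ^^ i) (G x)" for i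
  proof (induction i)
    case (Suc i)
    show ?case using Suc mpt_AE[OF mpt_funpow[OF S] comm, of i] by eventually_elim simp
  qed simp
  have "distr ?P ?P ?G = ?P"
  proof (rule measure_eqI_rectangles)
    show "prob_space (distr ?P ?P ?G)" using meas by (rule P.prob_space_distr)
    fix A B assume A[measurable]: "A \<in> sets N" and B[measurable]: "B \<in> sets N"
    define GA where "GA = G -` A \<inter> space N"
    define GB where "GB = G -` B \<inter> space N"
    have [measurable]: "GA \<in> sets N" "GB \<in> sets N" unfolding GA_def GB_def by measurable
    have AB: "A \<times> B \<in> sets ?P" unfolding sP by simp
    have "?G -` (A \<times> B) \<inter> space ?P = GA \<times> GB"
      by (auto simp: GA_def GB_def space_pair[OF sP])
    then have "measure (distr ?P ?P ?G) (A \<times> B) = joint GA GB"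
      using AB meas by (simp add: measure_distr is_rel_square_measure[OF J])
    also have "joint GA GB = joint A B"
    proof (rule LIMSEQ_unique[OF joint_limit])
      have "\<gamma> i (GA \<times> GB) = \<gamma> i (A \<times> B)" for i
      proof -
        have "measure N (GA \<inter> ((S ^^ i) -` GB \<inter> space N))
            = measure N (G -` (A \<inter> ((S ^^ i) -` B \<inter> space N)) \<inter> space N)"
        proof (rule measure_eq_AE)
          show "AE x in N. x \<in> GA \<inter> ((S ^^ i) -` GB \<inter> space N) \<longleftrightarrow>
              x \<in> G -` (A \<inter> ((S ^^ i) -` B \<inter> space N)) \<inter> space N"
            using pow[of i] AE_space
            by eventually_elim (use mpt_space[OF G] mpt_space[OF mpt_funpow[OF S]] in \<open>auto simp: GA_def GB_def\<close>)
        qed measurable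
        also have "\<dots> = measure N (A \<inter> ((S ^^ i) -` B \<inter> space N))"
          by (rule mpt_measure[OF G]) measurable
        finally show ?thesis by (simp add: measure_graph_measure)
      qed
      then show "(\<lambda>k. \<Gamma> k (GA \<times> GB)) \<longlonglongrightarrow> joint A B"
        using joint_limit[OF A B] by simp
    qed auto
    also have "\<dots> = measure ?P (A \<times> B)" by (simp add: is_rel_square_measure[OF J])
    finally show "measure (distr ?P ?P ?G) (A \<times> B) = measure ?P (A \<times> B)" .
  qed (auto simp: sP P.prob_space_axioms)
  then show ?thesis using meas by (simp add: mpt_def)
qed

lemma rel_square_marginals:
  assumes std: "standard_borel N"
  shows "distr (rel_square N S) N fst = N" and "distr (rel_square N S) N snd = N"
proof -
  note J = rel_square_is_rel_square[OF std]
  have sP: "sets (rel_square N S) = sets (N \<Otimes>\<^sub>M N)" using J by (simp add: is_rel_square_def)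
  note marg = joint_marginals[OF is_rel_square_prob[OF J] sP is_rel_square_measure[OF J]]
  show "distr (rel_square N S) N fst = N" by (rule marg(1))
  show "distr (rel_square N S) N snd = N" by (rule marg(2))
qed

end

section \<open>Box measures\<close>

lemma finite_cube: "finite (cube k)"
  unfolding cube_def using finite_lists_length_eq[of "UNIV :: bool set" k] by simp

lemma cube_nonempty: "cube k \<noteq> {}"
  unfolding cube_def using Ex_list_of_length[of k] by blast

lemma butlast_in_cube: "e \<in> cube (Suc k) \<Longrightarrow> butlast e \<in> cube k"
  by (simp add: cube_def)

lemma prod_cube_Suc:
  fixes g :: "bool list \<Rightarrow> real"
  shows "(\<Prod>e\<in>cube (Suc k). g e) = (\<Prod>e\<in>cube k. g (e @ [False])) * (\<Prod>e\<in>cube k. g (e @ [True]))"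
proof -
  let ?a = "\<lambda>e. e @ [False]" and ?b = "\<lambda>e. e @ [True]"
  have split: "cube (Suc k) = ?a ` cube k \<union> ?b ` cube k"
  proof (intro equalityI subsetI)
    fix e assume e: "e \<in> cube (Suc k)"
    then have e': "butlast e @ [last e] = e" by (cases e rule: rev_cases) (auto simp: cube_def)
    have b: "butlast e \<in> cube k" by (rule butlast_in_cube[OF e])
    show "e \<in> ?a ` cube k \<union> ?b ` cube k"
    proof (cases "last e")
      case True
      then show ?thesis using imageI[OF b, of ?b] e' by simp
    next
      case False
      then show ?thesis using imageI[OF b, of ?a] e' by simp
    qed
  qed (auto simp: cube_def)
  have "(\<Prod>e\<in>cube (Suc k). g e) = (\<Prod>e\<in>?a ` cube k. g e) * (\<Prod>e\<in>?b ` cube k. g e)"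
    unfolding split by (rule prod.union_disjoint) (auto simp: finite_cube)
  then show ?thesis by (simp add: prod.reindex inj_on_def)
qed

lemma cube_join_False: "e \<in> cube k \<Longrightarrow> cube_join k z (e @ [False]) = fst z e"
  and cube_join_True: "e \<in> cube k \<Longrightarrow> cube_join k z (e @ [True]) = snd z e"
  by (simp_all add: cube_join_def cube_def)

lemma diagonal_map_measurable:
  assumes "G \<in> M \<rightarrow>\<^sub>M M"
  shows "diagonal_map k G \<in> PiM (cube k) (\<lambda>_. M) \<rightarrow>\<^sub>M PiM (cube k) (\<lambda>_. M)"
  unfolding diagonal_map_def
  by (rule measurable_restrict) (intro measurable_compose[OF _ assms] measurable_component_singleton)

lemma cube_join_measurable:
  "cube_join k \<in> (PiM (cube k) (\<lambda>_. M) \<Otimes>\<^sub>M PiM (cube k) (\<lambda>_. M)) \<rightarrow>\<^sub>M PiM (cube (Suc k)) (\<lambda>_. M)"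
  unfolding cube_join_def
proof (rule measurable_restrict)
  fix e assume "e \<in> cube (Suc k)"
  then have e: "butlast e \<in> cube k" by (rule butlast_in_cube)
  note 1 = measurable_compose[OF measurable_fst measurable_component_singleton[OF e, of "\<lambda>_. M"]]
    and 2 = measurable_compose[OF measurable_snd measurable_component_singleton[OF e, of "\<lambda>_. M"]]
  show "(\<lambda>z. if last e then snd z (butlast e) else fst z (butlast e))
      \<in> (PiM (cube k) (\<lambda>_. M) \<Otimes>\<^sub>M PiM (cube k) (\<lambda>_. M)) \<rightarrow>\<^sub>M M"
    using 1 2 by (cases "last e") simp_all
qed

lemma diagonal_map_cube_join:
  "diagonal_map (Suc k) G (cube_join k z) = cube_join k (diagonal_map k G (fst z), diagonal_map k G (snd z))"
  by (auto simp: diagonal_map_def cube_join_def butlast_in_cube fun_eq_iff)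

lemma diagonal_map_funpow:
  "x \<in> extensional (cube k) \<Longrightarrow> (diagonal_map k G ^^ n) x = diagonal_map k (G ^^ n) x"
proof (induction n)
  case 0
  then show ?case by (auto simp: diagonal_map_def extensional_def fun_eq_iff)
qed (auto simp: diagonal_map_def fun_eq_iff)

text \<open>
  Maps that commute up to null sets, as needed for the diagonal map of each \<open>R (Suc k)\<close> to preserve the
  box measure of \<open>R 1, \<dots>, R k\<close>.
\<close>

locale box_system = prob_space M for M :: "'a measure" +
  fixes R :: "nat \<Rightarrow> 'a \<Rightarrow> 'a" and d :: nat
  assumes standard_M: "standard_borel M"
    and R: "\<And>i. i \<in> {1..d} \<Longrightarrow> mpt M (R i)"
    and R_commute: "\<And>i j. i \<in> {1..d} \<Longrightarrow> j \<in> {1..d} \<Longrightarrow> AE x in M. R i (R j x) = R j (R i x)"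
begin

abbreviation box :: "nat \<Rightarrow> (bool list \<Rightarrow> 'a) measure" where
  "box k \<equiv> box_measure M R k"

lemma sets_box: "sets (box k) = sets (PiM (cube k) (\<lambda>_. M))"
  by (cases k) auto

lemma space_box: "space (box k) = space (PiM (cube k) (\<lambda>_. M))"
  by (rule sets_eq_imp_space_eq[OF sets_box])

lemma standard_box: "standard_borel (box k)"
  by (rule standard_borel_cong[OF sets_box[symmetric]])
    (intro standard_borel_PiM countable_finite finite_cube cube_nonempty standard_M)

lemma coordinate_box: "e \<in> cube k \<Longrightarrow> (\<lambda>x. x e) \<in> box k \<rightarrow>\<^sub>M M"
  using measurable_component_singleton[of e "cube k" "\<lambda>_. M"]
  by (simp add: measurable_cong_sets[OF sets_box refl])

lemma diagonal_map_box: "G \<in> M \<rightarrow>\<^sub>M M \<Longrightarrow> diagonal_map k G \<in> box k \<rightarrow>\<^sub>M box k"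
  using diagonal_map_measurable by (simp add: measurable_cong_sets[OF sets_box sets_box])

lemma distr_box: "distr N (box k) f = distr N (PiM (cube k) (\<lambda>_. M)) f"
  by (rule distr_cong[OF refl sets_box refl])

lemma AE_box:
  assumes marg: "\<And>e. e \<in> cube k \<Longrightarrow> distr (box k) M (\<lambda>x. x e) = M"
    and AE: "AE y in M. Q y"
  shows "AE x in box k. \<forall>e\<in>cube k. Q (x e)"
proof -
  have "AE x in box k. Q (x e)" if e: "e \<in> cube k" for e
  proof -
    have "AE y in distr (box k) M (\<lambda>x. x e). Q y" unfolding marg[OF e] by (rule AE)
    then show ?thesis by (rule AE_distrD[OF coordinate_box[OF e]])
  qed
  then show ?thesis by (simp add: AE_finite_all[OF finite_cube])
qed

text \<open>
  The three properties support each other in the induction: the next relatively independent square exists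
  because the diagonal map of \<open>R (Suc k)\<close> preserves \<open>box k\<close>; commutation of diagonal maps up to
  null sets follows from the marginals; and invariance of the square under a diagonal map comes from
  \<open>rel_square_invariant\<close>.
\<close>

lemma box_invariants:
  assumes "k \<le> d"
  shows "prob_space (box k) \<and> (\<forall>e\<in>cube k. distr (box k) M (\<lambda>x. x e) = M) \<and>
    (\<forall>G. mpt M G \<and> (\<forall>i\<in>{1..k}. AE x in M. G (R i x) = R i (G x)) \<longrightarrow> mpt (box k) (diagonal_map k G))"
  using assms
proof (induction k)
  case 0
  let ?j = "\<lambda>x. \<lambda>e\<in>cube 0. x :: 'a"
  have cube0: "cube 0 = {[]}" by (auto simp: cube_def)
  have j[measurable]: "?j \<in> M \<rightarrow>\<^sub>M PiM (cube 0) (\<lambda>_. M)"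
    by (rule measurable_restrict) simp
  have "prob_space (box 0)" by (simp add: prob_space_distr)
  moreover have "distr (box 0) M (\<lambda>x. x e) = M" if e: "e \<in> cube 0" for e
  proof -
    have "distr (box 0) M (\<lambda>x. x e) = distr M M ((\<lambda>x. x e) \<circ> ?j)"
      unfolding box_measure.simps by (rule distr_distr[OF measurable_component_singleton[OF e] j])
    also have "(\<lambda>x. x e) \<circ> ?j = (\<lambda>x. x)" using e by (auto simp: fun_eq_iff)
    finally show ?thesis by (simp add: distr_id2)
  qed
  moreover have "mpt (box 0) (diagonal_map 0 G)" if G: "mpt M G" for G
  proof -
    have Gm: "G \<in> M \<rightarrow>\<^sub>M M" and Gd: "distr M M G = M" using G by (auto simp: mpt_def)
    let ?\<Pi> = "PiM (cube 0) (\<lambda>_. M)"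
    have "distr (box 0) ?\<Pi> (diagonal_map 0 G) = distr M ?\<Pi> (diagonal_map 0 G \<circ> ?j)"
      unfolding box_measure.simps by (rule distr_distr[OF diagonal_map_measurable[OF Gm] j])
    also have "diagonal_map 0 G \<circ> ?j = ?j \<circ> G" by (auto simp: fun_eq_iff diagonal_map_def)
    also have "distr M ?\<Pi> (?j \<circ> G) = distr (distr M M G) ?\<Pi> ?j"
      by (rule distr_distr[symmetric, OF j Gm])
    finally have "distr (box 0) ?\<Pi> (diagonal_map 0 G) = box 0" unfolding Gd by simp
    then have "distr (box 0) (box 0) (diagonal_map 0 G) = box 0"
      by (simp only: distr_box)
    then show ?thesis using diagonal_map_box[OF Gm, of 0] by (simp add: mpt_def del: box_measure.simps)
  qed
  ultimately show ?case by blast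
next
  case (Suc k)
  then have IH: "prob_space (box k)" "\<And>e. e \<in> cube k \<Longrightarrow> distr (box k) M (\<lambda>x. x e) = M"
    "\<And>G. mpt M G \<Longrightarrow> (\<And>i. i \<in> {1..k} \<Longrightarrow> AE x in M. G (R i x) = R i (G x)) \<Longrightarrow> mpt (box k) (diagonal_map k G)"
    by auto
  let ?D = "diagonal_map k (R (Suc k))"
  have D: "mpt (box k) ?D"
    by (rule IH(3)) (use Suc.prems in \<open>auto intro!: R R_commute\<close>)
  interpret N: mp_system "box k" ?D using IH(1) D by (simp add: mp_system_def mp_system_axioms_def)
  let ?P = "rel_square (box k) ?D" and ?\<Pi> = "PiM (cube (Suc k)) (\<lambda>_. M)"
  note J = N.rel_square_is_rel_square[OF standard_box]
  interpret P: prob_space ?P by (rule N.is_rel_square_prob[OF J])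
  have sP: "sets ?P = sets (PiM (cube k) (\<lambda>_. M) \<Otimes>\<^sub>M PiM (cube k) (\<lambda>_. M))"
    using J sets_pair_measure_cong[OF sets_box sets_box] by (simp add: N.is_rel_square_def)
  have join: "cube_join k \<in> ?P \<rightarrow>\<^sub>M ?\<Pi>"
    using cube_join_measurable by (simp add: measurable_cong_sets[OF sP refl])
  have fs: "fst \<in> ?P \<rightarrow>\<^sub>M box k" "snd \<in> ?P \<rightarrow>\<^sub>M box k"
    using measurable_fst measurable_snd by (simp_all add: measurable_cong_sets[OF sP sets_box])
  have box: "box (Suc k) = distr ?P ?\<Pi> (cube_join k)" by simp
  have "prob_space (box (Suc k))" unfolding box by (rule P.prob_space_distr[OF join])
  moreover have "distr (box (Suc k)) M (\<lambda>x. x e) = M" if e: "e \<in> cube (Suc k)" for e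
  proof -
    have b: "butlast e \<in> cube k" by (rule butlast_in_cube[OF e])
    define q where "q = (if last e then snd else fst :: _ \<Rightarrow> bool list \<Rightarrow> 'a)"
    have q: "q \<in> ?P \<rightarrow>\<^sub>M box k" "distr ?P (box k) q = box k"
      using fs N.rel_square_marginals[OF standard_box] by (simp_all add: q_def)
    have "distr (box (Suc k)) M (\<lambda>x. x e) = distr ?P M ((\<lambda>x. x e) \<circ> cube_join k)"
      unfolding box by (rule distr_distr[OF measurable_component_singleton[OF e] join])
    also have "(\<lambda>x. x e) \<circ> cube_join k = (\<lambda>x. x (butlast e)) \<circ> q"
      using e by (auto simp: fun_eq_iff cube_join_def q_def)
    also have "distr ?P M \<dots> = distr (distr ?P (box k) q) M (\<lambda>x. x (butlast e))"
      by (rule distr_distr[symmetric, OF coordinate_box[OF b] q(1)])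
    also have "\<dots> = M" unfolding q(2) by (rule IH(2)[OF b])
    finally show ?thesis .
  qed
  moreover have "mpt (box (Suc k)) (diagonal_map (Suc k) G)"
    if G: "mpt M G" and comm: "\<And>i. i \<in> {1..Suc k} \<Longrightarrow> AE x in M. G (R i x) = R i (G x)" for G
  proof -
    have Gm: "G \<in> M \<rightarrow>\<^sub>M M" using G by (simp add: mpt_def)
    let ?G = "diagonal_map k G" and ?GG = "\<lambda>z. (diagonal_map k G (fst z), diagonal_map k G (snd z))"
    have "AE x in box k. \<forall>e\<in>cube k. G (R (Suc k) (x e)) = R (Suc k) (G (x e))"
      by (rule AE_box[OF IH(2)]) (auto intro: comm)
    then have "AE x in box k. ?G (?D x) = ?D (?G x)"
      by eventually_elim (auto simp: diagonal_map_def fun_eq_iff)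
    moreover have "mpt (box k) ?G" by (rule IH(3)[OF G]) (use comm in auto)
    ultimately have GG: "mpt ?P ?GG" using N.rel_square_invariant[OF standard_box] by blast
    have "distr (box (Suc k)) ?\<Pi> (diagonal_map (Suc k) G) = distr ?P ?\<Pi> (diagonal_map (Suc k) G \<circ> cube_join k)"
      unfolding box by (rule distr_distr[OF diagonal_map_measurable[OF Gm] join])
    also have "diagonal_map (Suc k) G \<circ> cube_join k = cube_join k \<circ> ?GG"
      by (simp only: fun_eq_iff o_apply diagonal_map_cube_join) simp
    also have "distr ?P ?\<Pi> (cube_join k \<circ> ?GG) = distr (distr ?P ?P ?GG) ?\<Pi> (cube_join k)"
      by (rule distr_distr[symmetric, OF join mpt_measurable[OF GG]])
    also have "\<dots> = box (Suc k)" using GG by (simp add: mpt_def)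
    finally have "distr (box (Suc k)) ?\<Pi> (diagonal_map (Suc k) G) = box (Suc k)" .
    then have "distr (box (Suc k)) (box (Suc k)) (diagonal_map (Suc k) G) = box (Suc k)"
      by (simp only: distr_box)
    then show ?thesis using diagonal_map_box[OF Gm, of "Suc k"] by (simp add: mpt_def del: box_measure.simps)
  qed
  ultimately show ?case by blast
qed

lemma prob_space_box: "k \<le> d \<Longrightarrow> prob_space (box k)"
  and marginal_box: "k \<le> d \<Longrightarrow> e \<in> cube k \<Longrightarrow> distr (box k) M (\<lambda>x. x e) = M"
  and diagonal_box: "k \<le> d \<Longrightarrow> mpt M G \<Longrightarrow> (\<And>i. i \<in> {1..k} \<Longrightarrow> AE x in M. G (R i x) = R i (G x))
    \<Longrightarrow> mpt (box k) (diagonal_map k G)"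
  using box_invariants[of k] by blast+

lemma AE_box_coordinates:
  "k \<le> d \<Longrightarrow> AE y in M. Q y \<Longrightarrow> AE x in box k. \<forall>e\<in>cube k. Q (x e)"
  using AE_box marginal_box by blast

lemma diagonal_R:
  assumes "k < d"
  shows "mpt (box k) (diagonal_map k (R (Suc k)))"
  by (rule diagonal_box) (use assms in \<open>auto intro!: R R_commute\<close>)

lemma cube_product_measurable:
  fixes f :: "'a \<Rightarrow> real"
  assumes "f \<in> borel_measurable M"
  shows "(\<lambda>x. \<Prod>e\<in>cube k. f (x e)) \<in> borel_measurable (box k)"
  by (intro borel_measurable_prod measurable_compose[OF _ assms] coordinate_box)

lemma cube_product_bounded:
  fixes f :: "'a \<Rightarrow> real"
  assumes "\<And>x. \<bar>f x\<bar> \<le> C"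
  shows "\<bar>\<Prod>e\<in>cube k. f (x e)\<bar> \<le> C ^ card (cube k)"
proof -
  have "(\<Prod>e\<in>cube k. \<bar>f (x e)\<bar>) \<le> (\<Prod>e\<in>cube k. C)" by (rule prod_mono) (use assms in auto)
  then show ?thesis by (simp add: abs_prod)
qed

text \<open>
  The defining property of the relatively independent square, for the product of the copies of \<open>f\<close> on one
  face of the cube.
\<close>

lemma box_integral_Suc:
  fixes f :: "'a \<Rightarrow> real"
  assumes k: "k < d" and f[measurable]: "f \<in> borel_measurable M" and C: "\<And>x. \<bar>f x\<bar> \<le> C"
  shows "(\<integral>x. (\<Prod>e\<in>cube (Suc k). f (x e)) \<partial>box (Suc k)) =
    (\<integral>x. (real_cond_exp (box k) (invariant_algebra (box k) (diagonal_map k (R (Suc k))))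
        (\<lambda>x. \<Prod>e\<in>cube k. f (x e)) x)\<^sup>2 \<partial>box k)"
proof -
  let ?D = "diagonal_map k (R (Suc k))"
  interpret N: mp_system "box k" ?D
    using prob_space_box[of k] diagonal_R[OF k] k by (simp add: mp_system_def mp_system_axioms_def)
  let ?P = "rel_square (box k) ?D" and ?\<Pi> = "PiM (cube (Suc k)) (\<lambda>_. M)" and ?F = "\<lambda>x. \<Prod>e\<in>cube k. f (x e)"
  note J = N.rel_square_is_rel_square[OF standard_box]
  have sP: "sets ?P = sets (PiM (cube k) (\<lambda>_. M) \<Otimes>\<^sub>M PiM (cube k) (\<lambda>_. M))"
    using J sets_pair_measure_cong[OF sets_box sets_box] by (simp add: N.is_rel_square_def)
  have join: "cube_join k \<in> ?P \<rightarrow>\<^sub>M ?\<Pi>"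
    using cube_join_measurable by (simp add: measurable_cong_sets[OF sP refl])
  have m: "(\<lambda>x. \<Prod>e\<in>cube (Suc k). f (x e)) \<in> borel_measurable ?\<Pi>"
    using cube_product_measurable[OF f, of "Suc k"] by (simp only: measurable_cong_sets[OF sets_box refl])
  have "(\<integral>x. (\<Prod>e\<in>cube (Suc k). f (x e)) \<partial>box (Suc k)) = (\<integral>z. (\<Prod>e\<in>cube (Suc k). f (cube_join k z e)) \<partial>?P)"
    unfolding box_measure.simps by (rule integral_distr[OF join m])
  also have "\<dots> = (\<integral>z. ?F (fst z) * ?F (snd z) \<partial>?P)"
    by (simp add: prod_cube_Suc cube_join_False cube_join_True cong: prod.cong)
  also have "\<dots> = (\<integral>x. real_cond_exp (box k) N.F ?F x * real_cond_exp (box k) N.F ?F x \<partial>box k)"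
  proof -
    have "bounded (?F ` space (box k))"
      by (rule boundedI[of _ "C ^ card (cube k)"]) (use cube_product_bounded[of f C, OF C] in auto)
    then show ?thesis using J cube_product_measurable[OF f, of k] unfolding N.is_rel_square_def by blast
  qed
  finally show ?thesis by (simp add: power2_eq_square)
qed

lemma box_integral_Suc_nonneg:
  fixes f :: "'a \<Rightarrow> real"
  assumes "k < d" and "f \<in> borel_measurable M" and "\<And>x. \<bar>f x\<bar> \<le> C"
  shows "0 \<le> (\<integral>x. (\<Prod>e\<in>cube (Suc k). f (x e)) \<partial>box (Suc k))"
  unfolding box_integral_Suc[OF assms] by simp

text \<open>
  The mean ergodic theorem for the diagonal map identifies the next box integral with a limit over the
  present cube, where it can be compared with correlations.
\<close>

lemma box_integral_Suc_limit:
  fixes f :: "'a \<Rightarrow> real"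
  assumes k: "k < d" and f[measurable]: "f \<in> borel_measurable M" and C: "\<And>x. \<bar>f x\<bar> \<le> C"
  shows "(\<lambda>H. \<integral>x. ((\<Sum>h<H. \<Prod>e\<in>cube k. f ((diagonal_map k (R (Suc k)) ^^ h) x e)) / real H)\<^sup>2 \<partial>box k)
    \<longlonglongrightarrow> (\<integral>x. (\<Prod>e\<in>cube (Suc k). f (x e)) \<partial>box (Suc k))"
  unfolding box_integral_Suc[OF assms]
  by (rule mean_ergodic_norm[of "box k" "diagonal_map k (R (Suc k))" "\<lambda>x. \<Prod>e\<in>cube k. f (x e)",
        OF _ diagonal_R[OF k] cube_product_measurable[OF f] cube_product_bounded[of f C, OF C]])
    (use k in \<open>simp add: prob_space_box\<close>)

end

section \<open>The van der Corput inequality\<close>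

text \<open>
  Each unit shift of an interval exchanges two end terms.
\<close>

lemma sum_shift_bound:
  fixes a :: "int \<Rightarrow> real"
  assumes "\<And>n. \<bar>a n\<bar> \<le> B"
  shows "\<bar>(\<Sum>n\<in>{l..u}. a (n + int h)) - (\<Sum>n\<in>{l..u}. a n)\<bar> \<le> 2 * real h * B"
proof (induction h)
  case (Suc h)
  have B: "0 \<le> B" using order_trans[OF abs_ge_zero assms] .
  define b where "b n = a (n + int h)" for n
  have b: "\<bar>b n\<bar> \<le> B" for n using assms by (simp add: b_def)
  have "\<bar>(\<Sum>n\<in>{l..u}. b (n + 1)) - (\<Sum>n\<in>{l..u}. b n)\<bar> \<le> 2 * B"
  proof (cases "l \<le> u")
    case True
    have "(\<Sum>n\<in>{l..u}. b (n + 1)) = (\<Sum>n\<in>{l+1..u+1}. b n)"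
      by (rule sum.reindex_bij_witness[of _ "\<lambda>n. n - 1" "\<lambda>n. n + 1"]) auto
    moreover have "{l..u+1} = insert (u+1) {l..u}" "{l..u+1} = insert l {l+1..u+1}" using True by auto
    then have "b (u+1) + (\<Sum>n\<in>{l..u}. b n) = b l + (\<Sum>n\<in>{l+1..u+1}. b n)"
      by (metis atLeastAtMost_iff finite_atLeastAtMost_int sum.insert add_le_same_cancel1 not_one_le_zero)
    ultimately show ?thesis using b[of "u+1"] b[of l] by linarith
  qed (use B in simp)
  moreover have "b (n + 1) = a (n + int (Suc h))" for n by (simp add: b_def algebra_simps)
  ultimately show ?case using Suc by (simp add: b_def[symmetric] algebra_simps)
qed simp

text \<open>
  The distance of two natural numbers, by truncated subtraction.
\<close>

abbreviation gap :: "nat \<Rightarrow> nat \<Rightarrow> nat" where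
  "gap h h' \<equiv> (h - h') + (h' - h)"

text \<open>
  Up to an error of order \<open>H / card {l..u}\<close>, the terms may be replaced by their means over \<open>H\<close>
  consecutive indices. The Cauchy-Schwarz inequality bounds the square of the average of these means by the
  average of their squares. Expanding and shifting by the smaller of \<open>h\<close> and \<open>h'\<close> gives the claim.
\<close>

lemma van_der_Corput_sequence:
  fixes a :: "int \<Rightarrow> real"
  assumes C: "\<And>n. \<bar>a n\<bar> \<le> C" and "l \<le> u" and H: "0 < H"
  shows "((\<Sum>n\<in>{l..u}. a n) / card {l..u})\<^sup>2 \<le>
    (\<Sum>h<H. \<Sum>h'<H. (\<Sum>n\<in>{l..u}. a n * a (n + int (gap h h'))) / card {l..u}) / (real H)\<^sup>2
      + 6 * real H * C\<^sup>2 / card {l..u}"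
proof -
  have C0: "0 \<le> C" using order_trans[OF abs_ge_zero C] .
  let ?I = "{l..u}"
  define L where "L = real (card ?I)"
  have L: "0 < L" unfolding L_def using \<open>l \<le> u\<close> by simp
  have H': "0 < real H" using H by simp
  define A where "A = (\<Sum>n\<in>?I. a n) / L"
  define v where "v n = (\<Sum>h<H. a (n + int h)) / H" for n
  define A' where "A' = (\<Sum>n\<in>?I. v n) / L"
  have A: "\<bar>A\<bar> \<le> C" unfolding A_def L_def by (rule set_average_bounded[OF C])
  have v: "\<bar>v n\<bar> \<le> C" for n
    unfolding v_def by (rule average_bounded[of a C "\<lambda>h. n + int h" H, OF C])
  have A'b: "\<bar>A'\<bar> \<le> C" unfolding A'_def L_def by (rule set_average_bounded[OF v])
  have swap: "(\<Sum>n\<in>?I. v n) = (\<Sum>h<H. \<Sum>n\<in>?I. a (n + int h)) / H"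
    unfolding v_def by (simp add: sum_divide_distrib[symmetric] sum.swap[of _ ?I])
  have diff: "\<bar>A - A'\<bar> \<le> 2 * H * C / L"
  proof -
    have "H * ((\<Sum>n\<in>?I. v n) - (\<Sum>n\<in>?I. a n)) = (\<Sum>h<H. (\<Sum>n\<in>?I. a (n + int h)) - (\<Sum>n\<in>?I. a n))"
      using H' by (simp add: swap sum_subtractf right_diff_distrib)
    also have "\<bar>\<dots>\<bar> \<le> (\<Sum>h<H. 2 * real H * C)"
    proof (rule order_trans[OF sum_abs sum_mono])
      fix h assume "h \<in> {..<H}"
      then have "2 * real h * C \<le> 2 * real H * C" using C0 by (intro mult_right_mono) auto
      then show "\<bar>(\<Sum>n\<in>?I. a (n + int h)) - (\<Sum>n\<in>?I. a n)\<bar> \<le> 2 * real H * C"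
        using sum_shift_bound[where a = a and B = C and l = l and u = u and h = h, OF C] by linarith
    qed
    finally have "real H * \<bar>(\<Sum>n\<in>?I. v n) - (\<Sum>n\<in>?I. a n)\<bar> \<le> real H * (2 * real H * C)"
      by (simp add: abs_mult)
    then have "\<bar>(\<Sum>n\<in>?I. v n) - (\<Sum>n\<in>?I. a n)\<bar> \<le> 2 * real H * C"
      using H' by (simp only: mult_le_cancel_left_pos)
    moreover have "A - A' = ((\<Sum>n\<in>?I. a n) - (\<Sum>n\<in>?I. v n)) / L"
      by (simp add: A_def A'_def diff_divide_distrib)
    ultimately show ?thesis using L by (simp add: abs_minus_commute divide_right_mono)
  qed
  have "A\<^sup>2 - A'\<^sup>2 = (A - A') * (A + A')" by (simp add: power2_eq_square algebra_simps)
  also have "\<dots> \<le> \<bar>A - A'\<bar> * \<bar>A + A'\<bar>" by (metis abs_ge_self abs_mult)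
  also have "\<dots> \<le> (2 * H * C / L) * (2 * C)"
    using diff A A'b by (intro mult_mono) auto
  finally have 1: "A\<^sup>2 \<le> A'\<^sup>2 + 4 * H * C\<^sup>2 / L" by (simp add: power2_eq_square)
  have cs: "A'\<^sup>2 \<le> (\<Sum>n\<in>?I. (v n)\<^sup>2) / L"
  proof -
    have "(\<Sum>n\<in>?I. v n)\<^sup>2 \<le> (\<Sum>n\<in>?I. (v n)\<^sup>2) * L"
      unfolding L_def by (rule sum_squared_le_sum_of_squares)
    then have "(\<Sum>n\<in>?I. v n)\<^sup>2 / L\<^sup>2 \<le> (\<Sum>n\<in>?I. (v n)\<^sup>2) * L / L\<^sup>2"
      by (rule divide_right_mono) simp
    then show ?thesis using L by (simp add: A'_def power_divide power2_eq_square)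
  qed
  have v2: "(v n)\<^sup>2 = (\<Sum>h<H. \<Sum>h'<H. a (n + int h) * a (n + int h')) / (real H)\<^sup>2" for n
    by (simp add: v_def power_divide power2_eq_square sum_product)
  have "(\<Sum>n\<in>?I. (v n)\<^sup>2) / L = (\<Sum>h<H. \<Sum>h'<H. (\<Sum>n\<in>?I. a (n + int h) * a (n + int h')) / L) / (real H)\<^sup>2"
    unfolding v2 sum_divide_distrib[symmetric]
    by (subst sum.swap, subst sum.swap[of _ ?I]) simp
  also have "\<dots> \<le> (\<Sum>h<H. \<Sum>h'<H. (\<Sum>n\<in>?I. a n * a (n + int (gap h h'))) / L + 2 * real H * C\<^sup>2 / L) / (real H)\<^sup>2"
  proof (intro divide_right_mono sum_mono)
    fix h h' assume h: "h \<in> {..<H}" "h' \<in> {..<H}"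
    define b where "b n = a n * a (n + int (gap h h'))" for n
    have b: "\<bar>b n\<bar> \<le> C\<^sup>2" for n
      unfolding b_def abs_mult power2_eq_square by (intro mult_mono C C0 abs_ge_zero)
    have "a (n + int h) * a (n + int h') = b (n + int (min h h'))" for n
    proof (cases "h \<le> h'")
      case True
      then show ?thesis by (simp add: b_def)
    next
      case False
      then show ?thesis by (simp add: b_def mult.commute)
    qed
    then have "(\<Sum>n\<in>?I. a (n + int h) * a (n + int h')) \<le> (\<Sum>n\<in>?I. b n) + 2 * real (min h h') * C\<^sup>2"
      using sum_shift_bound[where a = b and B = "C\<^sup>2" and l = l and u = u and h = "min h h'", OF b] by simp
    also have "2 * real (min h h') * C\<^sup>2 \<le> 2 * real H * C\<^sup>2" using h by (intro mult_right_mono) auto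
    finally have "(\<Sum>n\<in>?I. a (n + int h) * a (n + int h')) \<le> (\<Sum>n\<in>?I. b n) + 2 * real H * C\<^sup>2" by simp
    then show "(\<Sum>n\<in>?I. a (n + int h) * a (n + int h')) / L
        \<le> (\<Sum>n\<in>?I. a n * a (n + int (gap h h'))) / L + 2 * real H * C\<^sup>2 / L"
      unfolding b_def add_divide_distrib[symmetric] using L by (intro divide_right_mono) auto
  qed simp
  also have "\<dots> = (\<Sum>h<H. \<Sum>h'<H. (\<Sum>n\<in>?I. a n * a (n + int (gap h h'))) / L) / (real H)\<^sup>2 + 2 * real H * C\<^sup>2 / L"
    using H' by (simp add: sum.distrib add_divide_distrib power2_eq_square)
  finally have 2: "(\<Sum>n\<in>?I. (v n)\<^sup>2) / L \<le> \<dots>" .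
  have "A\<^sup>2 \<le> (\<Sum>h<H. \<Sum>h'<H. (\<Sum>n\<in>?I. a n * a (n + int (gap h h'))) / L) / (real H)\<^sup>2
      + (2 * real H * C\<^sup>2 / L + 4 * H * C\<^sup>2 / L)"
    using 1 2 cs by linarith
  also have "2 * real H * C\<^sup>2 / L + 4 * H * C\<^sup>2 / L = 6 * real H * C\<^sup>2 / L"
    by (simp add: add_divide_distrib[symmetric])
  finally show ?thesis unfolding A_def L_def .
qed

definition correlation :: "'a measure \<Rightarrow> (int \<Rightarrow> 'a \<Rightarrow> real) \<Rightarrow> int set \<Rightarrow> nat \<Rightarrow> real" where
  "correlation M w I h = (\<Sum>n\<in>I. \<integral>x. w n x * w (n + int h) x \<partial>M) / card I"

lemma van_der_Corput_integrated:
  fixes w :: "int \<Rightarrow> 'a \<Rightarrow> real"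
  assumes "prob_space M" and w[measurable]: "\<And>n. w n \<in> borel_measurable M" and C: "\<And>n x. \<bar>w n x\<bar> \<le> C"
    and "l \<le> u" "0 < H"
  shows "(\<integral>x. ((\<Sum>n\<in>{l..u}. w n x) / card {l..u})\<^sup>2 \<partial>M) \<le>
    (\<Sum>h<H. \<Sum>h'<H. correlation M w {l..u} (gap h h')) / (real H)\<^sup>2 + 6 * real H * C\<^sup>2 / card {l..u}"
proof -
  interpret prob_space M by fact
  have C0: "0 \<le> C" using order_trans[OF abs_ge_zero C] .
  let ?I = "{l..u}"
  have int: "integrable M (\<lambda>x. w n x * w m x)" for n m
  proof (rule integrable_const_bound[of _ "C * C"])
    show "AE x in M. norm (w n x * w m x) \<le> C * C"
      unfolding real_norm_def abs_mult by (intro AE_I2 mult_mono C C0 abs_ge_zero)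
  qed measurable
  let ?K = "6 * real H * C\<^sup>2 / card ?I"
  let ?rhs = "\<lambda>x. (\<Sum>h<H. \<Sum>h'<H. (\<Sum>n\<in>?I. w n x * w (n + int (gap h h')) x) / card ?I) / (real H)\<^sup>2"
  have rhs: "integrable M ?rhs"
    by (intro integrable_divide_zero integrable_divide Bochner_Integration.integrable_sum int)
  have "(\<integral>x. ((\<Sum>n\<in>?I. w n x) / card ?I)\<^sup>2 \<partial>M) \<le> (\<integral>x. ?rhs x + ?K \<partial>M)"
  proof (rule integral_mono)
    have "\<bar>(\<Sum>n\<in>?I. w n x) / card ?I\<bar> \<le> C" for x by (rule set_average_bounded[OF C])
    then show "integrable M (\<lambda>x. ((\<Sum>n\<in>?I. w n x) / card ?I)\<^sup>2)"
      by (intro integrable_const_bound[of _ "C\<^sup>2"]) (auto simp: abs_le_square_iff[symmetric] C0 simp del: abs_divide)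
    show "integrable M (\<lambda>x. ?rhs x + ?K)" using rhs by simp
    show "((\<Sum>n\<in>?I. w n x) / card ?I)\<^sup>2 \<le> ?rhs x + ?K" for x
      by (rule van_der_Corput_sequence) (use C assms in auto)
  qed
  also have "\<dots> = (\<integral>x. ?rhs x \<partial>M) + ?K"
    using rhs by (simp add: prob_space)
  also have "(\<integral>x. ?rhs x \<partial>M) = (\<Sum>h<H. \<Sum>h'<H. correlation M w ?I (gap h h')) / (real H)\<^sup>2"
    unfolding correlation_def by (simp add: int Bochner_Integration.integral_sum Bochner_Integration.integrable_sum)
  finally show ?thesis .
qed

text \<open>
  The double sum is kept symmetric. It is then the same quadratic expression that \<open>square_of_average\<close> produces
  on the cube. The correlations enter without absolute values, so that the case of a single function fits
  the same scheme as the general one.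
\<close>

lemma van_der_Corput:
  fixes w :: "int \<Rightarrow> 'a \<Rightarrow> real" and I :: "nat \<Rightarrow> int set"
  assumes M: "prob_space M" and w: "\<And>n. w n \<in> borel_measurable M" and C: "\<And>n x. \<bar>w n x\<bar> \<le> C"
    and I: "\<forall>\<^sub>F j in sequentially. \<exists>l u. I j = {l..u}"
    and card: "filterlim (\<lambda>j. card (I j)) at_top sequentially"
    and corr: "\<And>h e. 0 < e \<Longrightarrow> \<forall>\<^sub>F j in sequentially. correlation M w (I j) h \<le> g h + e"
    and H: "0 < H" and e: "0 < e"
  shows "\<forall>\<^sub>F j in sequentially. (\<integral>x. ((\<Sum>n\<in>I j. w n x) / card (I j))\<^sup>2 \<partial>M)
      \<le> (\<Sum>h<H. \<Sum>h'<H. g (gap h h')) / (real H)\<^sup>2 + e"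
proof -
  have "\<forall>\<^sub>F j in sequentially. \<forall>h\<in>{..<H}. correlation M w (I j) h \<le> g h + e / 2"
    by (rule eventually_ball_finite) (use corr e in auto)
  moreover have "\<forall>\<^sub>F j in sequentially. 1 \<le> card (I j)"
    using card unfolding filterlim_at_top by blast
  moreover have "\<forall>\<^sub>F j in sequentially. nat \<lceil>12 * real H * C\<^sup>2 / e\<rceil> \<le> card (I j)"
    using card unfolding filterlim_at_top by blast
  ultimately show ?thesis using I
  proof eventually_elim
    case (elim j)
    then obtain l u where lu: "I j = {l..u}" by blast
    have L: "0 < real (card (I j))" using elim(2) by simp
    have "l \<le> u" using elim(2) lu by (cases "l \<le> u") auto
    have "12 * real H * C\<^sup>2 / e \<le> card (I j)" using elim(3) by linarith
    then have small: "6 * real H * C\<^sup>2 / card (I j) \<le> e / 2" using e L by (simp add: field_simps)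
    have "(\<Sum>h<H. \<Sum>h'<H. correlation M w (I j) (gap h h')) \<le> (\<Sum>h<H. \<Sum>h'<H. g (gap h h') + e / 2)"
      by (intro sum_mono) (use elim(1) in auto)
    then have "(\<Sum>h<H. \<Sum>h'<H. correlation M w (I j) (gap h h')) / (real H)\<^sup>2
        \<le> (\<Sum>h<H. \<Sum>h'<H. g (gap h h') + e / 2) / (real H)\<^sup>2"
      by (rule divide_right_mono) simp
    also have "\<dots> = (\<Sum>h<H. \<Sum>h'<H. g (gap h h')) / (real H)\<^sup>2 + e / 2"
      using H by (simp add: sum.distrib add_divide_distrib power2_eq_square)
    finally show ?case
      using van_der_Corput_integrated[where w = w, OF M w C \<open>l \<le> u\<close> H] small unfolding lu by linarith
  qed
qed

text \<open>
  Expand the square; by invariance of the measure each product depends on \<open>h\<close> and \<open>h'\<close> only through their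
  distance.
\<close>

lemma square_of_average:
  assumes "prob_space N" and S: "mpt N S" and [measurable]: "f \<in> borel_measurable N"
    and C: "\<And>x. \<bar>f x\<bar> \<le> C"
  shows "(\<integral>x. ((\<Sum>h<H. f ((S ^^ h) x)) / real H)\<^sup>2 \<partial>N)
    = (\<Sum>h<H. \<Sum>h'<H. \<integral>x. f x * f ((S ^^ gap h h') x) \<partial>N) / (real H)\<^sup>2"
proof -
  interpret prob_space N by fact
  note [measurable] = mpt_measurable[OF mpt_funpow[OF S]]
  have C0: "0 \<le> C" using order_trans[OF abs_ge_zero C] .
  have int: "integrable N (\<lambda>x. f ((S ^^ h) x) * f ((S ^^ h') x))" for h h'
  proof (rule integrable_const_bound[of _ "C * C"])
    show "AE x in N. norm (f ((S ^^ h) x) * f ((S ^^ h') x)) \<le> C * C"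
      unfolding real_norm_def abs_mult by (intro AE_I2 mult_mono C C0 abs_ge_zero)
  qed measurable
  have le: "(\<integral>x. f ((S ^^ h) x) * f ((S ^^ (h + m)) x) \<partial>N) = (\<integral>x. f x * f ((S ^^ m) x) \<partial>N)" for h m
    using mpt_integral[OF mpt_funpow[OF S, of h], of "\<lambda>x. f x * f ((S ^^ m) x)"]
    by (simp add: funpow_add add.commute[of h m])
  have eq: "(\<integral>x. f ((S ^^ h) x) * f ((S ^^ h') x) \<partial>N) = (\<integral>x. f x * f ((S ^^ gap h h') x) \<partial>N)" for h h'
  proof (cases "h \<le> h'")
    case True
    then show ?thesis using le[of h "h' - h"] by simp
  next
    case False
    then show ?thesis using le[of h' "h - h'"] by (simp add: mult.commute)
  qed
  have "(\<integral>x. ((\<Sum>h<H. f ((S ^^ h) x)) / real H)\<^sup>2 \<partial>N)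
      = (\<integral>x. (\<Sum>h<H. \<Sum>h'<H. f ((S ^^ h) x) * f ((S ^^ h') x)) / (real H)\<^sup>2 \<partial>N)"
    by (simp add: power_divide power2_eq_square sum_product)
  also have "\<dots> = (\<Sum>h<H. \<Sum>h'<H. \<integral>x. f ((S ^^ h) x) * f ((S ^^ h') x) \<partial>N) / (real H)\<^sup>2"
    by (simp add: int Bochner_Integration.integral_sum Bochner_Integration.integrable_sum)
  finally show ?thesis unfolding eq .
qed

lemma average_power_le:
  fixes x :: "'b \<Rightarrow> real"
  assumes A: "finite A" "A \<noteq> {}"
  shows "((\<Sum>i\<in>A. x i) / card A) ^ (2 ^ k) \<le> (\<Sum>i\<in>A. x i ^ (2 ^ k)) / card A"
proof (cases "k = 0")
  case False
  then have "convex_on UNIV (\<lambda>t::real. t ^ (2 ^ k))" by (intro convex_power_even) simp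
  from convex_on_sum[OF A this, of "\<lambda>_. 1 / card A" x] A
  show ?thesis by (simp add: sum_divide_distrib[symmetric] sum_distrib_left[symmetric])
qed simp

section \<open>Averages along a group action\<close>

text \<open>
  An action of an additive group that respects the group law up to null sets. The ring structure only
  serves to write integer multiples as \<open>of_int n * v\<close>.
\<close>

locale group_action = prob_space M for M :: "'a measure" +
  fixes U :: "'g::comm_ring_1 \<Rightarrow> 'a \<Rightarrow> 'a"
  assumes standard_M: "standard_borel M"
    and U: "mpt M (U v)"
    and U_zero: "AE x in M. U 0 x = x"
    and U_add: "AE x in M. U (v + w) x = U v (U w x)"
begin

lemma U_measurable[measurable]: "U v \<in> M \<rightarrow>\<^sub>M M"
  using U by (rule mpt_measurable)

lemma represented_comp:
  assumes F: "mpt M F" "AE x in M. F x = U v x" and G: "mpt M G" "AE x in M. G x = U w x"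
  shows "AE x in M. F (G x) = U (v + w) x"
  using mpt_AE[OF G(1) F(2)] G(2) U_add[of v w] by eventually_elim simp

lemma represented_funpow:
  assumes F: "mpt M F" "AE x in M. F x = U v x"
  shows "AE x in M. (F ^^ h) x = U (of_nat h * v) x"
proof (induction h)
  case 0
  show ?case using U_zero by eventually_elim simp
next
  case (Suc h)
  have "AE x in M. F ((F ^^ h) x) = U (v + of_nat h * v) x"
    by (rule represented_comp[OF F mpt_funpow[OF F(1)] Suc])
  then show ?case by (simp add: distrib_right)
qed

text \<open>
  The sign is left open because a map and its inverse have the same invariant sets, and the induction step
  replaces \<open>T 2\<close> by its inverse.
\<close>

definition represents :: "('a \<Rightarrow> 'a) \<Rightarrow> 'g \<Rightarrow> bool" where
  "represents F v \<longleftrightarrow> mpt M F \<and> ((AE x in M. F x = U v x) \<or> (AE x in M. F x = U (- v) x))"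

lemma represents_commute:
  assumes "represents F v" "represents G w"
  shows "AE x in M. F (G x) = G (F x)"
proof -
  obtain v' where F: "mpt M F" "AE x in M. F x = U v' x" using assms(1) unfolding represents_def by blast
  obtain w' where G: "mpt M G" "AE x in M. G x = U w' x" using assms(2) unfolding represents_def by blast
  show ?thesis using represented_comp[OF F G] represented_comp[OF G F]
    by eventually_elim (simp add: add.commute)
qed

lemma represents_U: "represents (U v) v"
  unfolding represents_def using U by simp

lemma represents_minus: "represents F v \<Longrightarrow> represents F (- v)"
  unfolding represents_def by auto

text \<open>
  The list starts with the direction of the last map, which the outermost step of the box
  measure uses; removing the head of the list removes that step.
\<close>

definition directions :: "(nat \<Rightarrow> 'a \<Rightarrow> 'a) \<Rightarrow> 'g list \<Rightarrow> bool" where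
  "directions R ts \<longleftrightarrow> (\<forall>k<length ts. represents (R (length ts - k)) (ts ! k))"

lemma directions_represents:
  assumes "directions R ts" "i \<in> {1..length ts}"
  shows "\<exists>v. represents (R i) v"
proof -
  have "represents (R (length ts - (length ts - i))) (ts ! (length ts - i))"
    using assms unfolding directions_def by (metis atLeastAtMost_iff diff_less less_le_trans zero_less_one le_zero_eq linorder_not_less)
  then show ?thesis using assms(2) by auto
qed

lemma directions_box_system:
  assumes "directions R ts"
  shows "box_system M R (length ts)"
proof
  show "standard_borel M" by (rule standard_M)
  show "mpt M (R i)" if "i \<in> {1..length ts}" for i
    using directions_represents[OF assms that] by (auto simp: represents_def)
  show "AE x in M. R i (R j x) = R j (R i x)" if "i \<in> {1..length ts}" "j \<in> {1..length ts}" for i j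
    using directions_represents[OF assms that(1)] directions_represents[OF assms that(2)] represents_commute by blast
qed

text \<open>
  If \<open>R (Suc k)\<close> acts as \<open>U s\<close>, both sides agree by the marginals. If it acts as \<open>U (- s)\<close>, apply
  first the diagonal map of \<open>U (of_nat h * s)\<close>, which preserves the box measure: it cancels the iterate in
  the second factor and appears in the first.
\<close>

lemma box_gap_correlation:
  fixes f :: "'a \<Rightarrow> real"
  assumes R: "directions R (s # ts)" and f[measurable]: "f \<in> borel_measurable M"
  defines "k \<equiv> length ts"
  shows "(\<integral>x. (\<Prod>e\<in>cube k. f (x e)) * (\<Prod>e\<in>cube k. f ((diagonal_map k (R (Suc k)) ^^ h) x e)) \<partial>box_measure M R k)
    = (\<integral>x. (\<Prod>e\<in>cube k. f (x e) * f (U (of_nat h * s) (x e))) \<partial>box_measure M R k)"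
proof -
  interpret B: box_system M R "Suc k"
    using directions_box_system[OF R] by (simp add: k_def)
  let ?B = "box_measure M R k" and ?V = "U (of_nat h * s)" and ?Rh = "R (Suc k) ^^ h"
  have rep: "represents (R (Suc k)) s"
    using R unfolding directions_def k_def by force
  then have mR: "mpt M (R (Suc k))" by (simp add: represents_def)
  note mRh = mpt_funpow[OF mR, of h]
  have F: "(\<lambda>x. \<Prod>e\<in>cube k. g (x e)) \<in> borel_measurable ?B" if "g \<in> borel_measurable M" for g :: "'a \<Rightarrow> real"
    using that by (rule B.cube_product_measurable)
  have FD: "(\<lambda>x. \<Prod>e\<in>cube k. f (?Rh (x e))) \<in> borel_measurable ?B"
    by (rule F) (rule measurable_compose[OF mpt_measurable[OF mRh] f])
  have pow: "(diagonal_map k (R (Suc k)) ^^ h) x e = ?Rh (x e)" if "x \<in> space ?B" "e \<in> cube k" for x e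
  proof -
    have "x \<in> extensional (cube k)" using that(1) by (auto simp: B.space_box space_PiM PiE_def)
    then show ?thesis using that(2) by (simp add: diagonal_map_funpow) (simp add: diagonal_map_def)
  qed
  have "(\<integral>x. (\<Prod>e\<in>cube k. f (x e)) * (\<Prod>e\<in>cube k. f ((diagonal_map k (R (Suc k)) ^^ h) x e)) \<partial>?B)
      = (\<integral>x. (\<Prod>e\<in>cube k. f (x e)) * (\<Prod>e\<in>cube k. f (?Rh (x e))) \<partial>?B)"
    by (rule Bochner_Integration.integral_cong) (simp_all add: pow cong: prod.cong)
  also have "\<dots> = (\<integral>x. (\<Prod>e\<in>cube k. f (x e)) * (\<Prod>e\<in>cube k. f (?V (x e))) \<partial>?B)"
  proof (cases "AE x in M. R (Suc k) x = U s x")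
    case True
    have "AE y in M. ?Rh y = ?V y" by (rule represented_funpow[OF mR True])
    then have "AE x in ?B. \<forall>e\<in>cube k. ?Rh (x e) = ?V (x e)"
      using B.AE_box_coordinates[of k "\<lambda>y. ?Rh y = ?V y"] by simp
    then have "AE x in ?B. (\<Prod>e\<in>cube k. f (x e)) * (\<Prod>e\<in>cube k. f (?Rh (x e)))
        = (\<Prod>e\<in>cube k. f (x e)) * (\<Prod>e\<in>cube k. f (?V (x e)))"
      by eventually_elim (simp cong: prod.cong)
    then show ?thesis
      by (intro integral_cong_AE borel_measurable_times F FD measurable_compose[OF U_measurable f] f)
  next
    case False
    then have "AE x in M. R (Suc k) x = U (- s) x" using rep by (auto simp: represents_def)
    from represented_funpow[OF mR this] have "AE y in M. ?Rh y = U (of_nat h * - s) y" .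
    then have "AE y in M. ?Rh (?V y) = U (of_nat h * - s + of_nat h * s) y"
      by (rule represented_comp[OF mRh _ U]) simp
    then have "AE y in M. ?Rh (?V y) = y" using U_zero by eventually_elim simp
    then have AE: "AE x in ?B. \<forall>e\<in>cube k. ?Rh (?V (x e)) = x e"
      using B.AE_box_coordinates[of k "\<lambda>y. ?Rh (?V y) = y"] by simp
    have dV: "mpt ?B (diagonal_map k ?V)"
    proof (rule B.diagonal_box)
      fix i assume "i \<in> {1..k}"
      then obtain v where "represents (R i) v" using directions_represents[OF R, of i] by (auto simp: k_def)
      then show "AE x in M. ?V (R i x) = R i (?V x)" by (rule represents_commute[OF represents_U])
    qed (use U in auto)
    have "(\<integral>x. (\<Prod>e\<in>cube k. f (x e)) * (\<Prod>e\<in>cube k. f (?Rh (x e))) \<partial>?B)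
        = (\<integral>x. (\<Prod>e\<in>cube k. f (diagonal_map k ?V x e)) * (\<Prod>e\<in>cube k. f (?Rh (diagonal_map k ?V x e))) \<partial>?B)"
      by (rule mpt_integral[OF dV, symmetric]) (intro borel_measurable_times F FD f)
    also have "\<dots> = (\<integral>x. (\<Prod>e\<in>cube k. f (?V (x e))) * (\<Prod>e\<in>cube k. f (?Rh (?V (x e)))) \<partial>?B)"
      by (simp add: diagonal_map_def cong: prod.cong)
    also have "\<dots> = (\<integral>x. (\<Prod>e\<in>cube k. f (?V (x e))) * (\<Prod>e\<in>cube k. f (x e)) \<partial>?B)"
    proof (rule integral_cong_AE)
      show "(\<lambda>x. (\<Prod>e\<in>cube k. f (?V (x e))) * (\<Prod>e\<in>cube k. f (?Rh (?V (x e))))) \<in> borel_measurable ?B"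
        by (intro borel_measurable_times F measurable_compose[OF U_measurable]
            measurable_compose[OF mpt_measurable[OF mRh]] f)
      show "(\<lambda>x. (\<Prod>e\<in>cube k. f (?V (x e))) * (\<Prod>e\<in>cube k. f (x e))) \<in> borel_measurable ?B"
        by (intro borel_measurable_times F measurable_compose[OF U_measurable] f)
      show "AE x in ?B. (\<Prod>e\<in>cube k. f (?V (x e))) * (\<Prod>e\<in>cube k. f (?Rh (?V (x e))))
          = (\<Prod>e\<in>cube k. f (?V (x e))) * (\<Prod>e\<in>cube k. f (x e))"
        using AE by eventually_elim (simp cong: prod.cong)
    qed
    finally show ?thesis by (simp add: mult.commute)
  qed
  finally show ?thesis by (simp add: prod.distrib)
qed

text \<open>
  Let \<open>c h\<close> be the power \<open>2 ^ k\<close> of \<open>g h\<close>. By \<open>box_gap_correlation\<close> the averages of \<open>c (gap h h')\<close>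
  are squared norms of ergodic averages, so they converge to the box integral of \<open>f\<close>, which is the power
  \<open>2 ^ Suc k\<close> of its seminorm. Convexity compares them with the averages of \<open>g (gap h h')\<close>.
\<close>

lemma seminorm_gap_average:
  fixes f :: "'a \<Rightarrow> real"
  assumes R: "directions R (s # ts)" and f[measurable]: "f \<in> borel_measurable M" and C: "\<And>x. \<bar>f x\<bar> \<le> C"
    and e: "0 < e"
  defines "k \<equiv> length ts"
  defines "g \<equiv> \<lambda>h. box_seminorm M R k (\<lambda>x. f x * f (U (of_nat h * s) x))"
  shows "0 \<le> box_seminorm M R (Suc k) f"
    and "\<exists>H>0. (\<Sum>h<H. \<Sum>h'<H. g (gap h h')) / (real H)\<^sup>2 \<le> (box_seminorm M R (Suc k) f)\<^sup>2 + e"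
proof -
  interpret B: box_system M R "Suc k"
    using directions_box_system[OF R] by (simp add: k_def)
  have kk: "k < Suc k" by simp
  define \<beta> where "\<beta> = (\<integral>x. (\<Prod>e\<in>cube (Suc k). f (x e)) \<partial>box_measure M R (Suc k))"
  define b where "b = box_seminorm M R (Suc k) f"
  have \<beta>0: "0 \<le> \<beta>" unfolding \<beta>_def by (rule B.box_integral_Suc_nonneg[OF kk f C])
  have b: "b = root (2 ^ Suc k) \<beta>" unfolding b_def box_seminorm_def \<beta>_def ..
  show b0: "0 \<le> box_seminorm M R (Suc k) f" using \<beta>0 b by (simp add: b_def[symmetric])
  have "\<beta> = b ^ (2 ^ Suc k)" unfolding b using \<beta>0 by (intro real_root_pow_pos2[symmetric]) auto
  also have "\<dots> = (b\<^sup>2) ^ (2 ^ k)" by (simp add: power_mult[symmetric])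
  finally have root_\<beta>: "root (2 ^ k) \<beta> = b\<^sup>2" by (simp add: real_root_power_cancel)
  have C0: "0 \<le> C" using order_trans[OF abs_ge_zero C] .
  define c where "c h = (\<integral>x. (\<Prod>e\<in>cube k. f (x e) * f (U (of_nat h * s) (x e))) \<partial>box_measure M R k)" for h
  have \<phi>b: "\<bar>f x * f (U v x)\<bar> \<le> C * C" for v x
    unfolding abs_mult by (intro mult_mono C C0 abs_ge_zero)
  have \<phi>m: "(\<lambda>x. f x * f (U v x)) \<in> borel_measurable M" for v by measurable
  have g: "g h = root (2 ^ k) (c h)" for h unfolding g_def box_seminorm_def c_def ..
  \<comment> \<open>For \<open>k = 0\<close> the number \<open>c h\<close> is a plain integral of either sign, but the exponent is \<open>1\<close>.\<close>
  have c0: "0 \<le> c h" if k0: "0 < k" for h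
  proof -
    obtain k' where k': "k = Suc k'" using gr0_implies_Suc[OF k0] by blast
    have "k' < Suc k" using k' by simp
    from B.box_integral_Suc_nonneg[OF this \<phi>m \<phi>b] show ?thesis unfolding c_def k' .
  qed
  have gc: "g h ^ (2 ^ k) = c h" for h
  proof (cases "k = 0")
    case False
    then show ?thesis unfolding g using c0 by (intro real_root_pow_pos2) auto
  qed (simp add: g)
  define q where "q H = (\<Sum>h<H. \<Sum>h'<H. c (gap h h')) / (real H)\<^sup>2" for H
  define G where "G H = (\<Sum>h<H. \<Sum>h'<H. g (gap h h')) / (real H)\<^sup>2" for H
  have "q \<longlonglongrightarrow> \<beta>"
  proof -
    have "(\<integral>x. ((\<Sum>h<H. \<Prod>e\<in>cube k. f ((diagonal_map k (R (Suc k)) ^^ h) x e)) / real H)\<^sup>2 \<partial>box_measure M R k) = q H" for H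
      using square_of_average[OF B.prob_space_box B.diagonal_R[OF kk] B.cube_product_measurable[OF f]
        B.cube_product_bounded[of f C, OF C], of H]
      unfolding q_def c_def box_gap_correlation[OF R f, folded k_def, symmetric] by simp
    then show ?thesis using B.box_integral_Suc_limit[OF kk f C] unfolding \<beta>_def by simp
  qed
  then have "(\<lambda>H. root (2 ^ k) (q H)) \<longlonglongrightarrow> b\<^sup>2"
    unfolding root_\<beta>[symmetric] by (rule tendsto_real_root)
  then have "\<forall>\<^sub>F H in sequentially. root (2 ^ k) (q H) < b\<^sup>2 + e"
    by (rule order_tendstoD) (use e in simp)
  then have "\<forall>\<^sub>F H in sequentially. root (2 ^ k) (q H) < b\<^sup>2 + e \<and> 0 < H"
    by (rule eventually_conj) (rule eventually_gt_at_top)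
  then obtain H where H: "root (2 ^ k) (q H) < b\<^sup>2 + e" "0 < H"
    using eventually_happens'[OF sequentially_bot] by blast
  have Gq: "G H ^ (2 ^ k) \<le> q H"
  proof -
    let ?A = "{..<H} \<times> {..<H}"
    have card: "real (card ?A) = (real H)\<^sup>2" by (simp add: power2_eq_square)
    have "G H = (\<Sum>i\<in>?A. g (gap (fst i) (snd i))) / card ?A"
      unfolding G_def card by (simp add: sum.cartesian_product case_prod_beta)
    moreover have "q H = (\<Sum>i\<in>?A. g (gap (fst i) (snd i)) ^ (2 ^ k)) / card ?A"
      unfolding q_def card gc by (simp add: sum.cartesian_product case_prod_beta)
    ultimately show ?thesis using average_power_le[of ?A "\<lambda>i. g (gap (fst i) (snd i))" k] H(2) by auto
  qed
  have "G H \<le> root (2 ^ k) (q H)"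
  proof (cases "k = 0")
    case True
    then show ?thesis using Gq by simp
  next
    case False
    have "0 \<le> g h" for h unfolding g using c0 False by simp
    then have "0 \<le> G H" unfolding G_def by (intro divide_nonneg_nonneg sum_nonneg) auto
    then have "G H = root (2 ^ k) (G H ^ (2 ^ k))" by (simp add: real_root_power_cancel)
    also have "\<dots> \<le> root (2 ^ k) (q H)" using Gq by simp
    finally show ?thesis .
  qed
  then have "G H \<le> b\<^sup>2 + e" using H by linarith
  then show "\<exists>H>0. (\<Sum>h<H. \<Sum>h'<H. g (gap h h')) / (real H)\<^sup>2 \<le> (box_seminorm M R (Suc k) f)\<^sup>2 + e"
    using H unfolding G_def b_def by blast
qed

text \<open>
  The analytic half of the induction step: bounds for the correlations by seminorms one level below give the
  bound for the averages.
\<close>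

lemma seminorm_bound_from_correlations:
  fixes f :: "'a \<Rightarrow> real" and w :: "int \<Rightarrow> 'a \<Rightarrow> real"
  assumes R: "directions R (s # ts)" and f: "f \<in> borel_measurable M" and C: "\<And>x. \<bar>f x\<bar> \<le> C"
    and w: "\<And>n. w n \<in> borel_measurable M" "\<And>n x. \<bar>w n x\<bar> \<le> C"
    and I: "\<forall>\<^sub>F j in sequentially. \<exists>l u. I j = {l..u}"
    and card: "filterlim (\<lambda>j. card (I j)) at_top sequentially"
    and corr: "\<And>h e. 0 < e \<Longrightarrow> \<forall>\<^sub>F j in sequentially.
      correlation M w (I j) h \<le> box_seminorm M R (length ts) (\<lambda>x. f x * f (U (of_nat h * s) x)) + e"
    and e: "0 < e"
  shows "\<forall>\<^sub>F j in sequentially. sqrt (\<integral>x. ((\<Sum>n\<in>I j. w n x) / card (I j))\<^sup>2 \<partial>M)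
    \<le> box_seminorm M R (Suc (length ts)) f + e"
proof -
  let ?b = "box_seminorm M R (Suc (length ts)) f"
  have e2: "0 < e\<^sup>2 / 2" using e by simp
  note b0 = seminorm_gap_average(1)[OF R f C e2]
  obtain H where H: "0 < H" "(\<Sum>h<H. \<Sum>h'<H. box_seminorm M R (length ts) (\<lambda>x. f x * f (U (of_nat (gap h h') * s) x))) / (real H)\<^sup>2
      \<le> ?b\<^sup>2 + e\<^sup>2 / 2"
    using seminorm_gap_average(2)[OF R f C e2] by blast
  have "\<forall>\<^sub>F j in sequentially. (\<integral>x. ((\<Sum>n\<in>I j. w n x) / card (I j))\<^sup>2 \<partial>M)
      \<le> (\<Sum>h<H. \<Sum>h'<H. box_seminorm M R (length ts) (\<lambda>x. f x * f (U (of_nat (gap h h') * s) x))) / (real H)\<^sup>2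
        + e\<^sup>2 / 2"
    by (rule van_der_Corput[where g = "\<lambda>h. box_seminorm M R (length ts) (\<lambda>x. f x * f (U (of_nat h * s) x))",
          OF prob_space_axioms w I card _ H(1) e2]) (rule corr)
  then show ?thesis
  proof eventually_elim
    case (elim j)
    then have "(\<integral>x. ((\<Sum>n\<in>I j. w n x) / card (I j))\<^sup>2 \<partial>M) \<le> ?b\<^sup>2 + e\<^sup>2" using H(2) by simp
    also have "\<dots> \<le> (?b + e)\<^sup>2" using b0 e by (simp add: power2_sum)
    finally show ?case using b0 e by (intro real_le_lsqrt) auto
  qed
qed

text \<open>
  The functions \<open>u n\<close> of the averages: each function of the list is evaluated along its own
  direction.
\<close>

definition along :: "('g \<times> ('a \<Rightarrow> real)) list \<Rightarrow> int \<Rightarrow> 'a \<Rightarrow> real" where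
  "along ps n x = (\<Prod>p\<leftarrow>ps. snd p (U (of_int n * fst p) x))"

lemma along_simps [simp]:
  "along [] n x = 1"
  "along (p # ps) n x = snd p (U (of_int n * fst p) x) * along ps n x"
  by (simp_all add: along_def)

lemma along_measurable:
  "(\<And>p. p \<in> set ps \<Longrightarrow> snd p \<in> borel_measurable M) \<Longrightarrow> along ps n \<in> borel_measurable M"
proof (induction ps)
  case Nil
  have "along [] n = (\<lambda>x. 1)" by (simp add: fun_eq_iff)
  then show ?case by simp
next
  case (Cons p ps)
  have "along (p # ps) n = (\<lambda>x. snd p (U (of_int n * fst p) x) * along ps n x)" by (simp add: fun_eq_iff)
  moreover have "\<dots> \<in> borel_measurable M"
    using Cons by (intro borel_measurable_times measurable_compose[OF U_measurable]) auto
  ultimately show ?case by simp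
qed

lemma along_bounded:
  "(\<And>p x. p \<in> set ps \<Longrightarrow> \<bar>snd p x\<bar> \<le> 1) \<Longrightarrow> \<bar>along ps n x\<bar> \<le> 1"
  by (induction ps) (simp_all add: abs_mult mult_le_one)

text \<open>
  What happens to a direction and its function when the correlation of order \<open>h\<close> is formed and the direction
  \<open>v\<close> is eliminated.
\<close>

definition twist :: "'g \<Rightarrow> nat \<Rightarrow> 'g \<times> ('a \<Rightarrow> real) \<Rightarrow> 'g \<times> ('a \<Rightarrow> real)" where
  "twist v h p = (fst p - v, \<lambda>x. snd p x * snd p (U (of_nat h * fst p) x))"

lemma twist_simps [simp]:
  "fst (twist v h p) = fst p - v"
  "snd (twist v h p) y = snd p y * snd p (U (of_nat h * fst p) y)"
  by (simp_all add: twist_def)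

text \<open>
  Both factors are read off at the point \<open>U (of_int n * v) x\<close>. From there a function with direction
  \<open>fst p\<close> is evaluated along \<open>fst p - v\<close>, and its second copy \<open>h\<close> steps of \<open>fst p\<close> further.
\<close>

lemma along_twist:
  "AE x in M. along ps n x * along ps (n + int h) x = along (map (twist v h) ps) n (U (of_int n * v) x)"
proof (induction ps)
  case (Cons p ps)
  have "of_int n * (fst p - v) + of_int n * v = of_int n * fst p" by (simp add: algebra_simps)
  then have 1: "AE x in M. U (of_int n * fst p) x = U (of_int n * (fst p - v)) (U (of_int n * v) x)"
    using U_add[of "of_int n * (fst p - v)" "of_int n * v"] by simp
  have "of_nat h * fst p + of_int n * fst p = of_int (n + int h) * fst p" by (simp add: algebra_simps)
  then have 2: "AE x in M. U (of_int (n + int h) * fst p) x = U (of_nat h * fst p) (U (of_int n * fst p) x)"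
    using U_add[of "of_nat h * fst p" "of_int n * fst p"] by simp
  show ?case using Cons 1 2
  proof eventually_elim
    case (elim x)
    have "along (p # ps) n x * along (p # ps) (n + int h) x
      = (snd p (U (of_int n * fst p) x) * snd p (U (of_int (n + int h) * fst p) x))
          * (along ps n x * along ps (n + int h) x)" by (simp only: along_simps mult_ac)
    also have "\<dots> = along (map (twist v h) (p # ps)) n (U (of_int n * v) x)"
      unfolding list.map along_simps twist_simps elim(1) elim(2)[symmetric] elim(3) ..
    finally show ?case .
  qed
qed simp

text \<open>
  The Cauchy-Schwarz inequality, as nonnegativity of the variance.
\<close>

lemma integral_le_L2:
  assumes [measurable]: "X \<in> borel_measurable M" "w \<in> borel_measurable M"
    and X: "\<And>x. \<bar>X x\<bar> \<le> C" and w: "\<And>x. \<bar>w x\<bar> \<le> (1::real)"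
  shows "(\<integral>x. w x * X x \<partial>M) \<le> sqrt (\<integral>x. (X x)\<^sup>2 \<partial>M)"
proof -
  have wX: "\<bar>w x * X x\<bar> \<le> \<bar>X x\<bar>" for x
    using mult_mono[OF w order_refl[of "\<bar>X x\<bar>"]] by (simp add: abs_mult)
  have i1: "integrable M (\<lambda>x. w x * X x)"
  proof (rule integrable_const_bound[of _ C])
    show "AE x in M. norm (w x * X x) \<le> C"
      unfolding real_norm_def by (intro AE_I2 order_trans[OF wX X])
  qed measurable
  have i2: "integrable M (\<lambda>x. (w x * X x)\<^sup>2)" "integrable M (\<lambda>x. (X x)\<^sup>2)"
  proof -
    have "\<bar>w x * X x\<bar> \<le> \<bar>C\<bar>" "\<bar>X x\<bar> \<le> \<bar>C\<bar>" for x using wX[of x] X[of x] by linarith+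
    then have "(w x * X x)\<^sup>2 \<le> C\<^sup>2" "(X x)\<^sup>2 \<le> C\<^sup>2" for x by (simp_all only: abs_le_square_iff)
    then show "integrable M (\<lambda>x. (w x * X x)\<^sup>2)" "integrable M (\<lambda>x. (X x)\<^sup>2)"
      by (auto intro!: integrable_const_bound[of _ "C\<^sup>2"])
  qed
  have "0 \<le> variance (\<lambda>x. w x * X x)" by (rule variance_positive)
  then have "(\<integral>x. w x * X x \<partial>M)\<^sup>2 \<le> (\<integral>x. (w x * X x)\<^sup>2 \<partial>M)"
    using variance_eq[OF i1 i2(1)] by simp
  also have "\<dots> \<le> (\<integral>x. (X x)\<^sup>2 \<partial>M)"
    by (rule integral_mono[OF i2]) (use wX in \<open>simp only: abs_le_square_iff\<close>)
  finally show ?thesis by (rule real_le_rsqrt)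
qed

text \<open>
  The first direction becomes \<open>s - fst p\<close>, the negative of the one that \<open>R\<close> had in this place, while the
  other differences do not change.
\<close>

lemma directions_map_Cons:
  assumes R: "directions R (s # map (\<lambda>q. fst q - s) (p # ps))"
  shows "directions R ((s - fst p) # map (\<lambda>q. fst q - (s - fst p)) (map (twist (fst p) h) ps))"
    (is "directions R ?us")
  unfolding directions_def
proof (intro allI impI)
  let ?ts = "s # map (\<lambda>q. fst q - s) (p # ps)"
  fix k assume k: "k < length ?us"
  then have "Suc k < length ?ts" by simp
  then have r: "represents (R (length ?ts - Suc k)) (?ts ! Suc k)"
    using R unfolding directions_def by blast
  have len: "length ?ts - Suc k = length ?us - k" by simp
  show "represents (R (length ?us - k)) (?us ! k)"
  proof (cases k)
    case 0
    then have "?ts ! Suc k = - (?us ! k)" by simp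
    then show ?thesis using represents_minus[OF r] unfolding len by simp
  next
    case (Suc i)
    then have "?ts ! Suc k = ?us ! k" using k by (simp add: twist_def)
    then show ?thesis using r unfolding len by (simp only:)
  qed
qed

text \<open>
  The base of the induction: on the level of exponent \<open>0\<close> the seminorm is the integral.
\<close>

lemma correlation_single:
  assumes f[measurable]: "f \<in> borel_measurable M" and J: "1 \<le> card J"
  shows "correlation M (along [(s, f)]) J h
    = box_seminorm M R 0 (\<lambda>x. f x * f (U (of_nat h * s) x))"
proof -
  let ?w = "along [(s, f)]" and ?\<phi> = "\<lambda>x. f x * f (U (of_nat h * s) x)"
  have cube0: "cube 0 = {[]}" by (auto simp: cube_def)
  have m: "(\<lambda>x. \<Prod>e\<in>cube 0. ?\<phi> (x e)) \<in> borel_measurable (PiM (cube 0) (\<lambda>_. M))"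
    by (intro borel_measurable_prod measurable_compose[OF measurable_component_singleton, of _ "cube 0" "\<lambda>_. M"]) auto
  have j: "(\<lambda>x. \<lambda>e\<in>cube 0. x) \<in> M \<rightarrow>\<^sub>M PiM (cube 0) (\<lambda>_. M)" by (rule measurable_restrict) simp
  have box: "box_seminorm M R 0 ?\<phi> = (\<integral>x. ?\<phi> x \<partial>M)"
    unfolding box_seminorm_def box_measure.simps integral_distr[OF j m] by (simp add: cube0)
  have "(\<integral>x. ?w n x * ?w (n + int h) x \<partial>M) = (\<integral>x. ?\<phi> x \<partial>M)" for n
  proof -
    have "AE x in M. ?w n x * ?w (n + int h) x = ?\<phi> (U (of_int n * s) x)"
      using along_twist[of "[(s, f)]" n h s] mpt_AE[OF U[of "of_int n * s"] U_zero]
      by eventually_elim (simp add: twist_def)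
    then have "(\<integral>x. ?w n x * ?w (n + int h) x \<partial>M) = (\<integral>x. ?\<phi> (U (of_int n * s) x) \<partial>M)"
      by (intro integral_cong_AE borel_measurable_times along_measurable) auto
    also have "\<dots> = (\<integral>x. ?\<phi> x \<partial>M)" by (rule mpt_integral[OF U]) measurable
    finally show ?thesis .
  qed
  then show ?thesis using J unfolding box by (simp add: correlation_def)
qed

text \<open>
  Every term of the correlation is the integral of \<open>g * w n\<close>, composed with \<open>U (of_int n * fst p)\<close>, where
  the factor \<open>g\<close> stems from \<open>p\<close>, is bounded by \<open>1\<close> and does not depend on \<open>n\<close>.
\<close>

lemma correlation_le_average:
  fixes s :: 'g and h :: nat
  assumes f[measurable]: "f \<in> borel_measurable M" and C: "\<And>x. \<bar>f x\<bar> \<le> C"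
    and ps: "\<And>q. q \<in> set (p # ps) \<Longrightarrow> snd q \<in> borel_measurable M" "\<And>q x. q \<in> set (p # ps) \<Longrightarrow> \<bar>snd q x\<bar> \<le> 1"
  defines "w \<equiv> along ((s - fst p, \<lambda>x. f x * f (U (of_nat h * s) x)) # map (twist (fst p) h) ps)"
  shows "correlation M (along ((s, f) # p # ps)) J h \<le> sqrt (\<integral>x. ((\<Sum>n\<in>J. w n x) / card J)\<^sup>2 \<partial>M)"
proof -
  have C0: "0 \<le> C" using order_trans[OF abs_ge_zero C] .
  let ?v = "along ((s, f) # p # ps)"
  define \<phi> where "\<phi> x = f x * f (U (of_nat h * s) x)" for x
  define g where "g x = snd p x * snd p (U (of_nat h * fst p) x)" for x
  define qs where "qs = map (twist (fst p) h) ps"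
  have w_eq: "w = along ((s - fst p, \<phi>) # qs)" unfolding w_def \<phi>_def qs_def ..
  have \<phi>m: "\<phi> \<in> borel_measurable M" unfolding \<phi>_def by measurable
  have [measurable]: "snd p \<in> borel_measurable M" using ps(1) by simp
  have gm: "g \<in> borel_measurable M" unfolding g_def by measurable
  have \<phi>b: "\<bar>\<phi> x\<bar> \<le> C * C" for x
    unfolding \<phi>_def abs_mult by (intro mult_mono C C0 abs_ge_zero)
  have gb: "\<bar>g x\<bar> \<le> 1" for x
    unfolding g_def abs_mult by (intro mult_le_one ps(2) abs_ge_zero) auto
  have vm: "?v n \<in> borel_measurable M" for n by (rule along_measurable) (use f ps(1) in auto)
  have qs: "snd q \<in> borel_measurable M" "\<bar>snd q x\<bar> \<le> 1" if q: "q \<in> set qs" for q x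
  proof -
    obtain r where r: "r \<in> set ps" "q = twist (fst p) h r" using q unfolding qs_def by auto
    have [measurable]: "snd r \<in> borel_measurable M" using ps(1) r by simp
    show "snd q \<in> borel_measurable M" unfolding r twist_def by simp
    show "\<bar>snd q x\<bar> \<le> 1" unfolding r twist_def snd_conv abs_mult
      by (intro mult_le_one ps(2) abs_ge_zero) (use r in auto)
  qed
  have wm: "w n \<in> borel_measurable M" for n
    unfolding w_eq by (rule along_measurable) (use qs \<phi>m in auto)
  have wb: "\<bar>w n x\<bar> \<le> C * C" for n x
  proof -
    have "\<bar>\<phi> (U (of_int n * (s - fst p)) x)\<bar> * \<bar>along qs n x\<bar> \<le> (C * C) * 1"
      by (intro mult_mono \<phi>b along_bounded qs abs_ge_zero) (use C0 in auto)
    then show ?thesis by (simp add: w_eq abs_mult)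
  qed
  have inner: "(\<integral>x. ?v n x * ?v (n + int h) x \<partial>M) = (\<integral>x. g x * w n x \<partial>M)" for n
  proof -
    have "AE x in M. ?v n x * ?v (n + int h) x = g (U (of_int n * fst p) x) * w n (U (of_int n * fst p) x)"
      using along_twist[of "(s, f) # p # ps" n h "fst p"] mpt_AE[OF U[of "of_int n * fst p"] U_zero]
    proof eventually_elim
      case (elim x)
      show ?case unfolding elim(1) by (simp add: twist_def \<phi>_def g_def qs_def w_eq elim(2))
    qed
    then have "(\<integral>x. ?v n x * ?v (n + int h) x \<partial>M)
        = (\<integral>x. g (U (of_int n * fst p) x) * w n (U (of_int n * fst p) x) \<partial>M)"
      by (intro integral_cong_AE borel_measurable_times vm measurable_compose[OF U_measurable gm]
          measurable_compose[OF U_measurable wm])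
    also have "\<dots> = (\<integral>x. g x * w n x \<partial>M)"
      by (rule mpt_integral[OF U]) (intro borel_measurable_times wm gm)
    finally show ?thesis .
  qed
  have int: "integrable M (\<lambda>x. g x * w n x)" for n
  proof (rule integrable_const_bound[of _ "1 * (C * C)"])
    show "AE x in M. norm (g x * w n x) \<le> 1 * (C * C)"
      unfolding real_norm_def abs_mult by (intro AE_I2 mult_mono gb wb abs_ge_zero) auto
  qed (intro borel_measurable_times wm gm)
  define X where "X x = (\<Sum>n\<in>J. w n x) / card J" for x
  have Xm: "X \<in> borel_measurable M"
    unfolding X_def by (intro borel_measurable_divide borel_measurable_sum wm) auto
  have Xb: "\<bar>X x\<bar> \<le> C * C" for x unfolding X_def by (rule set_average_bounded[OF wb])
  have "correlation M ?v J h = (\<integral>x. (\<Sum>n\<in>J. g x * w n x) / card J \<partial>M)"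
    unfolding correlation_def inner by (simp add: int Bochner_Integration.integral_sum)
  also have "\<dots> = (\<integral>x. g x * X x \<partial>M)"
    by (simp add: X_def sum_distrib_left)
  also have "\<dots> \<le> sqrt (\<integral>x. (X x)\<^sup>2 \<partial>M)"
    by (rule integral_le_L2[OF Xm gm Xb gb])
  finally show ?thesis unfolding X_def .
qed

text \<open>
  The induction is on the length of the list, since the correlation inequality replaces both the functions and
  the directions.
\<close>

theorem multiple_average_bound:
  fixes f :: "'a \<Rightarrow> real" and ps :: "('g \<times> ('a \<Rightarrow> real)) list" and I :: "nat \<Rightarrow> int set"
  assumes I: "\<forall>\<^sub>F j in sequentially. \<exists>l u. I j = {l..u}"
    and card: "filterlim (\<lambda>j. card (I j)) at_top sequentially"
    and f: "f \<in> borel_measurable M" and C: "\<And>x. \<bar>f x\<bar> \<le> C"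
    and ps: "\<And>p. p \<in> set ps \<Longrightarrow> snd p \<in> borel_measurable M" "\<And>p x. p \<in> set ps \<Longrightarrow> \<bar>snd p x\<bar> \<le> 1"
    and R: "directions R (s # map (\<lambda>p. fst p - s) ps)" and e: "0 < e"
  shows "\<forall>\<^sub>F j in sequentially. sqrt (\<integral>x. ((\<Sum>n\<in>I j. along ((s, f) # ps) n x) / card (I j))\<^sup>2 \<partial>M)
    \<le> box_seminorm M R (Suc (length ps)) f + e"
  using f C ps R e
proof (induction ps arbitrary: s f C e rule: measure_induct_rule[where f = length])
  case (less ps s f C e)
  note f[measurable] = less.prems(1)
  have C0: "0 \<le> C" using order_trans[OF abs_ge_zero less.prems(2)] .
  let ?w = "along ((s, f) # ps)"
  have wm: "?w n \<in> borel_measurable M" for n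
    by (rule along_measurable) (use less.prems(1,3) in auto)
  have wb: "\<bar>?w n x\<bar> \<le> C" for n x
  proof -
    have "\<bar>f (U (of_int n * s) x)\<bar> * \<bar>along ps n x\<bar> \<le> C * 1"
      by (intro mult_mono less.prems(2) along_bounded less.prems(4) C0 abs_ge_zero)
    then show "\<bar>?w n x\<bar> \<le> C" by (simp add: abs_mult)
  qed
  have corr: "\<forall>\<^sub>F j in sequentially. correlation M ?w (I j) h
      \<le> box_seminorm M R (length (map (\<lambda>p. fst p - s) ps)) (\<lambda>x. f x * f (U (of_nat h * s) x)) + \<delta>"
    if \<delta>: "0 < \<delta>" for h \<delta>
  proof (cases ps)
    case Nil
    have "\<forall>\<^sub>F j in sequentially. 1 \<le> card (I j)"
      using card unfolding filterlim_at_top by blast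
    then show ?thesis
    proof eventually_elim
      case (elim j)
      then show ?case using correlation_single[OF f elim, of s h R] \<delta> unfolding Nil by simp
    qed
  next
    case (Cons p qs)
    let ?\<phi> = "\<lambda>x. f x * f (U (of_nat h * s) x)" and ?qs = "map (twist (fst p) h) qs"
    have qs: "snd q \<in> borel_measurable M" "\<bar>snd q x\<bar> \<le> 1" if q: "q \<in> set ?qs" for q x
    proof -
      obtain r where r: "r \<in> set qs" "q = twist (fst p) h r" using q by auto
      have [measurable]: "snd r \<in> borel_measurable M" using less.prems(3) r Cons by simp
      show "snd q \<in> borel_measurable M" unfolding r twist_def by simp
      show "\<bar>snd q x\<bar> \<le> 1" unfolding r twist_def snd_conv abs_mult
        by (intro mult_le_one less.prems(4) abs_ge_zero) (use r Cons in auto)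
    qed
    have "\<forall>\<^sub>F j in sequentially. sqrt (\<integral>x. ((\<Sum>n\<in>I j. along ((s - fst p, ?\<phi>) # ?qs) n x) / card (I j))\<^sup>2 \<partial>M)
        \<le> box_seminorm M R (Suc (length ?qs)) ?\<phi> + \<delta>"
    proof (rule less.IH[of ?qs ?\<phi> "C * C" "s - fst p" \<delta>])
      show "length ?qs < length ps" by (simp add: Cons)
      show "\<bar>?\<phi> x\<bar> \<le> C * C" for x unfolding abs_mult by (intro mult_mono less.prems(2) C0 abs_ge_zero)
      show "directions R ((s - fst p) # map (\<lambda>q. fst q - (s - fst p)) ?qs)"
        by (rule directions_map_Cons) (use less.prems(5) in \<open>simp only: Cons\<close>)
    qed (use qs \<delta> in auto)
    then show ?thesis
    proof eventually_elim
      case (elim j)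
      have "correlation M ?w (I j) h \<le> sqrt (\<integral>x. ((\<Sum>n\<in>I j. along ((s - fst p, ?\<phi>) # ?qs) n x) / card (I j))\<^sup>2 \<partial>M)"
        unfolding Cons by (rule correlation_le_average[OF f less.prems(2)]) (use less.prems(3,4) Cons in auto)
      then show ?case using elim by (simp add: Cons)
    qed
  qed
  from seminorm_bound_from_correlations[OF less.prems(5,1,2) wm wb I card corr less.prems(6)]
  show ?case by simp
qed

end

section \<open>Commuting transformations\<close>

lemma invertible_mptD:
  assumes "invertible_mpt M S"
  shows "mpt M S" and "mpt M (inv_into (space M) S)"
    and "x \<in> space M \<Longrightarrow> inv_into (space M) S (S x) = x"
    and "x \<in> space M \<Longrightarrow> S (inv_into (space M) S x) = x"
proof -
  let ?S' = "inv_into (space M) S"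
  have S: "S \<in> M \<rightarrow>\<^sub>M M" "distr M M S = M" "bij_betw S (space M) (space M)" "?S' \<in> M \<rightarrow>\<^sub>M M"
    using assms by (auto simp: invertible_mpt_def)
  show "mpt M S" using S by (simp add: mpt_def)
  show l: "?S' (S x) = x" if "x \<in> space M" for x
    by (rule bij_betw_inv_into_left[OF S(3) that])
  show "S (?S' x) = x" if "x \<in> space M" for x
    by (rule bij_betw_inv_into_right[OF S(3) that])
  have "distr M M ?S' = distr (distr M M S) M ?S'" by (simp only: S(2))
  also have "\<dots> = distr M M (?S' \<circ> S)" by (rule distr_distr[OF S(4,1)])
  also have "\<dots> = distr M M (\<lambda>x. x)" by (rule distr_cong) (auto simp: l)
  finally show "mpt M ?S'" using S(4) by (simp add: mpt_def distr_id2)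
qed

lemma mpt_int_iterate:
  assumes "invertible_mpt M S"
  shows "mpt M (int_iterate M S n)"
  using mpt_funpow[OF invertible_mptD(1)[OF assms]] mpt_funpow[OF invertible_mptD(2)[OF assms]]
  by (cases "0 \<le> n") (simp_all only: int_iterate_def if_True if_False)

lemma int_iterate_0 [simp]: "int_iterate M S 0 x = x"
  by (simp add: int_iterate_def)

lemma int_iterate_1 [simp]: "int_iterate M S 1 x = S x"
  by (simp add: int_iterate_def)

lemma int_iterate_succ:
  assumes S: "invertible_mpt M S" and x: "x \<in> space M"
  shows "int_iterate M S (n + 1) x = S (int_iterate M S n x)"
proof (cases "0 \<le> n")
  case True
  then have "nat (n + 1) = Suc (nat n)" by simp
  then show ?thesis using True by (simp add: int_iterate_def)
next
  case False
  let ?S' = "inv_into (space M) S"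
  have n: "nat (- n) = Suc (nat (- (n + 1)))" using False by simp
  have "(?S' ^^ nat (- (n + 1))) x \<in> space M"
    by (rule mpt_space[OF mpt_funpow[OF invertible_mptD(2)[OF S]] x])
  then have "S (int_iterate M S n x) = (?S' ^^ nat (- (n + 1))) x"
    using False n invertible_mptD(4)[OF S] by (simp add: int_iterate_def)
  also have "\<dots> = int_iterate M S (n + 1) x"
    using False by (cases "n = -1") (simp_all add: int_iterate_def)
  finally show ?thesis by simp
qed

lemma int_iterate_pred:
  assumes S: "invertible_mpt M S" and x: "x \<in> space M"
  shows "int_iterate M S (n - 1) x = inv_into (space M) S (int_iterate M S n x)"
  using int_iterate_succ[OF S x, of "n - 1"] invertible_mptD(3)[OF S mpt_space[OF mpt_int_iterate[OF S] x], of "n - 1"]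
  by simp

lemma int_iterate_add:
  assumes S: "invertible_mpt M S" and x: "x \<in> space M"
  shows "int_iterate M S (m + n) x = int_iterate M S m (int_iterate M S n x)"
proof (induction m rule: int_induct[of _ 0])
  case base
  then show ?case by simp
next
  case (step1 m)
  have "int_iterate M S (m + 1 + n) x = S (int_iterate M S (m + n) x)"
    using int_iterate_succ[OF S x, of "m + n"] by (simp add: algebra_simps)
  then show ?case using step1 int_iterate_succ[OF S mpt_space[OF mpt_int_iterate[OF S] x]] by simp
next
  case (step2 m)
  have "int_iterate M S (m - 1 + n) x = inv_into (space M) S (int_iterate M S (m + n) x)"
    using int_iterate_pred[OF S x, of "m + n"] by (simp add: algebra_simps)
  then show ?case using step2 int_iterate_pred[OF S mpt_space[OF mpt_int_iterate[OF S] x]] by simp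
qed

lemma commute_funpow:
  assumes F: "mpt M F" and comm: "AE x in M. F (G x) = G (F x)"
  shows "AE x in M. (F ^^ n) (G x) = G ((F ^^ n) x)"
proof (induction n)
  case (Suc n)
  show ?case using Suc mpt_AE[OF mpt_funpow[OF F] comm, of n] by eventually_elim simp
qed simp

text \<open>
  The commutation relation at the preimage of \<open>x\<close>, with the inverse applied to both sides.
\<close>

lemma commute_inverse:
  assumes F: "invertible_mpt M F" and G: "mpt M G" and comm: "AE x in M. F (G x) = G (F x)"
  shows "AE x in M. inv_into (space M) F (G x) = G (inv_into (space M) F x)"
proof -
  let ?F' = "inv_into (space M) F"
  show ?thesis using mpt_AE[OF invertible_mptD(2)[OF F] comm] AE_space
  proof eventually_elim
    case (elim x)
    have "G (?F' x) \<in> space M" using mpt_space[OF G] mpt_space[OF invertible_mptD(2)[OF F]] elim(2) by blast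
    then have "?F' (F (G (?F' x))) = G (?F' x)" by (rule invertible_mptD(3)[OF F])
    then show ?case using elim invertible_mptD(4)[OF F elim(2)] by simp
  qed
qed

lemma commute_int_iterate:
  assumes F: "invertible_mpt M F" and G: "mpt M G" and comm: "AE x in M. F (G x) = G (F x)"
  shows "AE x in M. int_iterate M F n (G x) = G (int_iterate M F n x)"
  unfolding int_iterate_def
  using commute_funpow[OF invertible_mptD(1)[OF F] comm]
    commute_funpow[OF invertible_mptD(2)[OF F] commute_inverse[OF F G comm]] by simp

lemma commute_int_iterates:
  assumes F: "invertible_mpt M F" and G: "invertible_mpt M G" and comm: "AE x in M. F (G x) = G (F x)"
  shows "AE x in M. int_iterate M F m (int_iterate M G n x) = int_iterate M G n (int_iterate M F m x)"
proof (rule commute_int_iterate[OF F mpt_int_iterate[OF G]])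
  have "AE x in M. G (F x) = F (G x)" using comm by eventually_elim simp
  from commute_int_iterate[OF G invertible_mptD(1)[OF F] this, of n]
  show "AE x in M. F (int_iterate M G n x) = int_iterate M G n (F x)" by eventually_elim simp
qed

text \<open>
  The joint action of \<open>S 1, \<dots>, S k\<close>, where the exponent of \<open>S i\<close> is \<open>v i\<close>.
\<close>

primrec iterates :: "'a measure \<Rightarrow> (nat \<Rightarrow> 'a \<Rightarrow> 'a) \<Rightarrow> nat \<Rightarrow> (nat \<Rightarrow> int) \<Rightarrow> 'a \<Rightarrow> 'a" where
  "iterates M S 0 v x = x"
| "iterates M S (Suc k) v x = iterates M S k v (int_iterate M (S (Suc k)) (v (Suc k)) x)"

lemma iterates_zero: "iterates M S k 0 x = x"
  by (induction k arbitrary: x) simp_all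

lemma iterates_single:
  assumes "\<And>j. j \<noteq> i \<Longrightarrow> v j = 0"
  shows "iterates M S k v x = (if i \<in> {1..k} then int_iterate M (S i) (v i) x else x)"
proof (induction k arbitrary: x)
  case (Suc k)
  show ?case
  proof (cases "i = Suc k")
    case True
    then show ?thesis by (simp add: Suc)
  next
    case False
    then have "v (Suc k) = 0" using assms by metis
    then show ?thesis using False by (auto simp: Suc le_Suc_eq)
  qed
qed simp

lemma of_int_fun: "(of_int n :: nat \<Rightarrow> int) i = n"
  by (induction n rule: int_induct[of _ 0]) simp_all

context
  fixes M :: "'a measure" and d :: nat and S :: "nat \<Rightarrow> 'a \<Rightarrow> 'a"
  assumes S: "\<And>i. i \<in> {1..d} \<Longrightarrow> invertible_mpt M (S i)"
    and comm: "\<And>i j. i \<in> {1..d} \<Longrightarrow> j \<in> {1..d} \<Longrightarrow> AE x in M. S i (S j x) = S j (S i x)"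
begin

lemma mpt_iterates: "k \<le> d \<Longrightarrow> mpt M (iterates M S k v)"
proof (induction k)
  case 0
  have "iterates M S 0 v = (\<lambda>x. x)" by (simp add: fun_eq_iff)
  then show ?case using mpt_id by simp
next
  case (Suc k)
  have "iterates M S (Suc k) v = iterates M S k v \<circ> int_iterate M (S (Suc k)) (v (Suc k))"
    by (simp add: fun_eq_iff)
  moreover have "mpt M (int_iterate M (S (Suc k)) (v (Suc k)))" using Suc by (intro mpt_int_iterate S) simp
  moreover have "mpt M (iterates M S k v)" using Suc by simp
  ultimately show ?case using mpt_comp by metis
qed

lemma iterates_commute:
  assumes i: "i \<in> {1..d}" and "k \<le> d"
  shows "AE x in M. iterates M S k v (int_iterate M (S i) n x) = int_iterate M (S i) n (iterates M S k v x)"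
  using assms(2)
proof (induction k)
  case (Suc k)
  then have k: "Suc k \<in> {1..d}" by simp
  let ?Z = "int_iterate M (S (Suc k)) (v (Suc k))"
  have "AE x in M. ?Z (int_iterate M (S i) n x) = int_iterate M (S i) n (?Z x)"
    by (rule commute_int_iterates[OF S[OF k] S[OF i] comm[OF k i]])
  moreover have "AE x in M. iterates M S k v (int_iterate M (S i) n (?Z x)) = int_iterate M (S i) n (iterates M S k v (?Z x))"
    by (rule mpt_AE[OF mpt_int_iterate[OF S[OF k]]]) (use Suc in simp)
  ultimately show ?case by eventually_elim simp
qed simp

text \<open>
  The powers of a single map add up on the whole space; moving the second copy of \<open>S (Suc k)\<close> past the first
  \<open>k\<close> maps costs a null set.
\<close>

lemma iterates_add:
  assumes "k \<le> d"
  shows "AE x in M. iterates M S k (v + w) x = iterates M S k v (iterates M S k w x)"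
  using assms
proof (induction k)
  case (Suc k)
  then have k: "Suc k \<in> {1..d}" by simp
  let ?Z = "\<lambda>v :: nat \<Rightarrow> int. int_iterate M (S (Suc k)) (v (Suc k))"
  have Z: "mpt M (?Z v)" for v by (rule mpt_int_iterate[OF S[OF k]])
  have 1: "AE x in M. iterates M S k (v + w) (?Z (v + w) x) = iterates M S k v (iterates M S k w (?Z (v + w) x))"
    by (rule mpt_AE[OF Z]) (use Suc in simp)
  have 2: "AE x in M. iterates M S k w (?Z v (?Z w x)) = ?Z v (iterates M S k w (?Z w x))"
    by (rule mpt_AE[OF Z]) (use Suc.prems in \<open>auto intro: iterates_commute[OF k]\<close>)
  show ?case using 1 2 AE_space
  proof eventually_elim
    case (elim x)
    have Z: "?Z (v + w) x = ?Z v (?Z w x)" using int_iterate_add[OF S[OF k] elim(3)] by simp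
    have "iterates M S (Suc k) (v + w) x = iterates M S k v (iterates M S k w (?Z (v + w) x))"
      using elim(1) by (simp only: iterates.simps)
    also have "\<dots> = iterates M S k v (?Z v (iterates M S k w (?Z w x)))"
      by (simp only: Z elim(2))
    finally show ?case by (simp only: iterates.simps)
  qed
qed simp

end

lemma L_inftyD:
  assumes "f \<in> L_infty M" and "esssup M (\<lambda>x. ereal \<bar>f x\<bar>) \<le> ereal C"
  shows "f \<in> borel_measurable M" and "AE x in M. \<bar>f x\<bar> \<le> C"
proof -
  show f: "f \<in> borel_measurable M" using assms(1) by (simp add: L_infty_def)
  have "AE x in M. ereal \<bar>f x\<bar> \<le> esssup M (\<lambda>x. ereal \<bar>f x\<bar>)"
    by (rule esssup_AE)
  then show "AE x in M. \<bar>f x\<bar> \<le> C"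
  proof eventually_elim
    case (elim x)
    then have "ereal \<bar>f x\<bar> \<le> ereal C" using assms(2) by (rule order_trans)
    then show ?case by simp
  qed
qed

theorem proposition1:
  fixes M :: "'a measure" and d :: nat
    and S T :: "nat \<Rightarrow> 'a \<Rightarrow> 'a"
    and f :: "nat \<Rightarrow> 'a \<Rightarrow> real"
    and I :: "nat \<Rightarrow> int set"
  assumes "standard_prob_space M"
    and "d \<ge> 1"
    and "\<And>i. i \<in> {1..d} \<Longrightarrow> invertible_mpt M (S i)"
    and "\<And>i j. i \<in> {1..d} \<Longrightarrow> j \<in> {1..d} \<Longrightarrow> AE x in M. S i (S j x) = S j (S i x)"
    and "T 1 = S 1"
    and "\<And>i. i \<in> {2..d} \<Longrightarrow> T i = S i \<circ> inv_into (space M) (S 1)"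
    and "\<And>i. i \<in> {1..d} \<Longrightarrow> f i \<in> L_infty M"
    and "\<And>i. i \<in> {2..d} \<Longrightarrow> esssup M (\<lambda>x. ereal \<bar>f i x\<bar>) \<le> 1"
    and "\<And>j. j \<ge> 1 \<Longrightarrow> \<exists>a b. I j = {a..b}"
    and "filterlim (\<lambda>j. card (I j)) at_top sequentially"
  shows "limsup (\<lambda>j. ereal (L2_norm M
             (\<lambda>x. 1 / real (card (I j)) *
                  (\<Sum>n\<in>I j. \<Prod>i\<in>{1..d}. f i (int_iterate M (S i) n x)))))
         \<le> ereal (box_seminorm M (\<lambda>k. T (d + 1 - k)) d (f 1))"
proof -
  let ?A = "\<lambda>j x. 1 / real (card (I j)) * (\<Sum>n\<in>I j. \<Prod>i\<in>{1..d}. f i (int_iterate M (S i) n x))"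
  interpret standard_prob_space M by (rule assms(1))
  define U where "U = iterates M S d"
  interpret group_action M U
  proof
    show "standard_borel M" by (rule standard_prob_space_standard_borel[OF assms(1)])
    show "mpt M (U v)" for v unfolding U_def by (rule mpt_iterates[OF assms(3,4)]) auto
    show "AE x in M. U 0 x = x" unfolding U_def by (simp add: iterates_zero)
    show "AE x in M. U (v + w) x = U v (U w x)" for v w
      unfolding U_def by (rule iterates_add[OF assms(3,4)]) auto
  qed
  define \<epsilon> :: "nat \<Rightarrow> nat \<Rightarrow> int" where "\<epsilon> i j = (if j = i then 1 else 0)" for i j
  have U_\<epsilon>: "U (of_int n * \<epsilon> i) x = int_iterate M (S i) n x" if "i \<in> {1..d}" for n i x
    unfolding U_def using that
    by (subst iterates_single[of i]) (simp_all add: of_int_fun \<epsilon>_def)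
  have S_\<epsilon>: "U (\<epsilon> i) x = S i x" if "i \<in> {1..d}" for i x
    using U_\<epsilon>[OF that, of 1 x] by simp
  have d1: "1 \<in> {1..d}" using assms(2) by simp
  have S'_\<epsilon>: "AE x in M. inv_into (space M) (S 1) x = U (- \<epsilon> 1) x"
  proof (rule AE_I2)
    fix x assume x: "x \<in> space M"
    show "inv_into (space M) (S 1) x = U (- \<epsilon> 1) x"
      using U_\<epsilon>[OF d1, of "-1" x] by (simp add: int_iterate_def)
  qed
  obtain C where C: "0 \<le> C" "esssup M (\<lambda>x. ereal \<bar>f 1 x\<bar>) \<le> ereal C"
  proof -
    have "esssup M (\<lambda>x. ereal \<bar>f 1 x\<bar>) < \<infinity>" using assms(7)[OF d1] by (simp add: L_infty_def)
    then show ?thesis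
    proof (cases "esssup M (\<lambda>x. ereal \<bar>f 1 x\<bar>)")
      case (real r)
      then show ?thesis by (intro that[of "max 0 r"]) auto
    next
      case MInf
      then show ?thesis by (intro that[of 0]) auto
    qed simp
  qed
  define c where "c i = (if i = 1 then C else 1)" for i :: nat
  define g where "g i = truncate (c i) (f i)" for i
  have ess: "esssup M (\<lambda>x. ereal \<bar>f i x\<bar>) \<le> ereal (c i)" if "i \<in> {1..d}" for i
    using that C assms(8)[of i] by (cases "i = 1") (auto simp: c_def one_ereal_def)
  have fm: "f i \<in> borel_measurable M" and fb: "AE x in M. \<bar>f i x\<bar> \<le> c i" if "i \<in> {1..d}" for i
    using L_inftyD[OF assms(7)[OF that] ess[OF that]] by auto
  have gm: "g i \<in> borel_measurable M" if "i \<in> {1..d}" for i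
    unfolding g_def by (rule truncate_measurable[OF fm[OF that]])
  have gb: "\<bar>g i x\<bar> \<le> c i" for i x
    unfolding g_def by (rule truncate_bounded) (use C in \<open>simp add: c_def\<close>)
  have gf: "AE x in M. g i x = f i x" if "i \<in> {1..d}" for i
    using fb[OF that] unfolding g_def by eventually_elim (rule truncate_eq)
  define ps where "ps = map (\<lambda>i. (\<epsilon> i, g i)) [2..<d + 1]"
  define R where "R k = T (d + 1 - k)" for k
  have len: "Suc (length ps) = d" using assms(2) unfolding ps_def length_map length_upt by arith
  have dirs: "directions R (\<epsilon> 1 # map (\<lambda>p. fst p - \<epsilon> 1) ps)"
    unfolding directions_def
  proof (intro allI impI)
    let ?ts = "\<epsilon> 1 # map (\<lambda>p. fst p - \<epsilon> 1) ps"
    fix k assume k: "k < length ?ts"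
    then have kd: "k < d" using len by simp
    have R: "R (length ?ts - k) = T (Suc k)" using len kd by (simp add: R_def)
    show "represents (R (length ?ts - k)) (?ts ! k)"
    proof (cases k)
      case 0
      have "mpt M (S 1)" by (rule invertible_mptD(1)[OF assms(3)[OF d1]])
      then show ?thesis unfolding R using 0 S_\<epsilon>[OF d1] assms(5) by (simp add: represents_def)
    next
      case (Suc i)
      then have i: "Suc (Suc i) \<in> {2..d}" "Suc (Suc i) \<in> {1..d}" using kd by auto
      have ts: "?ts ! k = \<epsilon> (Suc (Suc i)) - \<epsilon> 1"
      proof -
        have "i < length [2..<d + 1]" "[2..<d + 1] ! i = Suc (Suc i)"
          using kd Suc nth_upt[of 2 i "d + 1"] by (auto simp del: upt_Suc)
        then show ?thesis by (simp add: Suc ps_def del: upt_Suc)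
      qed
      have 1: "mpt M (S (Suc (Suc i)))" "AE x in M. S (Suc (Suc i)) x = U (\<epsilon> (Suc (Suc i))) x"
        using invertible_mptD(1)[OF assms(3)[OF i(2)]] S_\<epsilon>[OF i(2)] by auto
      have 2: "mpt M (inv_into (space M) (S 1))" by (rule invertible_mptD(2)[OF assms(3)[OF d1]])
      have "AE x in M. (S (Suc (Suc i)) \<circ> inv_into (space M) (S 1)) x = U (\<epsilon> (Suc (Suc i)) + - \<epsilon> 1) x"
        using represented_comp[OF 1 2 S'_\<epsilon>] by simp
      then show ?thesis unfolding R ts using mpt_comp[OF 1(1) 2] assms(6)[OF i(1)] Suc
        by (simp add: represents_def)
    qed
  qed
  have g1: "\<bar>g 1 x\<bar> \<le> C" for x using gb[of 1 x] by (simp add: c_def)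
  have psb: "snd p \<in> borel_measurable M" "\<bar>snd p x\<bar> \<le> 1" if p: "p \<in> set ps" for p x
  proof -
    have "p \<in> (\<lambda>i. (\<epsilon> i, g i)) ` {2..<d + 1}" using p by (simp only: ps_def set_map set_upt)
    then obtain i where "i \<in> {2..<d + 1}" and i: "p = (\<epsilon> i, g i)" by (rule imageE)
    then have i: "i \<in> {2..d}" "p = (\<epsilon> i, g i)" by simp_all
    show "snd p \<in> borel_measurable M" using i gm[of i] by simp
    show "\<bar>snd p x\<bar> \<le> 1" using i gb[of i x] by (simp add: c_def)
  qed
  have I: "\<forall>\<^sub>F j in sequentially. \<exists>l u. I j = {l..u}"
    using eventually_ge_at_top[of 1] by eventually_elim (rule assms(9))
  have bound: "\<forall>\<^sub>F j in sequentially. sqrt (\<integral>x. ((\<Sum>n\<in>I j. along ((\<epsilon> 1, g 1) # ps) n x) / card (I j))\<^sup>2 \<partial>M)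
      \<le> box_seminorm M R d (g 1) + e" if e: "0 < e" for e
    using multiple_average_bound[OF I assms(10) gm[OF d1] g1 psb dirs e] unfolding len .
  have along: "along ((\<epsilon> 1, g 1) # ps) n x = (\<Prod>i\<in>{1..d}. g i (int_iterate M (S i) n x))" for n x
  proof -
    have "(\<Prod>i\<in>{1..d}. g i (int_iterate M (S i) n x)) = (\<Prod>i\<leftarrow>[1..<d + 1]. g i (int_iterate M (S i) n x))"
      by (subst prod.distinct_set_conv_list[symmetric]) (auto intro!: prod.cong)
    also have "[1..<d + 1] = 1 # [2..<d + 1]" using assms(2) by (simp add: upt_conv_Cons numeral_2_eq_2)
    also have "(\<Prod>i\<leftarrow>1 # [2..<d + 1]. g i (int_iterate M (S i) n x)) = along ((\<epsilon> 1, g 1) # ps) n x"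
    proof -
      have "(\<Prod>i\<leftarrow>[2..<d + 1]. g i (int_iterate M (S i) n x)) = along ps n x"
        unfolding along_def ps_def using U_\<epsilon> by (intro arg_cong[where f = prod_list]) (auto simp: o_def)
      then show ?thesis using U_\<epsilon>[OF d1] by simp
    qed
    finally show ?thesis by simp
  qed
  have box: "box_seminorm M R d (g 1) = box_seminorm M R d (f 1)"
  proof -
    interpret B: box_system M R d using directions_box_system[OF dirs] len by simp
    have "AE x in box_measure M R d. \<forall>e\<in>cube d. g 1 (x e) = f 1 (x e)"
      by (rule B.AE_box_coordinates[OF order_refl gf[OF d1]])
    then have "AE x in box_measure M R d. (\<Prod>e\<in>cube d. g 1 (x e)) = (\<Prod>e\<in>cube d. f 1 (x e))"
      by eventually_elim (simp cong: prod.cong)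
    then show ?thesis unfolding box_seminorm_def
      by (subst integral_cong_AE[OF B.cube_product_measurable[OF gm[OF d1]] B.cube_product_measurable[OF fm[OF d1]]]) auto
  qed
  have norm: "L2_norm M (?A j)
      = sqrt (\<integral>x. ((\<Sum>n\<in>I j. along ((\<epsilon> 1, g 1) # ps) n x) / card (I j))\<^sup>2 \<partial>M)" for j
  proof -
    have Z: "int_iterate M (S i) n \<in> M \<rightarrow>\<^sub>M M" if "i \<in> {1..d}" for i n
      by (rule mpt_measurable[OF mpt_int_iterate[OF assms(3)[OF that]]])
    have "AE x in M. \<forall>n. \<forall>i. i \<in> {1..d} \<longrightarrow> g i (int_iterate M (S i) n x) = f i (int_iterate M (S i) n x)"
      unfolding AE_all_countable using mpt_AE[OF mpt_int_iterate[OF assms(3)] gf] by auto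
    then have "AE x in M. (1 / real (card (I j)) * (\<Sum>n\<in>I j. \<Prod>i\<in>{1..d}. f i (int_iterate M (S i) n x)))\<^sup>2
        = ((\<Sum>n\<in>I j. along ((\<epsilon> 1, g 1) # ps) n x) / card (I j))\<^sup>2"
      unfolding along
    proof eventually_elim
      case (elim x)
      then have "(\<Prod>i\<in>{1..d}. g i (int_iterate M (S i) n x)) = (\<Prod>i\<in>{1..d}. f i (int_iterate M (S i) n x))" for n
        by (intro prod.cong) auto
      then show ?case by simp
    qed
    then show ?thesis unfolding L2_norm_def along
      by (intro arg_cong[where f = sqrt] integral_cong_AE borel_measurable_power borel_measurable_times
          borel_measurable_divide borel_measurable_sum borel_measurable_prod borel_measurable_const
          measurable_compose[OF Z fm] measurable_compose[OF Z gm])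
  qed
  have R: "(\<lambda>k. T (d + 1 - k)) = R" by (simp add: R_def fun_eq_iff)
  show ?thesis
  proof (rule ereal_le_epsilon2)
    fix e :: real assume "0 < e"
    have "\<forall>\<^sub>F j in sequentially. ereal (L2_norm M (?A j)) \<le> ereal (box_seminorm M (\<lambda>k. T (d + 1 - k)) d (f 1)) + ereal e"
      using bound[OF \<open>0 < e\<close>] unfolding norm box R plus_ereal.simps ereal_less_eq .
    then show "limsup (\<lambda>j. ereal (L2_norm M (?A j)))
        \<le> ereal (box_seminorm M (\<lambda>k. T (d + 1 - k)) d (f 1)) + ereal e"
      by (rule Limsup_bounded)
  qed
qed

end
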